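(* Let $G$ be a connected vertex transitive graph with two ends. Then there exist positive integers $s,t$ and a cyclic system $\vec{\sigma}$ such that $G$ is $(s,t)$-ring-like and $2st$-cohesive with respect to $\vec{\sigma}$, and $\kappa_{\infty}(G) = st$.
   Context: Graphs are simple, undirected, locally finite. A ray is a one-way-infinite path; two rays are equivalent if for every finite vertex set $X$, the component of $G\setminus X$ containing infinitely many vertices of one also contains infinitely many vertices of the other; ends are the equivalence classes. $\kappa_\infty(G)=\inf\{|S|: S\subseteq V(G),\ G\setminus S \text{ has at least two infinite components}\}$. A system of imprimitivity is a partition of $V(G)$ into blocks permuted by every automorphism. A cyclic order on a set is a symmetric relation whose graph is a cycle or a two-way-infinite path. A cyclic system $\vec\sigma$ is a system of imprimitivity with a cyclic order on its blocks preserved by all automorphisms of $G$. For positive integers $s,t$, $G$ is $(s,t)$-ring-like with respect to $\vec\sigma$ if every block has size $s$ and adjacent vertices lie in blocks at cyclic-order distance at most $t$. $G$ is $q$-cohesive with respect to $\vec\sigma$ if any two vertices lying in the same block or in adjacent blocks (in the cyclic order) are joined by a path of length at most $q$. *)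

theory Defs
  imports "HOL-Library.Disjoint_Sets" "HOL-Library.Extended_Nat"
begin

record 'a graph =
  verts :: "'a set"
  edges :: "('a \<times> 'a) set"

text \<open>An undirected edge joining \<open>u\<close> and \<open>v\<close> is represented by both ordered pairs
  \<open>(u, v)\<close> and \<open>(v, u)\<close>.\<close>

definition simple_graph :: "'a graph \<Rightarrow> bool" where
  "simple_graph G \<longleftrightarrow> edges G \<subseteq> verts G \<times> verts G \<and> sym (edges G) \<and> irrefl (edges G)"

definition locally_finite_graph :: "'a graph \<Rightarrow> bool" where
  "locally_finite_graph G \<longleftrightarrow> (\<forall>v \<in> verts G. finite {u. (v, u) \<in> edges G})"

definition delete_verts :: "'a graph \<Rightarrow> 'a set \<Rightarrow> 'a graph" where
  "delete_verts G X =
     \<lparr>verts = verts G - X, edges = edges G \<inter> (verts G - X) \<times> (verts G - X)\<rparr>"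

definition path_betw :: "'a graph \<Rightarrow> 'a \<Rightarrow> 'a list \<Rightarrow> 'a \<Rightarrow> bool" where
  "path_betw G u p v \<longleftrightarrow>
     p \<noteq> [] \<and> hd p = u \<and> last p = v \<and> distinct p \<and> set p \<subseteq> verts G \<and>
     successively (\<lambda>x y. (x, y) \<in> edges G) p"

text \<open>Paths are given by their vertex lists; the length counts edges.\<close>

definition path_length :: "'a list \<Rightarrow> nat" where
  "path_length p = length p - 1"

definition graph_dist :: "'a graph \<Rightarrow> 'a \<Rightarrow> 'a \<Rightarrow> enat" where
  "graph_dist G u v = Inf {enat (path_length p) | p. path_betw G u p v}"

definition connected_graph :: "'a graph \<Rightarrow> bool" where
  "connected_graph G \<longleftrightarrow>
     verts G \<noteq> {} \<and> (\<forall>u \<in> verts G. \<forall>v \<in> verts G. \<exists>p. path_betw G u p v)"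

text \<open>Components are represented by their vertex sets.\<close>

definition components :: "'a graph \<Rightarrow> 'a set set" where
  "components G = {{v. \<exists>p. path_betw G u p v} | u. u \<in> verts G}"

definition rays :: "'a graph \<Rightarrow> (nat \<Rightarrow> 'a) set" where
  "rays G = {r. inj r \<and> range r \<subseteq> verts G \<and> (\<forall>i. (r i, r (Suc i)) \<in> edges G)}"

text \<open>For a ray \<open>r\<close> and a finite \<open>X\<close>, exactly one component of \<open>G - X\<close> contains infinitely many
  vertices of \<open>r\<close>; the equivalence below says that this component is the same for both rays.\<close>

definition ray_equiv :: "'a graph \<Rightarrow> ((nat \<Rightarrow> 'a) \<times> (nat \<Rightarrow> 'a)) set" where
  "ray_equiv G = {(r, q). r \<in> rays G \<and> q \<in> rays G \<and>
     (\<forall>X. finite X \<and> X \<subseteq> verts G \<longrightarrow>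
        (\<forall>C \<in> components (delete_verts G X).
           infinite (C \<inter> range r) \<longleftrightarrow> infinite (C \<inter> range q)))}"

lemma equiv_ray_equiv: "equiv (rays G) (ray_equiv G)"
  by (rule equivI) (auto simp: ray_equiv_def refl_on_def sym_def trans_def)

definition ends :: "'a graph \<Rightarrow> (nat \<Rightarrow> 'a) set set" where
  "ends G = rays G // ray_equiv G"

text \<open>\<open>card\<close> is \<open>0\<close> on infinite sets, hence the size taken in \<open>enat\<close>.\<close>

definition ecard :: "'a set \<Rightarrow> enat" where
  "ecard S = (if finite S then enat (card S) else \<infinity>)"

definition kappa_inf :: "'a graph \<Rightarrow> enat" where
  "kappa_inf G = Inf {ecard S | S. S \<subseteq> verts G \<and>
     (\<exists>C D. C \<in> components (delete_verts G S) \<and> D \<in> components (delete_verts G S) \<and>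
        C \<noteq> D \<and> infinite C \<and> infinite D)}"

text \<open>Only the values of an automorphism on the vertex set are relevant.\<close>

definition automorphism :: "'a graph \<Rightarrow> ('a \<Rightarrow> 'a) \<Rightarrow> bool" where
  "automorphism G f \<longleftrightarrow> bij_betw f (verts G) (verts G) \<and>
     (\<forall>u \<in> verts G. \<forall>v \<in> verts G. (u, v) \<in> edges G \<longleftrightarrow> (f u, f v) \<in> edges G)"

definition vertex_transitive :: "'a graph \<Rightarrow> bool" where
  "vertex_transitive G \<longleftrightarrow>
     (\<forall>u \<in> verts G. \<forall>v \<in> verts G. \<exists>f. automorphism G f \<and> f u = v)"

definition system_of_imprimitivity :: "'a graph \<Rightarrow> 'a set set \<Rightarrow> bool" where
  "system_of_imprimitivity G \<sigma> \<longleftrightarrow> partition_on (verts G) \<sigma> \<and>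
     (\<forall>f. automorphism G f \<longrightarrow> bij_betw (\<lambda>B. f ` B) \<sigma> \<sigma>)"

definition is_cycle :: "'b graph \<Rightarrow> bool" where
  "is_cycle H \<longleftrightarrow> (\<exists>n \<ge> 3. \<exists>b :: nat \<Rightarrow> 'b. bij_betw b {..<n} (verts H) \<and>
     edges H = {(b i, b j) | i j. i < n \<and> j < n \<and> (j = Suc i mod n \<or> i = Suc j mod n)})"

definition is_two_way_infinite_path :: "'b graph \<Rightarrow> bool" where
  "is_two_way_infinite_path H \<longleftrightarrow> (\<exists>b :: int \<Rightarrow> 'b. bij_betw b UNIV (verts H) \<and>
     edges H = {(b i, b j) | i j. j = i + 1 \<or> i = j + 1})"

definition order_graph :: "'b set \<Rightarrow> ('b \<times> 'b) set \<Rightarrow> 'b graph" where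
  "order_graph A R = \<lparr>verts = A, edges = R\<rparr>"

definition cyclic_order :: "'b set \<Rightarrow> ('b \<times> 'b) set \<Rightarrow> bool" where
  "cyclic_order A R \<longleftrightarrow>
     sym R \<and> (is_cycle (order_graph A R) \<or> is_two_way_infinite_path (order_graph A R))"

definition cyclic_system :: "'a graph \<Rightarrow> 'a set set \<Rightarrow> ('a set \<times> 'a set) set \<Rightarrow> bool" where
  "cyclic_system G \<sigma> R \<longleftrightarrow> system_of_imprimitivity G \<sigma> \<and> cyclic_order \<sigma> R \<and>
     (\<forall>f. automorphism G f \<longrightarrow>
        (\<forall>A \<in> \<sigma>. \<forall>B \<in> \<sigma>. (A, B) \<in> R \<longleftrightarrow> (f ` A, f ` B) \<in> R))"

definition ring_like ::
    "nat \<Rightarrow> nat \<Rightarrow> 'a graph \<Rightarrow> 'a set set \<Rightarrow> ('a set \<times> 'a set) set \<Rightarrow> bool" where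
  "ring_like s t G \<sigma> R \<longleftrightarrow>
     (\<forall>B \<in> \<sigma>. finite B \<and> card B = s) \<and>
     (\<forall>A \<in> \<sigma>. \<forall>B \<in> \<sigma>. \<forall>u \<in> A. \<forall>v \<in> B.
        (u, v) \<in> edges G \<longrightarrow> graph_dist (order_graph \<sigma> R) A B \<le> enat t)"

definition cohesive ::
    "nat \<Rightarrow> 'a graph \<Rightarrow> 'a set set \<Rightarrow> ('a set \<times> 'a set) set \<Rightarrow> bool" where
  "cohesive q G \<sigma> R \<longleftrightarrow>
     (\<forall>A \<in> \<sigma>. \<forall>B \<in> \<sigma>. A = B \<or> (A, B) \<in> R \<longrightarrow>
        (\<forall>u \<in> A. \<forall>v \<in> B. \<exists>p. path_betw G u p v \<and> path_length p \<le> q))"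

end

theory Submission
  imports Defs Complex_Main
begin

text \<open>
  Removing a large ball around \<open>v\<close> leaves exactly two infinite components; call \<open>A v\<close> the one towards a
  fixed end. Any two such sets differ by finitely many vertices, and counting this difference with
  signs gives an integer height on which every automorphism acts by a translation or a reflection. Its
  level sets are finite because \<open>A u\<close> and \<open>A v\<close> are strictly nested when \<open>u\<close> and \<open>v\<close> are far apart.

  The automorphisms that fix the ends have at most two orbits. If there are two, the heights of one
  orbit are shifted so that the edges between the orbits reach equally far up and down. After
  rescaling, the level sets are the blocks, and \<open>t\<close> is the maximal difference of levels along an
  edge. Edges of span \<open>t\<close>, of a suitable type, form a digraph in which a set of vertices never has fewer
  predecessors than elements. Summing this inequality over the levels of one side of a separator gives
  \<open>s * t\<close> as a lower bound for its size.

  For cohesion, let \<open>N\<close> be the number of weak components of this digraph and \<open>k\<close> the size of their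
  nonempty levels, so that \<open>N * k = s * t\<close>. By transitivity the number of components met by a ball
  grows with the radius, so a ball of radius \<open>N - 1\<close> meets all of them. Within a component, the number of
  \<open>r\<close>-fold predecessors of a vertex grows at least every second step until it reaches \<open>k\<close>, which
  yields common predecessors and walks of length at most \<open>2 * k\<close>. Altogether
  \<open>2 * N - 2 + 2 * k \<le> 2 * s * t\<close> steps suffice.
\<close>

text \<open>The obstacle is that with two orbits the raw height may be lopsided. A vertex of one
  orbit may reach far up into the other orbit and never equally far down; end-reversing
  automorphisms exchange the orbits and merely reproduce this picture. Edges of maximal span would
  then leave some vertices without predecessor, and the counting behind the lower bound would break
  down. But any shift of one orbit against the other is compatible with all automorphisms, and
  centring the height differences across the orbits gives every vertex a longest edge in both
  directions.

  The edges of maximal span are restricted to one type, inside the orbits or across them, so that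
  two consecutive ones return to the orbit they started from. Hence predecessor counts are
  comparable every second step, which is the origin of the factor 2 in the length of the walks. The
  same restriction confines each such edge to two equally large sets, one orbit at one height each,
  and double counting makes the out-degree of its tail equal to the in-degree of its head.\<close>

section \<open>Walks, paths and components as relations\<close>

lemma path_betw_imp_relpow:
  "path_betw H u p v \<Longrightarrow> (u, v) \<in> edges H ^^ path_length p"
proof (induction p arbitrary: u)
  case Nil
  then show ?case by (simp add: path_betw_def)
next
  case (Cons x q)
  show ?case
  proof (cases q)
    case Nil
    then show ?thesis using Cons.prems by (auto simp: path_betw_def path_length_def)
  next
    case (Cons y q')
    have "path_betw H y q v" "(x, y) \<in> edges H" "u = x"
      using Cons.prems Cons by (auto simp: path_betw_def)
    with Cons.IH have "(u, v) \<in> edges H ^^ Suc (path_length q)"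
      by (meson relpow_Suc_I2)
    then show ?thesis using Cons by (simp add: path_length_def)
  qed
qed

text \<open>A walk that returns to a vertex already visited is cut back to that visit, so the path
  may be shorter than the walk.\<close>

lemma relpow_imp_path_betw:
  assumes "edges H \<subseteq> verts H \<times> verts H" "u \<in> verts H" "(u, v) \<in> edges H ^^ n"
  shows "\<exists>p. path_betw H u p v \<and> path_length p \<le> n"
  using assms(3)
proof (induction n arbitrary: v)
  case 0
  then have "path_betw H u [u] v" using assms(2) by (simp add: path_betw_def)
  then show ?case by (auto simp: path_length_def intro!: exI[of _ "[u]"])
next
  case (Suc n)
  then obtain w where w: "(u, w) \<in> edges H ^^ n" "(w, v) \<in> edges H" by auto
  then obtain p where p: "path_betw H u p w" "path_length p \<le> n" using Suc.IH by blast
  show ?case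
  proof (cases "v \<in> set p")
    case True
    then obtain p1 p2 where eq: "p = (p1 @ [v]) @ p2" by (metis append.assoc append_Cons append_Nil split_list)
    have "successively (\<lambda>x y. (x, y) \<in> edges H) (p1 @ [v])"
      using p(1) unfolding eq path_betw_def successively_append_iff[of _ "p1 @ [v]"] by blast
    moreover have "hd (p1 @ [v]) = u" using p(1) unfolding eq path_betw_def by (cases p1) auto
    ultimately have "path_betw H u (p1 @ [v]) v"
      using p(1) unfolding eq path_betw_def by auto
    moreover have "path_length (p1 @ [v]) \<le> n" using p(2) by (simp add: eq path_length_def)
    ultimately show ?thesis using le_SucI by blast
  next
    case False
    have "path_betw H u (p @ [v]) v"
      using p(1) False w(2) assms(1) unfolding path_betw_def
      by (auto simp: successively_append_iff)
    moreover have "path_length (p @ [v]) \<le> Suc n"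
      using p by (auto simp: path_length_def path_betw_def)
    ultimately show ?thesis by blast
  qed
qed

lemma path_betw_iff_rtrancl:
  assumes "edges H \<subseteq> verts H \<times> verts H" "u \<in> verts H"
  shows "(\<exists>p. path_betw H u p v) \<longleftrightarrow> (u, v) \<in> (edges H)\<^sup>*"
  by (metis assms path_betw_imp_relpow relpow_imp_path_betw rtrancl_power)

lemma components_rtrancl:
  assumes "edges H \<subseteq> verts H \<times> verts H"
  shows "components H = (\<lambda>u. (edges H)\<^sup>* `` {u}) ` verts H"
proof -
  have "{v. \<exists>p. path_betw H u p v} = (edges H)\<^sup>* `` {u}" if "u \<in> verts H" for u
    using path_betw_iff_rtrancl[OF assms that] by auto
  then show ?thesis unfolding components_def by (simp add: Setcompr_eq_image cong: image_cong_simp)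
qed

section \<open>Connected, locally finite, vertex transitive graphs\<close>

locale vt_graph =
  fixes G :: "'a graph"
  assumes simple: "simple_graph G"
    and locally_finite: "locally_finite_graph G"
    and connected: "connected_graph G"
    and transitive: "vertex_transitive G"
begin

abbreviation "V \<equiv> verts G"
abbreviation "E \<equiv> edges G"
abbreviation "aut \<equiv> automorphism G"
abbreviation "comps X \<equiv> components (delete_verts G X)"

lemma edge_verts: "(x, y) \<in> E \<Longrightarrow> x \<in> V \<and> y \<in> V"
  using simple unfolding simple_graph_def by blast

lemma edge_sym: "(x, y) \<in> E \<Longrightarrow> (y, x) \<in> E"
  using simple unfolding simple_graph_def by (blast dest: symD)

lemma E_subset: "E \<subseteq> V \<times> V"
  using simple by (simp add: simple_graph_def)

lemma finite_nbrs: "finite (E `` {x})"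
proof (cases "x \<in> V")
  case True
  then show ?thesis
    using locally_finite by (auto simp: locally_finite_graph_def Image_def)
next
  case False
  then have "E `` {x} = {}" using edge_verts by blast
  then show ?thesis by simp
qed

lemma V_nonempty: "V \<noteq> {}"
  using connected by (simp add: connected_graph_def)

lemma connected_rtrancl: "x \<in> V \<Longrightarrow> y \<in> V \<Longrightarrow> (x, y) \<in> E\<^sup>*"
  using connected path_betw_iff_rtrancl[OF E_subset] by (auto simp: connected_graph_def)

lemma transitive_aut: "x \<in> V \<Longrightarrow> y \<in> V \<Longrightarrow> \<exists>f. aut f \<and> f x = y"
  using transitive by (auto simp: vertex_transitive_def)

subsection \<open>Automorphisms\<close>

lemma aut_in: "aut f \<Longrightarrow> x \<in> V \<Longrightarrow> f x \<in> V"
  by (auto simp: automorphism_def bij_betw_def)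

lemma aut_inj: "aut f \<Longrightarrow> inj_on f V"
  by (auto simp: automorphism_def bij_betw_def)

lemma aut_image: "aut f \<Longrightarrow> f ` V = V"
  by (auto simp: automorphism_def bij_betw_def)

lemma aut_edge: "aut f \<Longrightarrow> (x, y) \<in> E \<Longrightarrow> (f x, f y) \<in> E"
  using edge_verts[of x y] unfolding automorphism_def by blast

lemma aut_edge_iff: "aut f \<Longrightarrow> x \<in> V \<Longrightarrow> y \<in> V \<Longrightarrow> (f x, f y) \<in> E \<longleftrightarrow> (x, y) \<in> E"
  by (auto simp: automorphism_def)

lemma aut_comp: "aut f \<Longrightarrow> aut g \<Longrightarrow> aut (g \<circ> f)"
  unfolding automorphism_def using bij_betw_trans[of f V V g V] bij_betwE[of f V V] by auto

lemma aut_inverse: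
  assumes "aut f"
  obtains g where "aut g" "\<And>x. x \<in> V \<Longrightarrow> g (f x) = x" "\<And>x. x \<in> V \<Longrightarrow> f (g x) = x"
proof
  let ?g = "inv_into V f"
  have bij: "bij_betw f V V" using assms by (simp add: automorphism_def)
  show 1: "?g (f x) = x" if "x \<in> V" for x using that bij by (simp add: bij_betw_inv_into_left)
  show 2: "f (?g x) = x" if "x \<in> V" for x using that bij by (simp add: bij_betw_inv_into_right)
  have b: "bij_betw ?g V V" using bij by (rule bij_betw_inv_into)
  show "aut ?g" unfolding automorphism_def
  proof (intro conjI b ballI)
    fix u v assume uv: "u \<in> V" "v \<in> V"
    have "?g u \<in> V" "?g v \<in> V" using bij_betwE[OF b] uv by blast+
    then have "(f (?g u), f (?g v)) \<in> E \<longleftrightarrow> (?g u, ?g v) \<in> E" using assms aut_edge_iff by blast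
    then show "(u, v) \<in> E \<longleftrightarrow> (?g u, ?g v) \<in> E" using 2[OF uv(1)] 2[OF uv(2)] by simp
  qed
qed

subsection \<open>Balls\<close>

definition ball :: "'a \<Rightarrow> nat \<Rightarrow> 'a set" where
  "ball x n = {y. \<exists>i\<le>n. (x, y) \<in> E ^^ i}"

lemma ball_0 [simp]: "ball x 0 = {x}"
  by (auto simp: ball_def)

lemma ball_self [simp]: "x \<in> ball x n"
  by (auto simp: ball_def intro!: exI[of _ 0])

lemma ball_mono: "m \<le> n \<Longrightarrow> ball x m \<subseteq> ball x n"
  unfolding ball_def using le_trans by blast

lemma ball_trans: "y \<in> ball x m \<Longrightarrow> z \<in> ball y n \<Longrightarrow> z \<in> ball x (m + n)"
proof -
  assume "y \<in> ball x m" "z \<in> ball y n"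
  then obtain i j where "i \<le> m" "j \<le> n" "(x, y) \<in> E ^^ i" "(y, z) \<in> E ^^ j"
    unfolding ball_def by blast
  then have "i + j \<le> m + n" "(x, z) \<in> E ^^ (i + j)" by (auto simp: relpow_add)
  then show ?thesis unfolding ball_def by blast
qed

lemma relpow_E_sym: "(x, y) \<in> E ^^ n \<Longrightarrow> (y, x) \<in> E ^^ n"
proof (induction n arbitrary: y)
  case (Suc n)
  then show ?case by (metis edge_sym relpow_Suc_D2 relpow_Suc_E relpow_Suc_I2)
qed auto

lemma ball_sym: "y \<in> ball x n \<longleftrightarrow> x \<in> ball y n"
  unfolding ball_def using relpow_E_sym by blast

lemma ball_edge: "(x, y) \<in> E \<Longrightarrow> y \<in> ball x 1"
  unfolding ball_def by (auto intro!: exI[of _ 1])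

lemma ball_Suc: "ball x (Suc n) = ball x n \<union> E `` ball x n"
proof -
  have "y \<in> ball x n \<union> E `` ball x n" if y: "(x, y) \<in> E ^^ i" "i \<le> Suc n" for y i
  proof (cases i)
    case 0
    then show ?thesis using y by auto
  next
    case (Suc j)
    then show ?thesis using y unfolding ball_def by auto
  qed
  moreover have "E `` ball x n \<subseteq> ball x (Suc n)"
    using ball_trans[OF _ ball_edge] by fastforce
  moreover have "ball x n \<subseteq> ball x (Suc n)" by (rule ball_mono) simp
  moreover have "ball x (Suc n) \<subseteq> ball x n \<union> E `` ball x n"
    using calculation(1) by (subst ball_def) blast
  ultimately show ?thesis by blast
qed

lemma finite_ball: "finite (ball x n)"
proof (induction n)
  case (Suc n)
  have "E `` ball x n = (\<Union>y\<in>ball x n. E `` {y})" by auto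
  then show ?case using Suc finite_nbrs by (simp add: ball_Suc)
qed simp

lemma ball_V: "x \<in> V \<Longrightarrow> ball x n \<subseteq> V"
  by (induction n) (use edge_verts in \<open>auto simp: ball_Suc\<close>)

lemma ball_ex: "x \<in> V \<Longrightarrow> y \<in> V \<Longrightarrow> \<exists>n. y \<in> ball x n"
  unfolding ball_def using connected_rtrancl[of x y] by (auto simp: rtrancl_power)

lemma finite_subset_ball:
  assumes "finite X" "X \<subseteq> V" "x \<in> V"
  shows "\<exists>n. X \<subseteq> ball x n"
  using assms(1,2)
proof (induction X)
  case (insert y X)
  then obtain m n where "X \<subseteq> ball x m" "y \<in> ball x n" using ball_ex assms(3) by blast
  then have "insert y X \<subseteq> ball x (max m n)" using ball_mono[of m "max m n" x] ball_mono[of n "max m n" x] by auto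
  then show ?case by blast
qed simp

lemma aut_ball_subset: "aut f \<Longrightarrow> f ` ball x n \<subseteq> ball (f x) n"
  by (induction n) (use aut_edge in \<open>fastforce simp: ball_Suc\<close>)+

lemma aut_ball: 
  assumes "aut f" "x \<in> V"
  shows "f ` ball x n = ball (f x) n"
proof
  obtain g where g: "aut g" "\<And>x. x \<in> V \<Longrightarrow> g (f x) = x" "\<And>x. x \<in> V \<Longrightarrow> f (g x) = x"
    using assms aut_inverse by blast
  show "ball (f x) n \<subseteq> f ` ball x n"
  proof
    fix y assume y: "y \<in> ball (f x) n"
    then have "g y \<in> ball (g (f x)) n" using aut_ball_subset[OF g(1)] by blast
    then have "g y \<in> ball x n" using g assms by simp
    moreover have "y \<in> V" using y ball_V aut_in assms by blast
    ultimately show "y \<in> f ` ball x n" using g(3) by (metis imageI)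
  qed
qed (use aut_ball_subset assms in blast)

subsection \<open>Components\<close>

text \<open>That is, \<open>Y\<close> is a union of components of \<open>G\<close> minus
  \<open>X\<close>. Phrased by edges, the property is easy to transport along automorphisms and
  passes to larger \<open>X\<close>.\<close>

definition closed_off :: "'a set \<Rightarrow> 'a set \<Rightarrow> bool" where
  "closed_off X Y \<longleftrightarrow> Y \<subseteq> V - X \<and> (\<forall>x y. x \<in> Y \<longrightarrow> (x, y) \<in> E \<longrightarrow> y \<notin> X \<longrightarrow> y \<in> Y)"

definition conn_set :: "'a set \<Rightarrow> bool" where
  "conn_set Y \<longleftrightarrow> (\<forall>x\<in>Y. \<forall>y\<in>Y. (x, y) \<in> (E \<inter> Y \<times> Y)\<^sup>*)"

lemma comps_eq: "comps X = (\<lambda>u. (E \<inter> (V - X) \<times> (V - X))\<^sup>* `` {u}) ` (V - X)"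
  by (subst components_rtrancl) (auto simp: delete_verts_def)

text \<open>A walk inside \<open>Y\<close> never meets \<open>X\<close>, so it cannot leave
  \<open>C\<close>. Most inclusions between sides of separations are obtained this way.\<close>

lemma conn_set_closed_off:
  assumes "conn_set Y" "Y \<inter> X = {}" "closed_off X C" "x \<in> Y" "x \<in> C"
  shows "Y \<subseteq> C"
proof
  fix y assume "y \<in> Y"
  then have "(x, y) \<in> (E \<inter> Y \<times> Y)\<^sup>*" using assms by (simp add: conn_set_def)
  then show "y \<in> C"
    by induction (use assms in \<open>auto simp: closed_off_def\<close>)
qed

lemma comp_closed_off: "C \<in> comps X \<Longrightarrow> closed_off X C"
  unfolding comps_eq closed_off_def
proof (intro conjI allI impI)
  assume "C \<in> (\<lambda>u. (E \<inter> (V - X) \<times> (V - X))\<^sup>* `` {u}) ` (V - X)"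
  then obtain u where u: "u \<in> V - X" "C = (E \<inter> (V - X) \<times> (V - X))\<^sup>* `` {u}" by auto
  show C: "C \<subseteq> V - X"
  proof
    fix y assume "y \<in> C"
    then have "(u, y) \<in> (E \<inter> (V - X) \<times> (V - X))\<^sup>*" using u by simp
    then show "y \<in> V - X" by induction (use u in auto)
  qed
  fix x y assume "x \<in> C" "(x, y) \<in> E" "y \<notin> X"
  then have "(u, x) \<in> (E \<inter> (V - X) \<times> (V - X))\<^sup>*" "(x, y) \<in> E \<inter> (V - X) \<times> (V - X)"
    using u C edge_verts by auto
  then show "y \<in> C" using u(2) by (simp add: rtrancl.rtrancl_into_rtrancl)
qed

lemma comp_subset: "C \<in> comps X \<Longrightarrow> C \<subseteq> V - X"
  using comp_closed_off closed_off_def by blast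

lemma comp_ex: "x \<in> V - X \<Longrightarrow> \<exists>C\<in>comps X. x \<in> C"
  unfolding comps_eq by auto

lemma comp_nonempty: "C \<in> comps X \<Longrightarrow> C \<noteq> {}"
  unfolding comps_eq by auto

lemma comp_conn: assumes "C \<in> comps X" shows "conn_set C"
proof -
  let ?F = "E \<inter> (V - X) \<times> (V - X)"
  obtain u where u: "u \<in> V - X" "C = ?F\<^sup>* `` {u}" using assms unfolding comps_eq by auto
  have 1: "(u, y) \<in> (E \<inter> C \<times> C)\<^sup>*" if "y \<in> C" for y
  proof -
    have "(u, y) \<in> ?F\<^sup>*" using that u by simp
    then have "(u, y) \<in> (E \<inter> C \<times> C)\<^sup>* \<and> y \<in> C"
    proof induction
      case base then show ?case using u by simp
    next
      case (step y z)
      then have "z \<in> C" using comp_closed_off[OF assms] closed_off_def by blast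
      then have "(y, z) \<in> E \<inter> C \<times> C" using step by auto
      then show ?case using step \<open>z \<in> C\<close> by (meson rtrancl.rtrancl_into_rtrancl)
    qed
    then show ?thesis by simp
  qed
  have s: "sym ((E \<inter> C \<times> C)\<^sup>*)" by (rule sym_rtrancl) (use edge_sym in \<open>auto simp: sym_def\<close>)
  then show ?thesis unfolding conn_set_def using 1 by (meson rtrancl_trans symD)
qed

lemma comp_eqI: "C \<in> comps X \<Longrightarrow> D \<in> comps X \<Longrightarrow> x \<in> C \<Longrightarrow> x \<in> D \<Longrightarrow> C = D"
proof -
  assume a: "C \<in> comps X" "D \<in> comps X" "x \<in> C" "x \<in> D"
  have "C \<inter> X = {}" "D \<inter> X = {}" using a comp_subset by blast+
  then have "C \<subseteq> D" "D \<subseteq> C"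
    using a conn_set_closed_off[of C X D x] conn_set_closed_off[of D X C x] comp_conn comp_closed_off by blast+
  then show ?thesis by simp
qed

lemma comp_disjoint: "C \<in> comps X \<Longrightarrow> D \<in> comps X \<Longrightarrow> C \<noteq> D \<Longrightarrow> C \<inter> D = {}"
  using comp_eqI by blast

text \<open>Otherwise \<open>C\<close> would be closed under adjacency in the connected graph
  \<open>G\<close> and swallow \<open>X\<close>.\<close>

lemma comp_adjacent:
  assumes "C \<in> comps X" "X \<subseteq> V" "X \<noteq> {}"
  shows "\<exists>x\<in>X. \<exists>c\<in>C. (x, c) \<in> E"
proof (rule ccontr)
  assume no: "\<not> ?thesis"
  obtain c x where c: "c \<in> C" "x \<in> X" using comp_nonempty assms by blast
  have "(c, x) \<in> E\<^sup>*" using c assms comp_subset connected_rtrancl by blast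
  then have "x \<in> C"
  proof induction
    case (step y z)
    then show ?case using no comp_closed_off[OF assms(1)] edge_sym unfolding closed_off_def by blast
  qed (use c in simp)
  then show False using c comp_subset assms by blast
qed

text \<open>Each component contains a neighbour of \<open>X\<close>, and by local finiteness there
  are only finitely many of these. The case \<open>X = {}\<close> is separate: there the whole of
  \<open>V\<close> is the only component.\<close>

lemma finite_comps:
  assumes "finite X" "X \<subseteq> V"
  shows "finite (comps X)"
proof (cases "X = {}")
  case True
  have "C = D" if "C \<in> comps X" "D \<in> comps X" for C D
  proof -
    have "closed_off {} C" "closed_off {} D" "C \<noteq> {}" "D \<noteq> {}"
      using that True comp_closed_off comp_nonempty by blast+
    moreover have "conn_set V"
      using connected_rtrancl E_subset unfolding conn_set_def by (simp add: Int_absorb2)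
    moreover have "C \<subseteq> V" "D \<subseteq> V" using that comp_subset by blast+
    ultimately have "V \<subseteq> C" "V \<subseteq> D"
      using conn_set_closed_off[of V "{}"] by blast+
    then show ?thesis using \<open>C \<subseteq> V\<close> \<open>D \<subseteq> V\<close> by blast
  qed
  then have "comps X \<subseteq> {SOME C. C \<in> comps X}"
    by (metis True singleton_iff someI subsetI)
  then show ?thesis by (rule finite_subset) simp
next
  case False
  define S where "S = (\<Union>x\<in>X. E `` {x})"
  have "finite S" using assms finite_nbrs by (simp add: S_def)
  have "\<exists>c\<in>S. c \<in> C" if "C \<in> comps X" for C
    using comp_adjacent[OF that assms(2) False] by (auto simp: S_def)
  then obtain g where g: "\<And>C. C \<in> comps X \<Longrightarrow> g C \<in> S \<and> g C \<in> C" by metis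
  have "inj_on g (comps X)" by (rule inj_onI) (metis g comp_eqI)
  moreover have "g ` comps X \<subseteq> S" using g by blast
  ultimately show ?thesis using \<open>finite S\<close> by (meson finite_imageD finite_subset)
qed

lemma infinite_comp_ex:
  assumes "finite X" "X \<subseteq> V" "closed_off X Y" "infinite Y"
  shows "\<exists>C\<in>comps X. infinite C \<and> C \<subseteq> Y"
proof (rule ccontr)
  assume no: "\<not> ?thesis"
  have "Y \<subseteq> \<Union> {C \<in> comps X. C \<subseteq> Y}"
  proof
    fix y assume y: "y \<in> Y"
    then obtain C where C: "C \<in> comps X" "y \<in> C" using comp_ex assms closed_off_def by blast
    then have "C \<subseteq> Y" using conn_set_closed_off[OF comp_conn[OF C(1)] _ assms(3), of y] y comp_subset by blast
    then show "y \<in> \<Union> {C \<in> comps X. C \<subseteq> Y}" using C by blast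
  qed
  moreover have "finite (\<Union> {C \<in> comps X. C \<subseteq> Y})"
    using no finite_comps[OF assms(1,2)] by auto
  ultimately show False using assms finite_subset by blast
qed

lemma aut_conn_set:
  assumes "aut f" "conn_set Y"
  shows "conn_set (f ` Y)"
proof -
  have "(f x, f y) \<in> (E \<inter> f ` Y \<times> f ` Y)\<^sup>*" if "(x, y) \<in> (E \<inter> Y \<times> Y)\<^sup>*" for x y
    using that
  proof induction
    case (step y z)
    then have "(f y, f z) \<in> E \<inter> f ` Y \<times> f ` Y" using aut_edge assms by auto
    then show ?case using step by (meson rtrancl.rtrancl_into_rtrancl)
  qed simp
  then show ?thesis using assms unfolding conn_set_def by blast
qed

lemma aut_closed_off:
  assumes "aut f" "closed_off X Y" "X \<subseteq> V"
  shows "closed_off (f ` X) (f ` Y)"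
proof -
  obtain g where g: "aut g" "\<And>x. x \<in> V \<Longrightarrow> g (f x) = x" "\<And>x. x \<in> V \<Longrightarrow> f (g x) = x"
    using assms aut_inverse by blast
  have YV: "Y \<subseteq> V - X" using assms closed_off_def by blast
  show ?thesis unfolding closed_off_def
  proof (intro conjI allI impI)
    show "f ` Y \<subseteq> V - f ` X" using YV aut_in[OF assms(1)] aut_inj[OF assms(1)] assms(3)
      by (auto dest: inj_onD)
    fix x y assume x: "x \<in> f ` Y" and e: "(x, y) \<in> E" and y: "y \<notin> f ` X"
    have "(g x, g y) \<in> E" using e g aut_edge by blast
    moreover have "g x \<in> Y" using x g YV by auto
    moreover have "g y \<notin> X" using y g(3) e edge_verts by (metis imageI)
    ultimately have "g y \<in> Y" using assms closed_off_def by blast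
    then show "y \<in> f ` Y" using g(3) e edge_verts by (metis imageI)
  qed
qed

text \<open>Both properties on the right are visibly preserved by automorphisms, hence so are
  components.\<close>

lemma comp_iff:
  "C \<in> comps X \<longleftrightarrow> closed_off X C \<and> conn_set C \<and> C \<noteq> {}"
proof
  assume C: "closed_off X C \<and> conn_set C \<and> C \<noteq> {}"
  then obtain x where x: "x \<in> C" by blast
  then obtain D where D: "D \<in> comps X" "x \<in> D" using C comp_ex closed_off_def by blast
  have "C \<inter> X = {}" "D \<inter> X = {}" using C D comp_subset closed_off_def by blast+
  then have "C = D" using conn_set_closed_off[of C X D x] conn_set_closed_off[of D X C x]
      C D x comp_conn comp_closed_off by blast
  then show "C \<in> comps X" using D by simp
qed (use comp_closed_off comp_conn comp_nonempty in blast)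

lemma aut_comp_image: "aut f \<Longrightarrow> X \<subseteq> V \<Longrightarrow> C \<in> comps X \<Longrightarrow> f ` C \<in> comps (f ` X)"
  using comp_iff aut_closed_off aut_conn_set by auto

lemma ball_conn_set: "conn_set (ball x n)"
proof -
  let ?B = "ball x n"
  have *: "(x, y) \<in> (E \<inter> ?B \<times> ?B)\<^sup>*" if "y \<in> ball x m" "m \<le> n" for y m
    using that
  proof (induction m arbitrary: y)
    case (Suc m)
    show ?case
    proof (cases "y \<in> ball x m")
      case True then show ?thesis using Suc by simp
    next
      case False
      then obtain z where z: "z \<in> ball x m" "(z, y) \<in> E" using Suc by (auto simp: ball_Suc)
      then have "(z, y) \<in> E \<inter> ?B \<times> ?B" using Suc.prems ball_mono[of m n x] ball_mono[of "Suc m" n x] by auto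
      then show ?thesis using Suc.IH[OF z(1)] Suc.prems by (meson Suc_leD rtrancl.rtrancl_into_rtrancl)
    qed
  qed simp
  have s: "sym ((E \<inter> ?B \<times> ?B)\<^sup>*)" by (rule sym_rtrancl) (use edge_sym in \<open>auto simp: sym_def\<close>)
  then show ?thesis unfolding conn_set_def using *[of _ n] by (meson rtrancl_trans symD order_refl)
qed

end

subsection \<open>Rays and separations\<close>

context vt_graph
begin

text \<open>Koenig's lemma on the geodesics issuing from \<open>v\<close> inside \<open>Y\<close>:
  some neighbour one step further from \<open>v\<close> always has infinitely many vertices behind
  it. Distances from \<open>v\<close> increase along the resulting sequence, so it is
  injective.\<close>

lemma infinite_conn_set_ray:
  assumes "conn_set Y" "infinite Y" "Y \<subseteq> V"
  shows "\<exists>r\<in>rays G. range r \<subseteq> Y"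
proof -
  obtain v where v: "v \<in> Y" using assms by (metis finite.emptyI all_not_in_conv)
  define F where "F = E \<inter> Y \<times> Y"
  define d where "d y = (LEAST n. (v, y) \<in> F ^^ n)" for y
  \<comment> \<open>The vertices that a shortest walk from \<open>v\<close> inside \<open>Y\<close>
    can reach through \<open>x\<close>.\<close>
  define T where "T x = {y. \<exists>k. (x, y) \<in> F ^^ k \<and> d y = d x + k}" for x
  have d: "(v, y) \<in> F ^^ d y" if "y \<in> Y" for y
  proof -
    have "(v, y) \<in> F\<^sup>*" using assms(1) v that unfolding conn_set_def F_def by blast
    then show ?thesis unfolding d_def rtrancl_power by (rule LeastI_ex)
  qed
  have d_le: "d y \<le> n" if "(v, y) \<in> F ^^ n" for y n
    unfolding d_def using that by (rule Least_le)
  have "d v = 0" using d_le[of v 0] by simp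
  have "Y \<subseteq> T v" unfolding T_def using d \<open>d v = 0\<close> by auto
  then have Tv: "infinite (T v)" using assms finite_subset by blast
  have step: "\<exists>x'. (x' \<in> Y \<and> infinite (T x')) \<and> ((x, x') \<in> E \<and> d x' = Suc (d x))"
    if x: "x \<in> Y \<and> infinite (T x)" for x
  proof (rule ccontr)
    assume no: "\<not> ?thesis"
    define S where "S = {x'. (x, x') \<in> F \<and> d x' = Suc (d x)}"
    have "S \<subseteq> E `` {x}" unfolding S_def F_def by blast
    then have "finite S" using finite_nbrs finite_subset by blast
    moreover have "finite (T x')" if "x' \<in> S" for x' using no that unfolding S_def F_def by blast
    moreover have "T x \<subseteq> {x} \<union> (\<Union>x'\<in>S. T x')"
    proof
      fix y assume "y \<in> T x"
      then obtain k where k: "(x, y) \<in> F ^^ k" "d y = d x + k" unfolding T_def by blast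
      show "y \<in> {x} \<union> (\<Union>x'\<in>S. T x')"
      proof (cases k)
        case 0
        then show ?thesis using k by simp
      next
        case (Suc j)
        then obtain x' where x': "(x, x') \<in> F" "(x', y) \<in> F ^^ j"
          using k(1) by (metis relpow_Suc_D2)
        have vx: "(v, x) \<in> F ^^ d x" using d x by blast
        then have "d x' \<le> Suc (d x)" using x'(1) by (intro d_le) auto
        moreover have x'Y: "x' \<in> Y" using x' F_def by blast
        have "(v, y) \<in> F ^^ (d x' + j)" using d[OF x'Y] x'(2) by (auto simp: relpow_add)
        then have "d y \<le> d x' + j" by (rule d_le)
        ultimately have "d x' = Suc (d x)" using k Suc by simp
        then show ?thesis using x' k Suc unfolding S_def T_def by auto
      qed
    qed
    ultimately have "finite (T x)" by (meson finite.emptyI finite.insertI finite_UN_I finite_UnI finite_subset)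
    then show False using x by simp
  qed
  have ex: "\<exists>r. r 0 = v \<and> (\<forall>n. (r n \<in> Y \<and> infinite (T (r n))) \<and> ((r n, r (Suc n)) \<in> E \<and> d (r (Suc n)) = Suc (d (r n))))"
  proof -
    define nxt where "nxt x = (SOME x'. (x' \<in> Y \<and> infinite (T x')) \<and> ((x, x') \<in> E \<and> d x' = Suc (d x)))" for x
    have nxt: "(nxt x \<in> Y \<and> infinite (T (nxt x))) \<and> ((x, nxt x) \<in> E \<and> d (nxt x) = Suc (d x))"
      if "x \<in> Y \<and> infinite (T x)" for x
      unfolding nxt_def by (rule someI_ex) (rule step[OF that])
    define r where "r n = (nxt ^^ n) v" for n
    have "r n \<in> Y \<and> infinite (T (r n))" for n
      by (induction n) (use v Tv nxt in \<open>auto simp: r_def\<close>)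
    then show ?thesis using nxt by (intro exI[of _ r]) (auto simp: r_def)
  qed
  then obtain r where r: "r 0 = v" "\<And>n. r n \<in> Y" "\<And>n. (r n, r (Suc n)) \<in> E"
    "\<And>n. d (r (Suc n)) = Suc (d (r n))" by blast
  have "d (r n) = n" for n by (induction n) (use r \<open>d v = 0\<close> in auto)
  then have "inj r" by (metis injI)
  then have "r \<in> rays G" using r assms unfolding rays_def by blast
  then show ?thesis using r by blast
qed

definition sep :: "'a set \<Rightarrow> 'a set \<Rightarrow> 'a set \<Rightarrow> bool" where
  "sep X C D \<longleftrightarrow> finite X \<and> X \<subseteq> V \<and> C \<in> comps X \<and> D \<in> comps X \<and> C \<noteq> D \<and> infinite C \<and> infinite D"

lemma sep_disjoint: "sep X C D \<Longrightarrow> C \<inter> D = {}"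
  using comp_disjoint unfolding sep_def by blast

lemma neq_if_disjoint:
  assumes "c \<subseteq> C" "d \<subseteq> D" "C \<inter> D = {}" "infinite c"
  shows "c \<noteq> d"
proof
  assume "c = d"
  then have "c = {}" using assms(1-3) by blast
  then show False using assms(4) by simp
qed

lemma sep_commute: "sep X C D \<Longrightarrow> sep X D C"
  unfolding sep_def by blast

section \<open>Commensurable sets and their relative index\<close>

definition comm :: "'a set \<Rightarrow> 'a set \<Rightarrow> bool" where
  "comm A B \<longleftrightarrow> finite (A - B) \<and> finite (B - A)"

lemma comm_sym: "comm A B \<Longrightarrow> comm B A"
  by (auto simp: comm_def)

lemma comm_trans: "comm A B \<Longrightarrow> comm B C \<Longrightarrow> comm A C"
proof -
  assume "comm A B" "comm B C"
  then have "finite ((A - B) \<union> (B - C))" "finite ((C - B) \<union> (B - A))" by (auto simp: comm_def)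
  moreover have "A - C \<subseteq> (A - B) \<union> (B - C)" "C - A \<subseteq> (C - B) \<union> (B - A)" by blast+
  ultimately show ?thesis unfolding comm_def by (meson finite_subset)
qed

lemma comm_infinite: "comm A B \<Longrightarrow> infinite A \<Longrightarrow> A \<inter> B \<noteq> {}"
  unfolding comm_def by (metis Diff_triv)

lemma comm_image: "inj_on f V \<Longrightarrow> A \<subseteq> V \<Longrightarrow> B \<subseteq> V \<Longrightarrow> comm A B \<Longrightarrow> comm (f ` A) (f ` B)"
proof -
  assume a: "inj_on f V" "A \<subseteq> V" "B \<subseteq> V" "comm A B"
  have "f ` A - f ` B \<subseteq> f ` (A - B)" "f ` B - f ` A \<subseteq> f ` (B - A)" by blast+
  then show ?thesis using a(4) unfolding comm_def by (meson finite_imageI finite_subset)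
qed

text \<open>For commensurable infinite sets this replaces the difference of sizes, and
  \<open>ind_add\<close> makes it behave like one. It is meaningful only under \<open>comm\<close>,
  since \<open>card\<close> is 0 on infinite sets.\<close>

definition ind :: "'a set \<Rightarrow> 'a set \<Rightarrow> int" where
  "ind A B = int (card (A - B)) - int (card (B - A))"

lemma ind_add:
  assumes "comm A B" "comm B C"
  shows "ind A C = ind A B + ind B C"
proof -
  have fin: "finite (A - B)" "finite (B - A)" "finite (B - C)" "finite (C - B)" "finite (A - C)" "finite (C - A)"
    using assms comm_trans[OF assms] by (auto simp: comm_def)
  have split: "card Z = card X + card Y" if "finite Z" "Z = X \<union> Y" "X \<inter> Y = {}" for X Y Z :: "'a set"
    using that by (simp add: card_Un_disjoint)
  have "card (A - B) = card (A - B - C) + card (A \<inter> C - B)"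
    by (rule split[OF fin(1)]) blast+
  moreover have "card (B - A) = card (B - A - C) + card (B \<inter> C - A)"
    by (rule split[OF fin(2)]) blast+
  moreover have "card (B - C) = card (B - A - C) + card (A \<inter> B - C)"
    by (rule split[OF fin(3)]) blast+
  moreover have "card (C - B) = card (C - A - B) + card (A \<inter> C - B)"
    by (rule split[OF fin(4)]) blast+
  moreover have "card (A - C) = card (A - B - C) + card (A \<inter> B - C)"
    by (rule split[OF fin(5)]) blast+
  moreover have "card (C - A) = card (C - A - B) + card (B \<inter> C - A)"
    by (rule split[OF fin(6)]) blast+
  ultimately show ?thesis by (simp add: ind_def)
qed

lemma ind_swap: "ind B A = - ind A B"
  by (simp add: ind_def)

lemma ind_image:
  assumes "inj_on f V" "A \<subseteq> V" "B \<subseteq> V"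
  shows "ind (f ` A) (f ` B) = ind A B"
proof -
  have *: "card (f ` A - f ` B) = card (A - B)" if "A \<subseteq> V" "B \<subseteq> V" for A B
  proof -
    have "f ` (A - B) = f ` A - f ` B"
      using inj_on_image_set_diff[OF assms(1), of A B] that by blast
    moreover have "inj_on f (A - B)" using assms(1) that by (meson Diff_subset inj_on_subset subset_trans)
    ultimately show ?thesis by (metis card_image)
  qed
  show ?thesis unfolding ind_def using *[OF assms(2,3)] *[OF assms(3,2)] by simp
qed

lemma closed_off_Diff: "closed_off X C \<Longrightarrow> X \<subseteq> Z \<Longrightarrow> closed_off Z (C - Z)"
  unfolding closed_off_def by blast

lemma infinite_subcomp:
  assumes "sep X C D" "finite Z" "Z \<subseteq> V" "X \<subseteq> Z"
  shows "\<exists>c\<in>comps Z. infinite c \<and> c \<subseteq> C"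
proof -
  have "closed_off Z (C - Z)" using closed_off_Diff comp_closed_off assms unfolding sep_def by blast
  moreover have "infinite (C - Z)" using assms unfolding sep_def by simp
  ultimately show ?thesis using infinite_comp_ex[of Z "C - Z"] assms by blast
qed

lemma aut_sep:
  assumes "aut f" "sep X C D"
  shows "sep (f ` X) (f ` C) (f ` D)"
proof -
  have s: "finite X" "X \<subseteq> V" "C \<in> comps X" "D \<in> comps X" "C \<noteq> D" "infinite C" "infinite D"
    using assms(2) unfolding sep_def by blast+
  have V: "C \<subseteq> V" "D \<subseteq> V" using s comp_subset by blast+
  have inj: "inj_on f C" "inj_on f D" using V aut_inj[OF assms(1)] inj_on_subset by blast+
  have "f ` C \<noteq> f ` D"
    using V aut_inj[OF assms(1)] s(5) inj_on_image_eq_iff[of f V C D] by simp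
  moreover have "f ` X \<subseteq> V" using s(2) aut_in[OF assms(1)] by blast
  moreover have "infinite (f ` C)" "infinite (f ` D)" using inj s finite_imageD by blast+
  ultimately show ?thesis
    unfolding sep_def using s aut_comp_image[OF assms(1) s(2)] by blast
qed

text \<open>\<open>D\<close> is connected, avoids \<open>X'\<close> and meets \<open>D'\<close>, so
  it lies in \<open>D'\<close>. The connected set \<open>X\<close> has a neighbour in
  \<open>D\<close> and is disjoint from \<open>X'\<close>, so it lies in \<open>D'\<close> too.
  Hence \<open>C'\<close> avoids \<open>X\<close>, and since it meets \<open>C\<close> it is
  contained in \<open>C\<close>.\<close>

lemma sep_nested:
  assumes "sep X C D" "sep X' C' D'" "comm C C'" "comm D D'"
    and "X' \<subseteq> C" "conn_set X" "X \<noteq> {}"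
  shows "C' \<subseteq> C" "X' \<subseteq> C - C'"
proof -
  have sub: "C \<subseteq> V - X" "D \<subseteq> V - X" "C' \<subseteq> V - X'" "D' \<subseteq> V - X'"
    and comps: "C \<in> comps X" "D \<in> comps X" "C' \<in> comps X'" "D' \<in> comps X'" and inf: "infinite D" "infinite C"
    using assms(1,2) comp_subset by (auto simp: sep_def)
  have "D \<inter> X' = {}" using sep_disjoint[OF assms(1)] assms(5) by blast
  obtain x where "x \<in> D" "x \<in> D'" using comm_infinite[OF assms(4) inf(1)] by blast
  then have D: "D \<subseteq> D'"
    using conn_set_closed_off[OF comp_conn[OF comps(2)] \<open>D \<inter> X' = {}\<close> comp_closed_off[OF comps(4)]] by blast
  obtain y d where y: "y \<in> X" "d \<in> D" "(y, d) \<in> E"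
    using comp_adjacent[OF comps(2)] assms(1,7) by (auto simp: sep_def)
  have XX': "X \<inter> X' = {}" using assms(5) sub by blast
  have "y \<in> D'" using y D XX' edge_sym comp_closed_off[OF comps(4)] unfolding closed_off_def by blast
  then have X: "X \<subseteq> D'"
    using conn_set_closed_off[OF assms(6) XX' comp_closed_off[OF comps(4)]] y by blast
  then have "C' \<inter> X = {}" using sep_disjoint[OF assms(2)] by blast
  moreover obtain z where "z \<in> C" "z \<in> C'" using comm_infinite[OF assms(3) inf(2)] by blast
  ultimately show "C' \<subseteq> C"
    using conn_set_closed_off[OF comp_conn[OF comps(3)] _ comp_closed_off[OF comps(1)]] by blast
  then show "X' \<subseteq> C - C'" using assms(5) sub by blast
qed

end

section \<open>Separations of a two-ended graph\<close>

locale two_ended = vt_graph +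
  assumes two_ends: "card (ends G) = 2"
begin

text \<open>Every infinite component carries a ray, and rays in different components are
  inequivalent, so three of them would give three ends.\<close>

lemma three_infinite_comps:
  assumes "finite X" "X \<subseteq> V" "C \<in> comps X" "D \<in> comps X" "F \<in> comps X"
    and "infinite C" "infinite D" "infinite F"
  shows "C = D \<or> C = F \<or> D = F"
proof (rule ccontr)
  assume no: "\<not> ?thesis"
  have ray: "\<exists>r\<in>rays G. range r \<subseteq> C" if "C \<in> comps X" "infinite C" for C
    using infinite_conn_set_ray[OF comp_conn[OF that(1)] that(2)] comp_subset that by blast
  obtain r1 r2 r3 where r: "r1 \<in> rays G" "range r1 \<subseteq> C" "r2 \<in> rays G" "range r2 \<subseteq> D" "r3 \<in> rays G" "range r3 \<subseteq> F"
    using ray assms by meson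
  have neq: "ray_equiv G `` {r} \<noteq> ray_equiv G `` {q}"
    if "r \<in> rays G" "q \<in> rays G" "range r \<subseteq> A" "range q \<subseteq> B" "A \<in> comps X" "B \<in> comps X" "A \<noteq> B" for r q A B
  proof
    assume "ray_equiv G `` {r} = ray_equiv G `` {q}"
    then have "(r, q) \<in> ray_equiv G" using eq_equiv_class[OF _ equiv_ray_equiv] that by metis
    then have "infinite (A \<inter> range r) \<longleftrightarrow> infinite (A \<inter> range q)"
      using that assms unfolding ray_equiv_def by blast
    moreover have "A \<inter> range r = range r" "A \<inter> range q = {}" using that comp_disjoint[of A X B] by blast+
    moreover have "infinite (range r)" using that by (auto simp: rays_def range_inj_infinite)
    ultimately show False by simp
  qed
  let ?S = "{ray_equiv G `` {r1}, ray_equiv G `` {r2}, ray_equiv G `` {r3}}"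
  have "card ?S = 3"
    using neq[OF r(1) r(3) r(2) r(4)] neq[OF r(1) r(5) r(2) r(6)] neq[OF r(3) r(5) r(4) r(6)] assms no by simp
  moreover have "?S \<subseteq> ends G" using r by (auto simp: ends_def quotientI)
  moreover have "finite (ends G)" using two_ends by (metis card.infinite zero_neq_numeral)
  ultimately show False using card_mono[of "ends G" ?S] two_ends by simp
qed

text \<open>Inequivalent rays are told apart by some finite \<open>X\<close>: a component holds
  infinitely many vertices of one ray and only finitely many of the other, so infinitely many
  vertices remain outside this component and \<open>X\<close>.\<close>

lemma sep_ex: "\<exists>X C D. sep X C D"
proof -
  obtain e1 e2 where e: "e1 \<in> ends G" "e2 \<in> ends G" "e1 \<noteq> e2"
    using two_ends by (metis card_2_iff' )
  then obtain r q where rq: "r \<in> rays G" "q \<in> rays G" "e1 = ray_equiv G `` {r}" "e2 = ray_equiv G `` {q}"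
    unfolding ends_def quotient_def by blast
  then have nrq: "(r, q) \<notin> ray_equiv G" using e equiv_class_eq[OF equiv_ray_equiv] by metis
  have *: "\<exists>X C D. sep X C D" if "r \<in> rays G" "q \<in> rays G" "finite X" "X \<subseteq> V" "C \<in> comps X"
    "infinite (C \<inter> range r)" "finite (C \<inter> range q)" for r q X C
  proof -
    have "closed_off X (V - X - C)"
      using comp_closed_off[OF that(5)] edge_verts edge_sym unfolding closed_off_def by blast
    moreover have "infinite (V - X - C)"
    proof
      assume "finite (V - X - C)"
      moreover have "range q \<subseteq> (V - X - C) \<union> X \<union> (C \<inter> range q)" using that by (auto simp: rays_def)
      ultimately have "finite (range q)" using that by (meson finite_UnI finite_subset)
      then show False using that by (auto simp: rays_def range_inj_infinite)
    qed
    ultimately have "\<exists>D\<in>comps X. infinite D \<and> D \<subseteq> V - X - C"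
      by (rule infinite_comp_ex[OF that(3,4)])
    then obtain D where D: "D \<in> comps X" "infinite D" "D \<subseteq> V - X - C" by blast
    moreover have "infinite C" using that(6) by blast
    moreover have "C \<noteq> D" using D comp_nonempty[OF D(1)] by blast
    ultimately have "sep X C D" using that(3-5) unfolding sep_def by blast
    then show ?thesis by blast
  qed
  from nrq rq(1,2) obtain X C where "finite X" "X \<subseteq> V" "C \<in> comps X"
    "infinite (C \<inter> range r) \<noteq> infinite (C \<inter> range q)"
    unfolding ray_equiv_def by blast
  then show ?thesis using *[OF rq(1,2)] *[OF rq(2,1)] by blast
qed

lemma finite_outside_sep:
  assumes "sep X C D"
  shows "finite (V - C - D)"
proof -
  have X: "finite X" "X \<subseteq> V" using assms by (auto simp: sep_def)
  have "V - C - D \<subseteq> X \<union> \<Union> {F \<in> comps X. finite F}"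
  proof
    fix x assume x: "x \<in> V - C - D"
    show "x \<in> X \<union> \<Union> {F \<in> comps X. finite F}"
    proof (cases "x \<in> X")
      case False
      then obtain F where F: "F \<in> comps X" "x \<in> F" using x comp_ex by blast
      then have "finite F" using three_infinite_comps[OF X, of C D F] assms x by (auto simp: sep_def)
      then show ?thesis using F by blast
    qed simp
  qed
  moreover have "finite (X \<union> \<Union> {F \<in> comps X. finite F})"
    using X finite_comps[OF X] by auto
  ultimately show ?thesis by (rule finite_subset)
qed

text \<open>Deleting both separators still leaves exactly two infinite components and finitely many
  other vertices. Each of the four sides contains exactly one of these components, up to a finite
  set.\<close>

lemma sep_comm:
  assumes "sep X C D" "sep X' C' D'"
  shows "comm C C' \<and> comm D D' \<or> comm C D' \<and> comm D C'"
proof -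
  let ?Z = "X \<union> X'"
  have Z: "finite ?Z" "?Z \<subseteq> V" using assms by (auto simp: sep_def)
  obtain c d c' d' where
    c: "c \<in> comps ?Z" "infinite c" "c \<subseteq> C" and d: "d \<in> comps ?Z" "infinite d" "d \<subseteq> D" and
    c': "c' \<in> comps ?Z" "infinite c'" "c' \<subseteq> C'" and d': "d' \<in> comps ?Z" "infinite d'" "d' \<subseteq> D'"
    using infinite_subcomp[OF assms(1) Z] infinite_subcomp[OF assms(2) Z]
      infinite_subcomp[OF sep_commute[OF assms(1)] Z] infinite_subcomp[OF sep_commute[OF assms(2)] Z] by blast
  have disj: "C \<inter> D = {}" "C' \<inter> D' = {}" using sep_disjoint assms by blast+
  have cd: "c \<noteq> d" "c' \<noteq> d'"
    using neq_if_disjoint[OF c(3) d(3) disj(1) c(2)] neq_if_disjoint[OF c'(3) d'(3) disj(2) c'(2)] by blast+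
  then have "sep ?Z c d" using c d Z by (simp add: sep_def)
  then have fin: "finite (V - c - d)" by (rule finite_outside_sep)
  have "C \<in> comps X" "D \<in> comps X" "C' \<in> comps X'" "D' \<in> comps X'" using assms by (auto simp: sep_def)
  then have V: "C \<subseteq> V" "D \<subseteq> V" "C' \<subseteq> V" "D' \<subseteq> V" using comp_subset by blast+
  have *: "comm A B" if "A \<subseteq> V" "B \<subseteq> V" "a \<subseteq> A" "a \<subseteq> B" "A \<inter> b = {}" "B \<inter> b = {}" "finite (V - a - b)" for A B a b
  proof -
    have "A - B \<subseteq> V - a - b" "B - A \<subseteq> V - a - b" using that by blast+
    then show ?thesis unfolding comm_def using that(7) finite_subset by blast
  qed
  have fin': "finite (V - d - c)" using fin by (simp add: Diff_eq Int_ac)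
  have "c' = c \<and> d' = d \<or> c' = d \<and> d' = c"
    using three_infinite_comps[OF Z c(1) d(1) c'(1) c(2) d(2) c'(2)]
      three_infinite_comps[OF Z c(1) d(1) d'(1) c(2) d(2) d'(2)] cd by argo
  moreover have e: "C \<inter> d = {}" "D \<inter> c = {}" "C' \<inter> d' = {}" "D' \<inter> c' = {}"
    using disj c(3) d(3) c'(3) d'(3) by blast+
  ultimately show ?thesis
  proof (elim disjE)
    assume "c' = c \<and> d' = d"
    then have "comm C C'" "comm D D'"
      using *[OF V(1,3) c(3)] *[OF V(2,4) d(3)] c'(3) d'(3) e fin fin' by simp_all
    then show ?thesis by simp
  next
    assume "c' = d \<and> d' = c"
    then have "comm C D'" "comm D C'"
      using *[OF V(1,4) c(3)] *[OF V(2,3) d(3)] c'(3) d'(3) e fin fin' by simp_all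
    then show ?thesis by simp
  qed
qed

text \<open>One separator is enlarged to a ball, because automorphisms map balls to balls of the
  same radius; transitivity then supplies a separation around every vertex. Its two sides are named
  so as to be commensurable with those at the starting vertex.\<close>

lemma oriented_ex:
  "\<exists>R plus minus. \<forall>v\<in>V. sep (ball v R) (plus v) (minus v) \<and>
     (\<forall>u\<in>V. comm (plus u) (plus v) \<and> comm (minus u) (minus v))"
proof -
  obtain X0 C0 D0 where 0: "sep X0 C0 D0" using sep_ex by blast
  obtain v0 where v0: "v0 \<in> V" using V_nonempty by blast
  obtain R where R: "X0 \<subseteq> ball v0 R" using finite_subset_ball v0 0 by (meson sep_def)
  let ?B = "ball v0 R"
  have B: "finite ?B" "?B \<subseteq> V" using finite_ball ball_V v0 by auto
  obtain c d where cd: "c \<in> comps ?B" "infinite c" "c \<subseteq> C0" "d \<in> comps ?B" "infinite d" "d \<subseteq> D0"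
    using infinite_subcomp[OF 0 B R] infinite_subcomp[OF sep_commute[OF 0] B R] by blast
  then have "c \<noteq> d" using neq_if_disjoint[OF cd(3,6) sep_disjoint[OF 0] cd(2)] by blast
  then have s0: "sep ?B c d" using cd B by (simp add: sep_def)
  have "\<exists>C D. sep (ball v R) C D \<and> comm c C \<and> comm d D" if "v \<in> V" for v
  proof -
    obtain f where f: "aut f" "f v0 = v" using transitive_aut v0 \<open>v \<in> V\<close> by blast
    have "sep (ball v R) (f ` c) (f ` d)" using aut_sep[OF f(1) s0] aut_ball[OF f(1) v0] f(2) by simp
    then show ?thesis using sep_comm[OF s0] sep_commute by blast
  qed
  then obtain plus minus where "\<And>v. v \<in> V \<Longrightarrow> sep (ball v R) (plus v) (minus v) \<and> comm c (plus v) \<and> comm d (minus v)"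
    by metis
  then show ?thesis using comm_trans comm_sym by blast
qed

end

subsection \<open>The height function of a two-ended graph\<close>

locale oriented = two_ended +
  fixes R :: nat and plus minus :: "'a \<Rightarrow> 'a set"
  assumes sep_pm: "v \<in> V \<Longrightarrow> sep (ball v R) (plus v) (minus v)"
    and comm_plus: "u \<in> V \<Longrightarrow> v \<in> V \<Longrightarrow> comm (plus u) (plus v)"
    and comm_minus: "u \<in> V \<Longrightarrow> v \<in> V \<Longrightarrow> comm (minus u) (minus v)"
begin

lemma pm_V: "v \<in> V \<Longrightarrow> plus v \<subseteq> V" "v \<in> V \<Longrightarrow> minus v \<subseteq> V"
  using sep_pm comp_subset unfolding sep_def by blast+

lemma not_comm_pm: assumes "u \<in> V" "v \<in> V" shows "\<not> comm (plus u) (minus v)"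
proof
  assume "comm (plus u) (minus v)"
  then have "comm (plus u) (minus u)" using comm_trans comm_minus assms by blast
  then show False
    using sep_pm[OF assms(1)] sep_disjoint comm_infinite unfolding sep_def by metis
qed

lemma aut_pm_single:
  assumes "aut f" "v \<in> V"
  shows "f ` plus v = plus (f v) \<and> f ` minus v = minus (f v) \<or>
         f ` plus v = minus (f v) \<and> f ` minus v = plus (f v)"
proof -
  have fv: "f v \<in> V" using aut_in assms by blast
  have "sep (ball (f v) R) (f ` plus v) (f ` minus v)"
    using aut_sep[OF assms(1) sep_pm[OF assms(2)]] aut_ball[OF assms] by simp
  moreover note sep_pm[OF fv]
  ultimately show ?thesis
    using three_infinite_comps[of "ball (f v) R"] unfolding sep_def by metis
qed

text \<open>Whether the sides are exchanged cannot depend on the vertex: the sets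
  \<open>plus v\<close> are pairwise commensurable, their images remain so, and no
  \<open>plus u\<close> is commensurable with a \<open>minus v\<close>.\<close>

lemma aut_pm:
  assumes "aut f"
  shows "(\<forall>v\<in>V. f ` plus v = plus (f v) \<and> f ` minus v = minus (f v)) \<or>
         (\<forall>v\<in>V. f ` plus v = minus (f v) \<and> f ` minus v = plus (f v))"
proof (rule ccontr)
  assume "\<not> ?thesis"
  then obtain u v where uv: "u \<in> V" "v \<in> V" "f ` plus u = minus (f u)" "f ` plus v = plus (f v)"
    using aut_pm_single[OF assms] by blast
  have "comm (f ` plus v) (f ` plus u)"
    using comm_image[OF aut_inj[OF assms] pm_V(1)[OF uv(2)] pm_V(1)[OF uv(1)] comm_plus[OF uv(2,1)]] .
  then show False using uv not_comm_pm aut_in assms by metis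
qed

text \<open>The ball around \<open>v\<close> together with the finite components of its
  complement.\<close>

definition rest :: "'a \<Rightarrow> 'a set" where "rest v = V - plus v - minus v"

lemma finite_rest: "v \<in> V \<Longrightarrow> finite (rest v)"
  unfolding rest_def using finite_outside_sep sep_pm by blast

lemma aut_rest: assumes "aut f" "v \<in> V" shows "f ` rest v = rest (f v)"
proof -
  have "f ` rest v = f ` V - f ` plus v - f ` minus v"
    unfolding rest_def using pm_V[OF assms(2)]
      inj_on_image_set_diff[OF aut_inj[OF assms(1)], of V "plus v"]
      inj_on_image_set_diff[OF aut_inj[OF assms(1)], of "V - plus v" "minus v"] by auto
  then show ?thesis using aut_pm_single[OF assms] aut_image[OF assms(1)] unfolding rest_def by auto
qed

lemma card_rest: "u \<in> V \<Longrightarrow> v \<in> V \<Longrightarrow> card (rest u) = card (rest v)"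
  using transitive_aut[of u v] aut_rest aut_inj
  by (metis Diff_subset card_image inj_on_subset rest_def subset_trans)

text \<open>\<open>minus v\<close> is the complement of \<open>plus v \<union> rest v\<close>.
  Complementation reverses the sign of \<open>ind\<close>, and the contributions of the two sets
  \<open>rest\<close> cancel because they are equally large.\<close>

lemma ind_minus:
  assumes "u \<in> V" "v \<in> V"
  shows "ind (minus u) (minus v) = - ind (plus u) (plus v)"
proof -
  have fin: "finite (rest u)" "finite (rest v)" using finite_rest assms by auto
  have disj: "plus u \<inter> minus u = {}" "plus v \<inter> minus v = {}" using sep_disjoint sep_pm assms by blast+
  have eq: "minus u = V - (plus u \<union> rest u)" "minus v = V - (plus v \<union> rest v)"
    using disj pm_V assms unfolding rest_def by blast+
  have sub: "plus u \<union> rest u \<subseteq> V" "plus v \<union> rest v \<subseteq> V" using pm_V assms unfolding rest_def by blast+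
  have d: "minus u - minus v = (plus v \<union> rest v) - (plus u \<union> rest u)"
    "minus v - minus u = (plus u \<union> rest u) - (plus v \<union> rest v)"
    using eq sub by blast+
  have e0: "ind (minus u) (minus v) = - ind (plus u \<union> rest u) (plus v \<union> rest v)"
    unfolding ind_def d by simp
  have r: "ind (plus w \<union> rest w) (plus w) = int (card (rest w))" "comm (plus w \<union> rest w) (plus w)" if "w \<in> V" for w
  proof -
    have "plus w \<union> rest w - plus w = rest w" "plus w - (plus w \<union> rest w) = {}" unfolding rest_def by blast+
    note e = this
    show "ind (plus w \<union> rest w) (plus w) = int (card (rest w))" unfolding ind_def e by simp
    show "comm (plus w \<union> rest w) (plus w)" unfolding comm_def e using finite_rest[OF that] by simp
  qed
  have "ind (plus u \<union> rest u) (plus v \<union> rest v) = ind (plus u \<union> rest u) (plus u) + ind (plus u) (plus v \<union> rest v)"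
    by (rule ind_add[OF r(2)[OF assms(1)] comm_trans[OF comm_plus[OF assms] comm_sym[OF r(2)[OF assms(2)]]]])
  also have "ind (plus u) (plus v \<union> rest v) = ind (plus u) (plus v) + ind (plus v) (plus v \<union> rest v)"
    by (rule ind_add[OF comm_plus[OF assms] comm_sym[OF r(2)[OF assms(2)]]])
  finally have "ind (plus u \<union> rest u) (plus v \<union> rest v) = ind (plus u) (plus v)"
    using r(1)[OF assms(1)] r(1)[OF assms(2)] card_rest[OF assms] ind_swap[of "plus v" "plus v \<union> rest v"] by linarith
  then show ?thesis using e0 by simp
qed

section \<open>The height and the finiteness of its levels\<close>

definition base :: 'a where "base = (SOME v. v \<in> V)"

lemma base_V: "base \<in> V"
  unfolding base_def using V_nonempty by (simp add: some_in_eq)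

definition pos :: "'a \<Rightarrow> int" where
  "pos v = ind (plus v) (plus base)"

lemma ind_pos: "u \<in> V \<Longrightarrow> v \<in> V \<Longrightarrow> ind (plus u) (plus v) = pos u - pos v"
  unfolding pos_def using ind_add[of "plus u" "plus v" "plus base"] comm_plus base_V by simp

text \<open>Automorphisms preserve \<open>ind\<close>; if they exchange the sides,
  \<open>ind_minus\<close> supplies the reversed sign.\<close>

lemma aut_pos:
  assumes "aut f"
  shows "(\<exists>c. \<forall>v\<in>V. pos (f v) = pos v + c) \<or> (\<exists>c. \<forall>v\<in>V. pos (f v) = c - pos v)"
  using aut_pm[OF assms]
proof
  assume a: "\<forall>v\<in>V. f ` plus v = plus (f v) \<and> f ` minus v = minus (f v)"
  have "pos (f v) = pos v + pos (f base)" if "v \<in> V" for v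
  proof -
    have "pos (f v) - pos (f base) = ind (f ` plus v) (f ` plus base)"
      using a that base_V ind_pos[OF aut_in[OF assms that] aut_in[OF assms base_V]] by simp
    also have "\<dots> = pos v" unfolding pos_def using ind_image[OF aut_inj[OF assms] pm_V(1)[OF that] pm_V(1)[OF base_V]] .
    finally show ?thesis by simp
  qed
  then show ?thesis by blast
next
  assume a: "\<forall>v\<in>V. f ` plus v = minus (f v) \<and> f ` minus v = plus (f v)"
  have "pos (f v) = pos (f base) - pos v" if "v \<in> V" for v
  proof -
    have "pos (f v) - pos (f base) = ind (f ` minus v) (f ` minus base)"
      using a that base_V ind_pos[OF aut_in[OF assms that] aut_in[OF assms base_V]] by simp
    also have "\<dots> = ind (minus v) (minus base)" using ind_image[OF aut_inj[OF assms] pm_V(2)[OF that] pm_V(2)[OF base_V]] .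
    also have "\<dots> = - pos v" unfolding pos_def using ind_minus that base_V by blast
    finally show ?thesis by simp
  qed
  then show ?thesis by blast
qed

text \<open>For distant vertices the ball around \<open>v\<close> lies inside one side of
  \<open>u\<close>. By \<open>sep_nested\<close> the corresponding side of \<open>v\<close> is then
  a proper subset of that side, which makes the index nonzero.\<close>

lemma far_pos:
  "\<exists>r. \<forall>u\<in>V. \<forall>v\<in>V. v \<notin> ball u r \<longrightarrow> pos u \<noteq> pos v"
proof -
  obtain r0 where r0: "rest base \<subseteq> ball base r0"
    using finite_subset_ball[OF finite_rest[OF base_V] _ base_V] unfolding rest_def by blast
  have rest: "rest u \<subseteq> ball u r0" if u: "u \<in> V" for u
  proof -
    obtain f where f: "aut f" "f base = u" using transitive_aut base_V u by blast
    then show ?thesis using r0 aut_rest[OF f(1) base_V] aut_ball[OF f(1) base_V] by (metis image_mono)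
  qed
  \<comment> \<open>Beyond \<open>r0\<close> the vertex \<open>v\<close> is outside
    \<open>rest u\<close>; beyond \<open>R + R\<close> the two balls of radius \<open>R\<close> are
    disjoint.\<close>
  let ?r = "max r0 (R + R)"
  show ?thesis
  proof (intro exI[of _ ?r] ballI impI)
    fix u v assume u: "u \<in> V" and v: "v \<in> V" and far: "v \<notin> ball u ?r"
    have "v \<notin> rest u" using far rest[OF u] ball_mono[of r0 ?r u] by auto
    then have side: "v \<in> plus u \<or> v \<in> minus u" using v unfolding rest_def by blast
    have disj: "ball v R \<inter> ball u R = {}"
    proof (rule ccontr)
      assume "\<not> ?thesis"
      then obtain w where "w \<in> ball u R" "v \<in> ball w R" using ball_sym by blast
      then have "v \<in> ball u (R + R)" by (rule ball_trans)
      then show False using far ball_mono[of "R + R" ?r u] by auto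
    qed
    have strict: False
      if "sep (ball u R) C D" "sep (ball v R) C' D'" "comm C C'" "comm D D'" "v \<in> C" "ind C C' = 0" for C D C' D'
    proof -
      have C: "closed_off (ball u R) C" using that(1) comp_closed_off unfolding sep_def by blast
      have "ball v R \<subseteq> C" using conn_set_closed_off[OF ball_conn_set disj C ball_self that(5)] .
      then have n: "C' \<subseteq> C" "ball v R \<subseteq> C - C'"
        using sep_nested[OF that(1-4)] ball_conn_set ball_self by blast+
      then have "C' - C = {}" "C - C' \<noteq> {}" using ball_self by blast+
      moreover have "finite (C - C')" using that(3) by (simp add: comm_def)
      ultimately have "card (C' - C) = 0" "card (C - C') > 0" by (simp_all only: card.empty card_gt_0_iff) simp
      then show False using that(6) unfolding ind_def by linarith
    qed
    show "pos u \<noteq> pos v"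
    proof
      assume "pos u = pos v"
      then have "ind (plus u) (plus v) = 0" "ind (minus u) (minus v) = 0"
        using ind_pos ind_minus u v by auto
      then show False
        using side strict[OF sep_pm[OF u] sep_pm[OF v] comm_plus[OF u v] comm_minus[OF u v]]
          strict[OF sep_commute[OF sep_pm[OF u]] sep_commute[OF sep_pm[OF v]] comm_minus[OF u v] comm_plus[OF u v]]
        by blast
    qed
  qed
qed

lemma finite_pos_level: "finite {v \<in> V. pos v = j}"
proof (cases "{v \<in> V. pos v = j} = {}")
  case False
  then obtain u where u: "u \<in> V" "pos u = j" by blast
  obtain r where r: "\<forall>u\<in>V. \<forall>v\<in>V. v \<notin> ball u r \<longrightarrow> pos u \<noteq> pos v" using far_pos by blast
  then have "{v \<in> V. pos v = j} \<subseteq> ball u r" using u by blast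
  then show ?thesis using finite_ball finite_subset by blast
next
  case True
  then show ?thesis by (metis finite.emptyI)
qed

end

theorem (in two_ended) height_ex:
  "\<exists>pos :: 'a \<Rightarrow> int.
     (\<forall>f. aut f \<longrightarrow> (\<exists>c. \<forall>v\<in>V. pos (f v) = pos v + c) \<or> (\<exists>c. \<forall>v\<in>V. pos (f v) = c - pos v)) \<and>
     (\<forall>j. finite {v \<in> V. pos v = j})"
proof -
  obtain R plus minus where "\<forall>v\<in>V. sep (ball v R) (plus v) (minus v) \<and>
     (\<forall>u\<in>V. comm (plus u) (plus v) \<and> comm (minus u) (minus v))"
    using oriented_ex by blast
  then interpret oriented G R plus minus by unfold_locales blast+
  show ?thesis using aut_pos finite_pos_level by blast
qed

lemma (in two_ended) infinite_V: "infinite V"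
proof -
  obtain X C D where "sep X C D" using sep_ex by blast
  then have "C \<subseteq> V" "infinite C" using comp_subset[of C X] unfolding sep_def by blast+
  then show ?thesis using finite_subset by blast
qed

subsection \<open>Layered graphs\<close>

text \<open>Each \<open>y\<close> sends weight 1 in equal parts to its images. By the degree
  condition the part arriving at \<open>x\<close> is 1 divided by the in-degree of \<open>x\<close>,
  so \<open>x\<close> receives at most 1 altogether.\<close>

lemma card_le_card_Image:
  assumes fin: "finite Y" "\<And>y. finite (r `` {y})" "\<And>x. finite (r\<inverse> `` {x})"
    and ne: "\<And>y. y \<in> Y \<Longrightarrow> r `` {y} \<noteq> {}"
    and deg: "\<And>y x. (y, x) \<in> r \<Longrightarrow> card (r `` {y}) = card (r\<inverse> `` {x})"
  shows "card Y \<le> card (r `` Y)"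
proof -
  let ?w = "\<lambda>x. 1 / real (card (r\<inverse> `` {x}))"
  have finI: "finite (r `` Y)"
  proof -
    have "r `` Y = (\<Union>y\<in>Y. r `` {y})" by blast
    then show ?thesis using fin by simp
  qed
  have "real (card Y) = (\<Sum>y\<in>Y. 1)" by simp
  also have "\<dots> = (\<Sum>y\<in>Y. \<Sum>x | x \<in> r `` Y \<and> (y, x) \<in> r. ?w x)"
  proof (rule sum.cong)
    fix y assume y: "y \<in> Y"
    have "{x. x \<in> r `` Y \<and> (y, x) \<in> r} = r `` {y}" using y by blast
    then have "(\<Sum>x | x \<in> r `` Y \<and> (y, x) \<in> r. ?w x) = (\<Sum>x\<in>r `` {y}. 1 / real (card (r `` {y})))"
      using deg[of y] by simp
    also have "\<dots> = 1" using ne[OF y] fin by simp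
    finally show "1 = (\<Sum>x | x \<in> r `` Y \<and> (y, x) \<in> r. ?w x)" by simp
  qed simp
  also have "\<dots> = (\<Sum>x\<in>r `` Y. \<Sum>y | y \<in> Y \<and> (y, x) \<in> r. ?w x)"
    by (rule sum.swap_restrict[OF fin(1) finI])
  also have "\<dots> \<le> (\<Sum>x\<in>r `` Y. 1)"
  proof (rule sum_mono)
    fix x assume "x \<in> r `` Y"
    then have "r\<inverse> `` {x} \<noteq> {}" by blast
    then have pos: "card (r\<inverse> `` {x}) > 0" using fin(3) by (simp add: card_gt_0_iff)
    have "{y. y \<in> Y \<and> (y, x) \<in> r} \<subseteq> r\<inverse> `` {x}" by blast
    then have "card {y. y \<in> Y \<and> (y, x) \<in> r} \<le> card (r\<inverse> `` {x})" using fin(3) card_mono by blast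
    then show "(\<Sum>y | y \<in> Y \<and> (y, x) \<in> r. ?w x) \<le> 1" using pos by simp
  qed
  finally show ?thesis by simp
qed

text \<open>The interface between the two halves of the proof: the ring structure, the cohesion and
  the value of \<open>kappa_inf\<close> all follow from these properties of a height
  \<open>P\<close> and a digraph \<open>D\<close> of longest edges. \<open>D_deg\<close> feeds the
  weight argument, and \<open>D_two\<close> makes predecessor counts comparable two steps
  apart.\<close>

locale layered = vt_graph +
  fixes P :: "'a \<Rightarrow> int" and t :: nat and D :: "('a \<times> 'a) set"
  assumes P_range: "P ` V = UNIV"
    and P_finite: "finite {v \<in> V. P v = j}"
    and aut_P: "aut f \<Longrightarrow>
      (\<exists>c. \<forall>v\<in>V. P (f v) = P v + c) \<and> (\<forall>x y. (x, y) \<in> D \<longrightarrow> (f x, f y) \<in> D) \<or>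
      (\<exists>c. \<forall>v\<in>V. P (f v) = c - P v) \<and> (\<forall>x y. (x, y) \<in> D \<longrightarrow> (f y, f x) \<in> D)"
    and span: "(x, y) \<in> E \<Longrightarrow> \<bar>P y - P x\<bar> \<le> int t"
    and D_E: "D \<subseteq> E"
    and D_P: "(x, y) \<in> D \<Longrightarrow> P y = P x + int t"
    and D_out: "z \<in> V \<Longrightarrow> \<exists>y. (z, y) \<in> D"
    and D_in: "z \<in> V \<Longrightarrow> \<exists>y. (y, z) \<in> D"
    and D_deg: "(x, y) \<in> D \<Longrightarrow> card (D `` {x}) = card (D\<inverse> `` {y})"
    and D_two: "(x, y) \<in> D \<Longrightarrow> (y, z) \<in> D \<Longrightarrow>
      \<exists>f c. aut f \<and> (\<forall>v\<in>V. P (f v) = P v + c) \<and> f x = z"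
    and t_pos: "t > 0"
begin

definition up :: "('a \<Rightarrow> 'a) \<Rightarrow> bool" where
  "up f \<longleftrightarrow> aut f \<and> (\<exists>c. \<forall>v\<in>V. P (f v) = P v + c)"

lemma P_obtain: obtains v where "v \<in> V" "P v = j"
  using P_range by (metis UNIV_I image_iff)

text \<open>An automorphism cannot translate and reflect the heights at once, since both 0 and 1
  occur as heights.\<close>

lemma up_D: assumes "up f" "(x, y) \<in> D" shows "(f x, f y) \<in> D"
proof (rule ccontr)
  assume no: "(f x, f y) \<notin> D"
  obtain c where c: "\<And>v. v \<in> V \<Longrightarrow> P (f v) = P v + c" and "aut f" using assms(1) unfolding up_def by blast
  then obtain c' where c': "\<And>v. v \<in> V \<Longrightarrow> P (f v) = c' - P v" using aut_P[of f] no assms(2) by blast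
  obtain v w where "v \<in> V" "P v = 0" "w \<in> V" "P w = 1" using P_obtain by metis
  then show False using c[of v] c[of w] c'[of v] c'[of w] by simp
qed

lemma up_inverse:
  assumes "up f"
  shows "\<exists>g. up g \<and> (\<forall>x\<in>V. g (f x) = x)"
proof -
  obtain c where c: "\<And>v. v \<in> V \<Longrightarrow> P (f v) = P v + c" and f: "aut f" using assms(1) unfolding up_def by blast
  obtain g where g: "aut g" "\<And>x. x \<in> V \<Longrightarrow> g (f x) = x" "\<And>x. x \<in> V \<Longrightarrow> f (g x) = x"
    using aut_inverse[OF f] by blast
  have "P (g v) = P v + (- c)" if "v \<in> V" for v
    using c[OF aut_in[OF g(1) that]] g(3)[OF that] by simp
  then show ?thesis using g unfolding up_def by blast
qed

lemma D_V: "(x, y) \<in> D \<Longrightarrow> x \<in> V \<and> y \<in> V"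
  using D_E edge_verts by blast

lemma relpow_D_V: "(x, y) \<in> D ^^ n \<Longrightarrow> x \<in> V \<longleftrightarrow> y \<in> V"
  by (induction n arbitrary: y) (use D_V in auto)

lemma relpow_D_P: "(x, y) \<in> D ^^ n \<Longrightarrow> P y = P x + int n * int t"
  by (induction n arbitrary: y) (use D_P in \<open>auto simp: algebra_simps\<close>)

lemma relpow_D_ball: "(x, y) \<in> D ^^ n \<Longrightarrow> y \<in> ball x n"
proof (induction n arbitrary: y)
  case (Suc n)
  then obtain z where "z \<in> ball x n" "(z, y) \<in> D" by auto
  then show ?case using D_E by (auto simp: ball_Suc)
qed simp

lemma relpow_D_out: "x \<in> V \<Longrightarrow> \<exists>y. (x, y) \<in> D ^^ n"
proof (induction n)
  case (Suc n)
  then show ?case using relpow_D_V D_out by (meson relpow_Suc_I)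
qed auto

lemma relpow_D_in: "x \<in> V \<Longrightarrow> \<exists>y. (y, x) \<in> D ^^ n"
proof (induction n)
  case (Suc n)
  then show ?case using relpow_D_V D_in by (meson relpow_Suc_I2)
qed auto

lemma ball_P: "y \<in> ball x n \<Longrightarrow> \<bar>P y - P x\<bar> \<le> int n * int t"
proof (induction n arbitrary: y)
  case (Suc n)
  show ?case
  proof (cases "y \<in> ball x n")
    case True
    then show ?thesis using Suc.IH[OF True] by (simp add: algebra_simps)
  next
    case False
    then obtain z where "z \<in> ball x n" "(z, y) \<in> E" using Suc.prems by (auto simp: ball_Suc)
    then show ?thesis using Suc.IH[of z] span[of z y] by (simp add: algebra_simps)
  qed
qed simp

section \<open>Levels of the height\<close>

definition lev :: "int \<Rightarrow> 'a set" where "lev j = {v \<in> V. P v = j}"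

definition s :: nat where "s = card (lev 0)"

lemma finite_lev: "finite (lev j)"
  unfolding lev_def by (rule P_finite)

lemma lev_nonempty: "lev j \<noteq> {}"
  unfolding lev_def using P_obtain[of j] by blast

lemma lev_inj: "lev i = lev j \<Longrightarrow> i = j"
  using lev_nonempty[of i] unfolding lev_def by blast

lemma card_lev_le: "card (lev i) \<le> card (lev j)"
proof -
  obtain x y where xy: "x \<in> V" "P x = i" "y \<in> V" "P y = j" using P_obtain by metis
  obtain f where f: "aut f" "f x = y" using transitive_aut xy by blast
  have "f ` lev i \<subseteq> lev j"
  proof
    fix w assume "w \<in> f ` lev i"
    then obtain v where v: "v \<in> V" "P v = i" "w = f v" by (auto simp: lev_def)
    then have "P (f v) = P (f x)" using aut_P[OF f(1)] xy by auto
    then show "w \<in> lev j" using v f xy aut_in[OF f(1)] by (simp add: lev_def)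
  qed
  moreover have "inj_on f (lev i)" using aut_inj[OF f(1)] by (rule inj_on_subset) (simp add: lev_def)
  ultimately show ?thesis using card_inj_on_le finite_lev by blast
qed

lemma card_lev: "card (lev j) = s"
  unfolding s_def using card_lev_le by (simp add: order_antisym)

lemma s_pos: "s > 0"
  using card_lev[of 0] lev_nonempty[of 0] finite_lev[of 0] by (metis card_gt_0_iff)

lemma aut_lev:
  assumes "aut f"
  shows "(\<exists>c. \<forall>j. f ` lev j = lev (j + c)) \<or> (\<exists>c. \<forall>j. f ` lev j = lev (c - j))"
proof -
  have *: "f ` lev j = lev i" if "f ` lev j \<subseteq> lev i" for i j
  proof (rule card_subset_eq[OF finite_lev that])
    have "inj_on f (lev j)" using aut_inj[OF assms] by (rule inj_on_subset) (simp add: lev_def)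
    then show "card (f ` lev j) = card (lev i)" by (simp add: card_image card_lev)
  qed
  consider c where "\<forall>v\<in>V. P (f v) = P v + c" | c where "\<forall>v\<in>V. P (f v) = c - P v"
    using aut_P[OF assms] by blast
  then show ?thesis
  proof cases
    case 1
    then have "f ` lev j \<subseteq> lev (j + c)" for j using aut_in[OF assms] by (auto simp: lev_def)
    then have "f ` lev j = lev (j + c)" for j by (rule *)
    then show ?thesis by blast
  next
    case 2
    then have "f ` lev j \<subseteq> lev (c - j)" for j using aut_in[OF assms] by (auto simp: lev_def)
    then have "f ` lev j = lev (c - j)" for j by (rule *)
    then show ?thesis by blast
  qed
qed

text \<open>Such a window of \<open>t\<close> consecutive levels serves twice: as a separator of
  least size, and to count the classes of \<open>D\<close>, each of which it meets in exactly one
  level.\<close>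

lemma card_slice: "finite {v \<in> V. a \<le> P v \<and> P v < a + int t}" "card {v \<in> V. a \<le> P v \<and> P v < a + int t} = s * t"
proof -
  have eq: "{v \<in> V. a \<le> P v \<and> P v < a + int t} = (\<Union>j\<in>{a..<a + int t}. lev j)"
    by (auto simp: lev_def)
  show "finite {v \<in> V. a \<le> P v \<and> P v < a + int t}" unfolding eq using finite_lev by simp
  have "card (\<Union>j\<in>{a..<a + int t}. lev j) = (\<Sum>j\<in>{a..<a + int t}. card (lev j))"
    by (rule card_UN_disjoint) (auto simp: P_finite lev_def)
  then show "card {v \<in> V. a \<le> P v \<and> P v < a + int t} = s * t" unfolding eq by (simp add: card_lev)
qed

subsection \<open>Classes of vertices joined by edges of maximal span\<close>

definition K :: "'a \<Rightarrow> 'a set" where "K x = (D \<union> D\<inverse>)\<^sup>* `` {x}"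

lemma K_refl: "x \<in> K x"
  by (simp add: K_def)

lemma K_sym: "y \<in> K x \<Longrightarrow> x \<in> K y"
proof -
  have "sym ((D \<union> D\<inverse>)\<^sup>*)" by (rule sym_rtrancl) (auto simp: sym_def)
  then show "y \<in> K x \<Longrightarrow> x \<in> K y" unfolding K_def by (auto dest: symD)
qed

lemma K_eq: "y \<in> K x \<Longrightarrow> K y = K x"
  using K_sym[of y x] unfolding K_def by (auto intro: rtrancl_trans)

lemma K_D: "(x, y) \<in> D \<Longrightarrow> y \<in> K x"
  unfolding K_def by auto

lemma K_relpow: "(x, y) \<in> D ^^ n \<Longrightarrow> y \<in> K x"
proof (induction n arbitrary: y)
  case (Suc n)
  then obtain z where "z \<in> K x" "(z, y) \<in> D" by auto
  then show ?case using K_D K_eq by blast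
qed (simp add: K_refl)

lemma K_V_P: assumes "x \<in> V" "y \<in> K x" shows "y \<in> V \<and> (\<exists>j. P y = P x + j * int t)"
proof -
  have "(x, y) \<in> (D \<union> D\<inverse>)\<^sup>*" using assms by (simp add: K_def)
  then show ?thesis
  proof induction
    case base
    then show ?case using assms by (auto intro: exI[of _ 0])
  next
    case (step y z)
    then obtain j where j: "P y = P x + j * int t" by blast
    from step(2) show ?case
    proof
      assume yz: "(y, z) \<in> D"
      then have "P z = P x + (j + 1) * int t" using D_P j by (simp add: algebra_simps)
      then show ?thesis using D_V yz by blast
    next
      assume "(y, z) \<in> D\<inverse>"
      then have yz: "(z, y) \<in> D" by simp
      then have "P z = P x + (j - 1) * int t" using D_P[OF yz] j by (simp add: algebra_simps)
      then show ?thesis using D_V yz by blast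
    qed
  qed
qed

lemma aut_K_subset: assumes "aut f" shows "f ` K x \<subseteq> K (f x)"
proof -
  have "(f x, f y) \<in> (D \<union> D\<inverse>)\<^sup>*" if "(x, y) \<in> (D \<union> D\<inverse>)\<^sup>*" for y
    using that
  proof induction
    case (step y z)
    then have "(f y, f z) \<in> D \<union> D\<inverse>" using aut_P[OF assms] by blast
    then show ?case using step by (meson rtrancl.rtrancl_into_rtrancl)
  qed simp
  then show ?thesis unfolding K_def by blast
qed

lemma aut_K: assumes "aut f" "x \<in> V" shows "f ` K x = K (f x)"
proof
  obtain g where g: "aut g" "\<And>x. x \<in> V \<Longrightarrow> g (f x) = x" "\<And>x. x \<in> V \<Longrightarrow> f (g x) = x"
    using aut_inverse[OF assms(1)] by blast
  show "K (f x) \<subseteq> f ` K x"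
  proof
    fix y assume y: "y \<in> K (f x)"
    then have "g y \<in> K (g (f x))" using aut_K_subset[OF g(1)] by blast
    then have "g y \<in> K x" using g(2) assms by simp
    moreover have "y \<in> V" using y K_V_P aut_in assms by blast
    ultimately show "y \<in> f ` K x" using g(3) by (metis imageI)
  qed
qed (rule aut_K_subset[OF assms(1)])

text \<open>The choice is harmless: by transitivity every vertex gives the same number, see
  \<open>card_K_lev\<close>.\<close>

definition k :: nat where "k = (let x = (SOME x. x \<in> V) in card (K x \<inter> lev (P x)))"

lemma card_K_lev: assumes "x \<in> V" shows "card (K x \<inter> lev (P x)) = k"
proof -
  have *: "card (K x \<inter> lev (P x)) \<le> card (K y \<inter> lev (P y))" if xy: "x \<in> V" "y \<in> V" for x y
  proof -
    obtain f where f: "aut f" "f x = y" using transitive_aut xy by blast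
    have "f ` (K x \<inter> lev (P x)) \<subseteq> K y \<inter> lev (P y)"
    proof
      fix w assume "w \<in> f ` (K x \<inter> lev (P x))"
      then obtain v where v: "v \<in> V" "P v = P x" "v \<in> K x" "w = f v" by (auto simp: lev_def)
      then have "P (f v) = P (f x)" using aut_P[OF f(1)] xy by auto
      moreover have "w \<in> K y" using aut_K_subset[OF f(1), of x] v f by blast
      ultimately show "w \<in> K y \<inter> lev (P y)" using v f aut_in[OF f(1)] by (simp add: lev_def)
    qed
    moreover have "inj_on f (K x \<inter> lev (P x))"
      using aut_inj[OF f(1)] by (rule inj_on_subset) (auto simp: lev_def)
    ultimately show ?thesis using card_inj_on_le finite_lev by blast
  qed
  have "(SOME x. x \<in> V) \<in> V" using V_nonempty by (simp add: some_in_eq)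
  then show ?thesis unfolding k_def Let_def using * assms by (simp add: order_antisym)
qed

lemma k_pos: "k > 0"
proof -
  obtain x where x: "x \<in> V" using V_nonempty by blast
  then have "x \<in> K x \<inter> lev (P x)" using K_refl by (simp add: lev_def)
  then have "card (K x \<inter> lev (P x)) > 0" using finite_lev by (metis card_gt_0_iff empty_iff finite_Int)
  then show ?thesis using card_K_lev x by simp
qed

lemma K_meets_level: assumes "x \<in> V" shows "\<exists>y. y \<in> K x \<and> P y = P x + j * int t"
proof (cases "j \<ge> 0")
  case True
  obtain y where "(x, y) \<in> D ^^ nat j" using relpow_D_out assms by blast
  then show ?thesis using K_relpow relpow_D_P True by fastforce
next
  case False
  obtain y where "(y, x) \<in> D ^^ nat (- j)" using relpow_D_in assms by blast
  then have "x \<in> K y" "P x = P y + int (nat (- j)) * int t" using K_relpow relpow_D_P by blast+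
  then show ?thesis using K_sym[of x y] False by (auto simp: algebra_simps)
qed

lemma card_K_level: assumes "x \<in> V" shows "card (K x \<inter> lev (P x + j * int t)) = k"
proof -
  obtain y where y: "y \<in> K x" "P y = P x + j * int t" using K_meets_level assms by blast
  then show ?thesis using card_K_lev[of y] K_V_P[OF assms y(1)] K_eq[OF y(1)] by simp
qed

definition N :: nat where "N = card (K ` V)"

text \<open>The nonempty levels of a class are spaced \<open>t\<close> apart, so a window of
  \<open>t\<close> levels contains exactly one of them, with \<open>k\<close> vertices.\<close>

lemma classes: "finite (K ` V)" "N * k = s * t"
proof -
  let ?W = "{v \<in> V. 0 \<le> P v \<and> P v < 0 + int t}"
  have W: "finite ?W" "card ?W = s * t" using card_slice[of 0] by auto
  have KW: "K ` V = K ` ?W"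
  proof
    show "K ` V \<subseteq> K ` ?W"
    proof
      fix C assume "C \<in> K ` V"
      then obtain x where x: "x \<in> V" "C = K x" by blast
      \<comment> \<open>Moving inside the class by this multiple of \<open>t\<close> brings the
        height to \<open>P x mod int t\<close>, which lies in the window.\<close>
      obtain y where y: "y \<in> K x" "P y = P x + (- (P x div int t)) * int t" using K_meets_level x by blast
      have "P y = P x mod int t" using y(2) by (simp add: minus_div_mult_eq_mod[symmetric])
      then have "y \<in> ?W" using K_V_P[OF x(1) y(1)] t_pos by simp
      then show "C \<in> K ` ?W" using K_eq[OF y(1)] x by blast
    qed
  qed blast
  then show fin: "finite (K ` V)" using W by simp
  have int: "card (C \<inter> ?W) = k" if "C \<in> K ` V" for C
  proof -
    have "C \<in> K ` ?W" using that unfolding KW .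
    then obtain x where x: "x \<in> ?W" "C = K x" by (rule imageE)
    have "K x \<inter> ?W = K x \<inter> lev (P x)"
    proof (intro equalityI subsetI)
      fix y assume y: "y \<in> K x \<inter> ?W"
      then obtain j where j: "P y = P x + j * int t" using K_V_P x by blast
      have "P y mod int t = P x mod int t" unfolding j by simp
      then have "P y = P x" using y x by simp
      then show "y \<in> K x \<inter> lev (P x)" using y by (simp add: lev_def)
    qed (use x in \<open>auto simp: lev_def\<close>)
    then show ?thesis using card_K_lev x by simp
  qed
  have "?W = (\<Union>C\<in>K ` V. C \<inter> ?W)" using K_refl by blast
  then have "card ?W = card (\<Union>C\<in>K ` V. C \<inter> ?W)" by simp
  also have "\<dots> = (\<Sum>C\<in>K ` V. card (C \<inter> ?W))"
  proof (rule card_UN_disjoint[OF fin])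
    show "\<forall>C\<in>K ` V. finite (C \<inter> ?W)" using W by blast
    show "\<forall>C\<in>K ` V. \<forall>C'\<in>K ` V. C \<noteq> C' \<longrightarrow> (C \<inter> ?W) \<inter> (C' \<inter> ?W) = {}"
      using K_eq by blast
  qed
  also have "\<dots> = N * k" using int by (simp add: N_def)
  finally show "N * k = s * t" using W by simp
qed

text \<open>By transitivity the number of classes met by a ball depends only on its radius. If it
  stalls from one radius to the next, balls around adjacent vertices meet the same classes; by
  connectedness so do all balls of this radius, and then they meet every class.\<close>

lemma ball_meets_class:
  assumes "u \<in> V" "v \<in> V"
  shows "\<exists>w\<in>ball u (N - 1). K w = K v"
proof -
  define T where "T r x = K ` ball x r" for r x
  have TV: "T r x \<subseteq> K ` V" if "x \<in> V" for r x using ball_V[OF that] unfolding T_def by blast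
  have fin: "finite (T r x)" if "x \<in> V" for r x using TV[OF that] classes(1) finite_subset by blast
  have card_le: "card (T r y) \<le> card (T r x)" if xy: "x \<in> V" "y \<in> V" for r x y
  proof -
    obtain f where f: "aut f" "f x = y" using transitive_aut xy by blast
    have "T r y = K ` f ` ball x r" unfolding T_def using aut_ball[OF f(1) xy(1)] f(2) by simp
    also have "\<dots> = (`) f ` T r x" unfolding T_def using aut_K[OF f(1)] ball_V[OF xy(1)]
      by (auto simp: image_image intro!: image_cong)
    finally show ?thesis using card_image_le[OF fin[OF xy(1)]] by simp
  qed
  then have card_eq: "card (T r y) = card (T r x)" if "x \<in> V" "y \<in> V" for r x y
    using that by (simp add: order_antisym)
  have mono: "T r x \<subseteq> T (Suc r) x" for r x unfolding T_def using ball_mono[of r "Suc r" x] by auto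
  have full: "T r u = K ` V" if st: "card (T (Suc r) u) = card (T r u)" for r
  proof -
    have same: "T (Suc r) x = T r x" if "x \<in> V" for x
      using card_subset_eq[OF fin[OF that] mono, of r] card_eq[OF that assms(1)] st by metis
    have edge: "T r y = T r x" if xy: "(x, y) \<in> E" for x y
    proof -
      have V: "x \<in> V" "y \<in> V" using xy edge_verts by auto
      have "ball y r \<subseteq> ball x (Suc r)" using ball_trans[OF ball_edge[OF xy]] by fastforce
      then have "T r y \<subseteq> T r x" using same[OF V(1)] unfolding T_def by blast
      then show ?thesis using card_subset_eq[OF fin[OF V(1)]] card_eq[OF V] by blast
    qed
    have all: "T r y = T r u" if "y \<in> V" for y
      using connected_rtrancl[OF assms(1) that] by induction (use edge in auto)
    show ?thesis
    proof
      show "K ` V \<subseteq> T r u"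
      proof
        fix C assume "C \<in> K ` V"
        then obtain y where "y \<in> V" "C = K y" by blast
        then show "C \<in> T r u" using all[of y] ball_self[of y r] unfolding T_def by blast
      qed
    qed (rule TV[OF assms(1)])
  qed
  have grow: "min (Suc r) N \<le> card (T r u)" for r
  proof (induction r)
    case 0
    show ?case by (simp add: T_def)
  next
    case (Suc r)
    show ?case
    proof (cases "card (T (Suc r) u) = card (T r u)")
      case True
      then show ?thesis using full N_def by simp
    next
      case False
      then have "card (T r u) < card (T (Suc r) u)"
        using card_mono[OF fin[OF assms(1)] mono, of r] by simp
      then show ?thesis using Suc by simp
    qed
  qed
  have "N > 0" unfolding N_def using classes(1) V_nonempty by (simp add: card_gt_0_iff)
  then have "N \<le> card (T (N - 1) u)" using grow[of "N - 1"] by simp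
  then have "T (N - 1) u = K ` V"
    using card_seteq[OF classes(1) TV[OF assms(1)]] unfolding N_def by blast
  then show ?thesis using assms(2) unfolding T_def by (metis imageE imageI)
qed

subsection \<open>Common predecessors within a class\<close>

definition Dn :: "nat \<Rightarrow> 'a \<Rightarrow> 'a set" where "Dn n x = {y. (y, x) \<in> D ^^ n}"

lemma Dn_add: "Dn (m + n) x = (\<Union>z\<in>Dn n x. Dn m z)"
  unfolding Dn_def by (auto simp: relpow_add)

lemma Dn_subset: "Dn n x \<subseteq> K x \<inter> lev (P x + (- int n) * int t)" if "x \<in> V"
proof
  fix y assume "y \<in> Dn n x"
  then have y: "(y, x) \<in> D ^^ n" by (simp add: Dn_def)
  then have "y \<in> K x" using K_relpow K_sym by blast
  moreover have "y \<in> lev (P x + (- int n) * int t)" using relpow_D_V[OF y] relpow_D_P[OF y] that by (simp add: lev_def)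
  ultimately show "y \<in> K x \<inter> lev (P x + (- int n) * int t)" by simp
qed

lemma finite_Dn: "x \<in> V \<Longrightarrow> finite (Dn n x)"
  using Dn_subset finite_lev by (meson finite_Int finite_subset)

lemma Dn_nonempty: "x \<in> V \<Longrightarrow> Dn n x \<noteq> {}"
  using relpow_D_in unfolding Dn_def by blast

lemma card_Dn_le: "x \<in> V \<Longrightarrow> card (Dn n x) \<le> k"
  using card_mono[OF _ Dn_subset, of x n] finite_lev card_K_level by (metis finite_Int)

lemma finite_D: "finite (D `` {x})" "finite (D\<inverse> `` {x})"
proof -
  have "D `` {x} \<subseteq> E `` {x}" "D\<inverse> `` {x} \<subseteq> E `` {x}" using D_E edge_sym by blast+
  then show "finite (D `` {x})" "finite (D\<inverse> `` {x})" using finite_nbrs finite_subset by blast+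
qed

lemma card_down: assumes "finite Y" "Y \<subseteq> V" shows "card Y \<le> card (D\<inverse> `` Y)"
proof (rule card_le_card_Image[OF assms(1)])
  show "finite (D\<inverse> `` {y})" "finite ((D\<inverse>)\<inverse> `` {y})" for y using finite_D by simp_all
  show "D\<inverse> `` {y} \<noteq> {}" if "y \<in> Y" for y using D_in assms that by blast
  show "card (D\<inverse> `` {y}) = card ((D\<inverse>)\<inverse> `` {x})" if "(y, x) \<in> D\<inverse>" for x y
    using D_deg[of x y] that by simp
qed

lemma card_Dn_Suc: assumes "x \<in> V" shows "card (Dn n x) \<le> card (Dn (Suc n) x)"
proof -
  have "Dn (Suc n) x = D\<inverse> `` Dn n x"
    using Dn_add[of 1 n x] by (auto simp: Dn_def)
  moreover have "Dn n x \<subseteq> V" using Dn_subset[OF assms] by (auto simp: lev_def)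
  ultimately show ?thesis using card_down[OF finite_Dn[OF assms]] by simp
qed

lemma card_Dn_mono: assumes "x \<in> V" "m \<le> n" shows "card (Dn m x) \<le> card (Dn n x)"
  using lift_Suc_mono_le[of "\<lambda>n. card (Dn n x)", OF card_Dn_Suc[OF assms(1)] assms(2)] .

lemma up_Dn_le: assumes "up f" "x \<in> V" shows "card (Dn n x) \<le> card (Dn n (f x))"
proof -
  have f: "aut f" using assms by (simp add: up_def)
  have *: "(f y, f x) \<in> D ^^ n" if "(y, x) \<in> D ^^ n" for y
    using that
  proof (induction n arbitrary: y)
    case (Suc n)
    then obtain z where "(y, z) \<in> D" "(z, x) \<in> D ^^ n" by (meson relpow_Suc_D2)
    then show ?case using Suc.IH up_D[OF assms(1)] by (meson relpow_Suc_I2)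
  qed simp
  then have "f ` Dn n x \<subseteq> Dn n (f x)" unfolding Dn_def by blast
  moreover have "inj_on f (Dn n x)"
    using aut_inj[OF f] Dn_subset[OF assms(2)] by (rule inj_on_subset[OF _ subset_trans]) (auto simp: lev_def)
  ultimately show ?thesis using card_inj_on_le finite_Dn[OF aut_in[OF f assms(2)]] by blast
qed

text \<open>\<open>D_two\<close> yields a height-translating automorphism from \<open>z\<close> to
  \<open>x\<close>. It and its inverse respect \<open>D\<close>, so they map the predecessor sets
  injectively into each other.\<close>

lemma two_steps_Dn: assumes "z \<in> Dn 2 x" shows "card (Dn n z) = card (Dn n x)" "z \<in> V" "x \<in> V"
proof -
  obtain y where y: "(z, y) \<in> D" "(y, x) \<in> D"
    using assms unfolding Dn_def by (auto simp: numeral_2_eq_2)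
  show V: "z \<in> V" "x \<in> V" using y D_V by blast+
  obtain f where f: "up f" "f z = x" using D_two[OF y] unfolding up_def by blast
  obtain g where g: "up g" "\<And>v. v \<in> V \<Longrightarrow> g (f v) = v" using up_inverse[OF f(1)] by blast
  show "card (Dn n z) = card (Dn n x)"
    using up_Dn_le[OF f(1) V(1), of n] up_Dn_le[OF g(1) V(2), of n] f(2) g(2)[OF V(1)] by simp
qed

text \<open>For \<open>w\<close> two steps below \<open>z\<close>, the set \<open>Dn r w\<close> is
  contained in \<open>Dn (r + 2) z\<close>; once the count stalls they are equal. Further
  predecessors of \<open>z\<close> are thus predecessors of \<open>w\<close>, where the same stall
  occurs.\<close>

lemma Dn_stable:
  assumes "z \<in> V" "card (Dn (r + 2) z) = card (Dn r z)"
  shows "card (Dn (r + 2 * n) z) = card (Dn r z)"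
  using assms
proof (induction n arbitrary: z)
  case (Suc n)
  obtain w where w: "w \<in> Dn 2 z" using Dn_nonempty Suc.prems by blast
  note two = two_steps_Dn[OF w]
  have "Dn r w \<subseteq> Dn (r + 2) z" using w Dn_add[of r 2 z] by blast
  then have eq: "Dn r w = Dn (r + 2) z"
    using card_subset_eq[OF finite_Dn[OF Suc.prems(1)]] two(1) Suc.prems(2) by simp
  have "Dn (r + 2 * Suc n) z = Dn (2 * n + (r + 2)) z" by (simp add: algebra_simps)
  also have "\<dots> = Dn (2 * n + r) w" by (simp only: Dn_add eq)
  finally show ?case using Suc.IH[OF two(2)] two(1) Suc.prems(2) by (simp add: add.commute)
qed simp

text \<open>If the number of \<open>r\<close>-fold predecessors stops growing, then the sets of iterated predecessors of
  all vertices of a class eventually coincide, hence exhaust the levels of the class.\<close>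

lemma Dn_full:
  assumes x: "x \<in> V" and st: "card (Dn (r + 2) x) = card (Dn r x)"
  shows "card (Dn r x) = k"
proof -
  define b where "b = card (Dn r x)"
  have bx: "card (Dn n x) = b" if "n \<ge> r" for n
  proof -
    have "card (Dn n x) \<le> card (Dn (r + 2 * n) x)" by (rule card_Dn_mono[OF x]) simp
    then show ?thesis using Dn_stable[OF x st, of n] card_Dn_mono[OF x that] by (simp add: b_def)
  qed
  \<comment> \<open>Both parts are needed to pass along an edge of \<open>D\<close>: counts that
    settle at \<open>b\<close>, and predecessor sets that agree with those of \<open>x\<close> up to
    the shift of depth caused by different heights.\<close>
  define Q where "Q y \<longleftrightarrow> (\<exists>m. \<forall>n\<ge>m. card (Dn n y) = b) \<and> (\<exists>a c. \<forall>n. Dn (a + n) y = Dn (c + n) x)" for y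
  have edge: "\<exists>m. \<forall>n\<ge>m. Dn n y = Dn (Suc n) z"
    if yz: "(y, z) \<in> D" and cy: "\<exists>m. \<forall>n\<ge>m. card (Dn n y) = b" and cz: "\<exists>m. \<forall>n\<ge>m. card (Dn n z) = b" for y z
  proof -
    obtain m m' where m: "\<And>n. n \<ge> m \<Longrightarrow> card (Dn n y) = b" "\<And>n. n \<ge> m' \<Longrightarrow> card (Dn n z) = b"
      using cy cz by blast
    have "Dn n y \<subseteq> Dn (Suc n) z" for n using Dn_add[of n 1 z] yz by (auto simp: Dn_def)
    then have "Dn n y = Dn (Suc n) z" if "n \<ge> max m m'" for n
      using card_subset_eq[OF finite_Dn, of z "Dn n y" "Suc n"] m(1)[of n] m(2)[of "Suc n"] that D_V[OF yz] by auto
    then show ?thesis by blast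
  qed
  \<comment> \<open>With a successor \<open>z'\<close> of \<open>z\<close>, the vertices
    \<open>y\<close> and \<open>z'\<close> are two steps apart and have equal counts, so the counts
    at \<open>z\<close> are squeezed between two values at \<open>y\<close>. The converse uses a
    predecessor \<open>y'\<close> of \<open>y\<close> in the same way.\<close>
  have card_edge: "(\<exists>m. \<forall>n\<ge>m. card (Dn n y) = b) \<longleftrightarrow> (\<exists>m. \<forall>n\<ge>m. card (Dn n z) = b)" if yz: "(y, z) \<in> D" for y z
  proof -
    have V: "y \<in> V" "z \<in> V" using D_V yz by auto
    have sub1: "card (Dn n y) \<le> card (Dn (Suc n) z)" for n
      by (rule card_mono[OF finite_Dn[OF V(2)]]) (use Dn_add[of n 1 z] yz in \<open>auto simp: Dn_def\<close>)
    obtain y' where y': "(y', y) \<in> D" using D_in V by blast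
    obtain z' where z': "(z, z') \<in> D" using D_out V by blast
    have V': "y' \<in> V" "z' \<in> V" using D_V y' z' by auto
    have sub2: "card (Dn n y') \<le> card (Dn (Suc n) y)" for n
      by (rule card_mono[OF finite_Dn[OF V(1)]]) (use Dn_add[of n 1 y] y' in \<open>auto simp: Dn_def\<close>)
    have sub3: "card (Dn n z) \<le> card (Dn (Suc n) z')" for n
      by (rule card_mono[OF finite_Dn[OF V'(2)]]) (use Dn_add[of n 1 z'] z' in \<open>auto simp: Dn_def\<close>)
    have eqy: "card (Dn n y') = card (Dn n z)" for n
      by (rule two_steps_Dn) (use y' yz in \<open>auto simp: Dn_def numeral_2_eq_2\<close>)
    have eqz: "card (Dn n y) = card (Dn n z')" for n
      by (rule two_steps_Dn) (use z' yz in \<open>auto simp: Dn_def numeral_2_eq_2\<close>)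
    show ?thesis
    proof
      assume "\<exists>m. \<forall>n\<ge>m. card (Dn n y) = b"
      then obtain m where m: "\<And>n. n \<ge> m \<Longrightarrow> card (Dn n y) = b" by blast
      have "card (Dn n z) = b" if "n \<ge> Suc m" for n
        using sub1[of "n - 1"] sub3[of n] eqz[of "Suc n"] m[of "n - 1"] m[of "Suc n"] that by simp
      then show "\<exists>m. \<forall>n\<ge>m. card (Dn n z) = b" by blast
    next
      assume "\<exists>m. \<forall>n\<ge>m. card (Dn n z) = b"
      then obtain m where m: "\<And>n. n \<ge> m \<Longrightarrow> card (Dn n z) = b" by blast
      have "card (Dn n y) = b" if "n \<ge> Suc m" for n
        using sub1[of n] sub2[of "n - 1"] eqy[of "n - 1"] m[of "n - 1"] m[of "Suc n"] that by simp
      then show "\<exists>m. \<forall>n\<ge>m. card (Dn n y) = b" by blast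
    qed
  qed
  have Q: "Q y" if "y \<in> K x" for y
  proof -
    have "(x, y) \<in> (D \<union> D\<inverse>)\<^sup>*" using that by (simp add: K_def)
    then show ?thesis
    proof induction
      case base
      then show ?case unfolding Q_def using bx by blast
    next
      case (step y z)
      then obtain a c where ac: "\<And>n. Dn (a + n) y = Dn (c + n) x" and cy: "\<exists>m. \<forall>n\<ge>m. card (Dn n y) = b"
        unfolding Q_def by blast
      from step(2) show ?case
      proof
        assume yz: "(y, z) \<in> D"
        then have cz: "\<exists>m. \<forall>n\<ge>m. card (Dn n z) = b" using card_edge cy by blast
        then obtain m where m: "\<And>n. n \<ge> m \<Longrightarrow> Dn n y = Dn (Suc n) z" using edge[OF yz cy] by blast
        have "Dn (Suc (a + m) + n) z = Dn (c + m + n) x" for n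
          using m[of "a + m + n"] ac[of "m + n"] by (simp add: add.assoc)
        then show ?thesis unfolding Q_def using cz by blast
      next
        assume "(y, z) \<in> D\<inverse>"
        then have zy: "(z, y) \<in> D" by simp
        then have cz: "\<exists>m. \<forall>n\<ge>m. card (Dn n z) = b" using card_edge cy by blast
        then obtain m where m: "\<And>n. n \<ge> m \<Longrightarrow> Dn n z = Dn (Suc n) y" using edge[OF zy cz cy] by blast
        have "Dn (a + m + n) z = Dn (Suc (c + m) + n) x" for n
          using m[of "a + m + n"] ac[of "Suc (m + n)"] by (simp add: add.assoc)
        then show ?thesis unfolding Q_def using cz by blast
      qed
    qed
  qed
  let ?W = "K x \<inter> lev (P x)"
  have same: "\<exists>a. \<forall>n\<ge>a. Dn n y = Dn n x" if y: "y \<in> ?W" for y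
  proof -
    obtain a c where ac: "\<And>n. Dn (a + n) y = Dn (c + n) x" using Q y unfolding Q_def by blast
    have Vy: "y \<in> V" using y by (simp add: lev_def)
    obtain z where "z \<in> Dn a y" "z \<in> Dn c x" using ac[of 0] Dn_nonempty[OF Vy, of a] by auto
    then have "P y = P z + int a * int t" "P x = P z + int c * int t"
      unfolding Dn_def using relpow_D_P by blast+
    then have "a = c" using y t_pos by (simp add: lev_def)
    then have "Dn n y = Dn n x" if "n \<ge> a" for n using ac[of "n - a"] that by simp
    then show ?thesis by blast
  qed
  then obtain A where A: "\<And>y n. y \<in> ?W \<Longrightarrow> n \<ge> A y \<Longrightarrow> Dn n y = Dn n x" by metis
  \<comment> \<open>One depth that works for all vertices of the class at the height of
    \<open>x\<close>; adding \<open>r\<close> ensures that the count at \<open>x\<close> has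
    settled.\<close>
  define M where "M = Max (A ` ?W) + r"
  have M: "A y \<le> M" if "y \<in> ?W" for y
    using Max_ge[of "A ` ?W" "A y"] that finite_lev unfolding M_def by (simp add: trans_le_add1)
  \<comment> \<open>Any vertex this far down climbs along \<open>D\<close> to some vertex at the
    height of \<open>x\<close>, whose predecessors at depth \<open>M\<close> are those of
    \<open>x\<close>.\<close>
  have "K x \<inter> lev (P x + (- int M) * int t) \<subseteq> Dn M x"
  proof
    fix z assume z: "z \<in> K x \<inter> lev (P x + (- int M) * int t)"
    then have zV: "z \<in> V" by (simp add: lev_def)
    obtain y where y: "(z, y) \<in> D ^^ M" using relpow_D_out[OF zV] by blast
    have "y \<in> K x" using K_relpow[OF y] K_eq[of z x] z by blast
    moreover have "P y = P x" using relpow_D_P[OF y] z by (simp add: lev_def)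
    ultimately have "y \<in> ?W" using relpow_D_V[OF y] zV by (simp add: lev_def)
    then show "z \<in> Dn M x" using A[of y M] M[of y] y by (auto simp: Dn_def)
  qed
  then have "k \<le> card (Dn M x)" using card_mono[OF finite_Dn[OF x]] card_K_level[OF x] by metis
  moreover have "card (Dn M x) = b" using bx by (simp add: M_def)
  ultimately show ?thesis using card_Dn_le[OF x, of r] by (simp add: b_def)
qed

text \<open>By \<open>Dn_full\<close> a stall over two steps can occur only at the full size
  \<open>k\<close>; otherwise two steps gain at least one vertex.\<close>

lemma card_Dn_ge: assumes "x \<in> V" shows "min k (1 + r div 2) \<le> card (Dn r x)"
proof (induction r rule: less_induct)
  case (less r)
  show ?case
  proof (cases "r < 2")
    case True
    have "card (Dn r x) > 0" using Dn_nonempty finite_Dn assms by (simp add: card_gt_0_iff)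
    then show ?thesis using True by simp
  next
    case False
    then obtain q where q: "r = q + 2" by (metis add.commute le_Suc_ex not_less)
    have IH: "min k (1 + q div 2) \<le> card (Dn q x)" using less q by simp
    show ?thesis
    proof (cases "card (Dn (q + 2) x) = card (Dn q x)")
      case True
      then show ?thesis using Dn_full[OF assms True] q by simp
    next
      case False
      then have "card (Dn q x) < card (Dn (q + 2) x)" using card_Dn_mono[OF assms, of q "q + 2"] by simp
      then show ?thesis using IH q by simp
    qed
  qed
qed

section \<open>Distances within a class and between neighbouring levels\<close>

lemma common_predecessor:
  assumes "x \<in> V" "y \<in> K x" "P y = P x + (int n - int m) * int t" "k < card (Dn m x) + card (Dn n y)"
  shows "y \<in> ball x (m + n)"
proof -
  have yV: "y \<in> V" using K_V_P assms by blast
  let ?L = "K x \<inter> lev (P x + (- int m) * int t)"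
  have "Dn m x \<subseteq> ?L" using Dn_subset assms by blast
  moreover have "P y + (- int n) * int t = P x + (- int m) * int t" using assms(3) by (simp add: algebra_simps)
  then have "Dn n y \<subseteq> ?L" using Dn_subset[OF yV, of n] K_eq[OF assms(2)] by simp
  moreover have "finite ?L" "card ?L = k" using finite_lev card_K_level[OF assms(1), of "- int m"] by auto
  \<comment> \<open>Pigeonhole: both predecessor sets lie in the same level of the class, which has
    only \<open>k\<close> vertices.\<close>
  ultimately have "Dn m x \<inter> Dn n y \<noteq> {}"
    using assms(4) card_Un_disjoint[OF finite_Dn[OF assms(1)] finite_Dn[OF yV], of m n]
      card_mono[of ?L "Dn m x \<union> Dn n y"] by auto
  then obtain z where "(z, x) \<in> D ^^ m" "(z, y) \<in> D ^^ n" by (auto simp: Dn_def)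
  then show ?thesis using relpow_D_ball ball_sym ball_trans by blast
qed

lemma K_dist_same: assumes "x \<in> V" "y \<in> K x" "P y = P x" shows "y \<in> ball x (2 * k)"
proof -
  have yV: "y \<in> V" using K_V_P assms by blast
  \<comment> \<open>Each summand is at least \<open>min k (1 + k div 2)\<close>, which is more than
    half of \<open>k\<close>.\<close>
  have "k < card (Dn k x) + card (Dn k y)"
    using card_Dn_ge[OF assms(1), of k] card_Dn_ge[OF yV, of k] k_pos by linarith
  then show ?thesis using common_predecessor[of x y k k] assms by (simp add: mult_2)
qed

lemma K_dist_adjacent: assumes "x \<in> V" "y \<in> K x" "P y = P x + int t" shows "y \<in> ball x (2 * k)"
proof -
  have yV: "y \<in> V" using K_V_P assms by blast
  \<comment> \<open>One step less suffices below the lower vertex: since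
    \<open>l div 2 + k div 2 = l\<close>, the two sizes still add up to at least
    \<open>k + 1\<close>.\<close>
  obtain l where l: "k = Suc l" using k_pos by (metis not0_implies_Suc not_less0)
  have "k < card (Dn l x) + card (Dn k y)"
    using card_Dn_ge[OF assms(1), of l] card_Dn_ge[OF yV, of k] l by linarith
  then have "y \<in> ball x (l + k)" using common_predecessor[of x y k l] assms l by simp
  then show ?thesis using ball_mono[of "l + k" "2 * k" x] l by auto
qed

text \<open>The first \<open>n - 1\<close> layers are climbed along \<open>D\<close>, the last one
  costs \<open>2 * k\<close>. For \<open>n = 0\<close> the truncated subtraction leaves the bound
  for equal heights.\<close>

lemma K_dist: assumes "x \<in> V" "y \<in> K x" "P y = P x + int n * int t" shows "y \<in> ball x (2 * k + (n - 1))"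
proof (cases n)
  case 0
  then show ?thesis using K_dist_same assms by simp
next
  case (Suc m)
  obtain z where z: "(x, z) \<in> D ^^ m" using relpow_D_out assms by blast
  have "z \<in> K x" using K_relpow z by blast
  then have "z \<in> V" "y \<in> K z" using assms K_V_P K_eq by blast+
  moreover have "P y = P z + int t" using relpow_D_P[OF z] assms(3) Suc by (simp add: algebra_simps)
  ultimately have "y \<in> ball z (2 * k)" using K_dist_adjacent by blast
  then have "y \<in> ball x (m + 2 * k)" using relpow_D_ball[OF z] ball_trans by blast
  then show ?thesis using Suc by (simp add: add.commute)
qed

lemma cohesive_dist:
  assumes "u \<in> V" "v \<in> V" "\<bar>P v - P u\<bar> \<le> 1"
  shows "v \<in> ball u (2 * s * t)"
proof -
  obtain w where w: "w \<in> ball u (N - 1)" "K w = K v" using ball_meets_class assms by blast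
  have wV: "w \<in> V" using w ball_V assms by blast
  have vw: "v \<in> K w" "w \<in> K v" using w K_refl by blast+
  then obtain j where j: "P v = P w + j * int t" using K_V_P wV by blast
  have "N > 0" using classes s_pos t_pos by (metis mult_0 nat_0_less_mult_iff)
  \<comment> \<open>Reaching the class of \<open>v\<close> changes the height by at most
    \<open>(N - 1) * t\<close>; the possible extra level between \<open>u\<close> and
    \<open>v\<close> is absorbed by one further layer.\<close>
  have "\<bar>j * int t\<bar> \<le> int (N - 1) * int t + 1" using ball_P[OF w(1)] assms(3) j by linarith
  also have "\<dots> \<le> int N * int t" using t_pos \<open>N > 0\<close> by (simp add: of_nat_diff algebra_simps)
  finally have "\<bar>j\<bar> \<le> int N" using t_pos by (simp add: abs_mult)
  then have jN: "nat \<bar>j\<bar> \<le> N" by simp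
  have "v \<in> ball w (2 * k + (nat \<bar>j\<bar> - 1))"
  proof (cases "j \<ge> 0")
    case True
    then show ?thesis using K_dist[OF wV vw(1), of "nat \<bar>j\<bar>"] j by simp
  next
    case False
    then have "w \<in> ball v (2 * k + (nat \<bar>j\<bar> - 1))" using K_dist[OF assms(2) vw(2), of "nat \<bar>j\<bar>"] j by simp
    then show ?thesis using ball_sym by blast
  qed
  then have "v \<in> ball u (N - 1 + (2 * k + (nat \<bar>j\<bar> - 1)))" using ball_trans[OF w(1)] by blast
  \<comment> \<open>In the worst case |j| = N this amounts to 2 * (N - 1) * (k - 1) \<ge> 0.\<close>
  moreover have "N - 1 + (2 * k + (nat \<bar>j\<bar> - 1)) \<le> 2 * (N * k)"
  proof -
    obtain a b where ab: "N = Suc a" "k = Suc b" using \<open>N > 0\<close> k_pos by (metis gr0_implies_Suc)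
    then show ?thesis using jN by simp
  qed
  ultimately show ?thesis using classes(2) ball_mono by (metis mult.assoc subsetD)
qed

end

subsection \<open>Separators and the cyclic order of the levels\<close>

context layered
begin

lemma ball_walk_closed:
  assumes "closed_off S C" "x \<in> C" "(x, y) \<in> E ^^ i"
    and "\<And>z. z \<in> V \<Longrightarrow> \<bar>P z - P x\<bar> \<le> int i * int t \<Longrightarrow> z \<notin> S"
  shows "y \<in> C"
  using assms(3,4)
proof (induction i arbitrary: y)
  case (Suc i)
  then obtain z where z: "(x, z) \<in> E ^^ i" "(z, y) \<in> E" by auto
  have "z \<in> C"
  proof (rule Suc.IH[OF z(1)])
    fix w assume "w \<in> V" "\<bar>P w - P x\<bar> \<le> int i * int t"
    then show "w \<notin> S" using Suc.prems(2)[of w] by (simp add: algebra_simps)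
  qed
  moreover have "y \<in> ball x (Suc i)" using Suc.prems(1) unfolding ball_def by blast
  then have "y \<notin> S" using Suc.prems(2)[of y] ball_P[of y x "Suc i"] edge_verts[OF z(2)] by blast
  ultimately show ?case using z(2) assms(1) unfolding closed_off_def by blast
qed (use assms(2) in simp)

text \<open>Cohesion joins vertices of equal or neighbouring levels by walks of length at most
  \<open>2 * s * t\<close>, along which the height changes by at most \<open>2 * s * t * t\<close>.
  Starting beyond \<open>M\<close>, such walks miss \<open>S\<close>, so \<open>C\<close> spreads
  from level to level over the whole side. The sign \<open>\<epsilon>\<close> treats both sides at
  once.\<close>

lemma far_side:
  assumes C: "closed_off S C" and S: "\<And>z. z \<in> S \<Longrightarrow> \<bar>P z\<bar> \<le> n"
    and \<epsilon>: "\<epsilon> = 1 \<or> \<epsilon> = (- 1 :: int)"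
    and M: "M = n + int (2 * s * t) * int t + 1"
    and x: "x \<in> C" "\<epsilon> * P x \<ge> M" and y: "y \<in> V" "\<epsilon> * P y \<ge> M"
  shows "y \<in> C"
proof -
  have C_V: "C \<subseteq> V" using C unfolding closed_off_def by blast
  have near: "v \<in> C" if "u \<in> C" "v \<in> V" "\<epsilon> * P u \<ge> M" "\<bar>P v - P u\<bar> \<le> 1" for u v
  proof -
    have "v \<in> ball u (2 * s * t)" using cohesive_dist[of u v] that(1,2,4) C_V by blast
    then obtain i where i: "i \<le> 2 * s * t" "(u, v) \<in> E ^^ i" unfolding ball_def by blast
    show ?thesis
    proof (rule ball_walk_closed[OF C that(1) i(2)])
      fix z assume "\<bar>P z - P u\<bar> \<le> int i * int t"
      also have "\<dots> \<le> int (2 * s * t) * int t" by (rule mult_right_mono) (use i(1) in \<open>simp_all only: of_nat_le_iff of_nat_0_le_iff\<close>)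
      finally have "\<bar>P z - P u\<bar> \<le> M - n - 1" using M by linarith
      moreover have "\<bar>P u\<bar> \<ge> M" using that(3) \<epsilon> by (elim disjE) simp_all
      ultimately have "\<bar>P z\<bar> > n" by linarith
      then show "z \<notin> S" using S by force
    qed
  qed
  \<comment> \<open>The induction runs in both directions from the level of \<open>x\<close>;
    downwards it matters only as far as \<open>M\<close>.\<close>
  have "\<forall>v\<in>V. \<epsilon> * P v = j \<longrightarrow> j \<ge> M \<longrightarrow> v \<in> C" for j
  proof (induction j rule: int_induct[of _ "\<epsilon> * P x"])
    case base
    have "P v = P x" if "\<epsilon> * P v = \<epsilon> * P x" for v using that \<epsilon> by auto
    then have "v \<in> C" if "v \<in> V" "\<epsilon> * P v = \<epsilon> * P x" for v
      using near[OF x(1) that(1) x(2)] that(2) by fastforce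
    then show ?case by blast
  next
    case (step1 j)
    show ?case
    proof (intro ballI impI)
      fix v assume v: "v \<in> V" "\<epsilon> * P v = j + 1"
      obtain u where u: "u \<in> V" "P u = \<epsilon> * j" using P_obtain by blast
      have eu: "\<epsilon> * P u = j" using u \<epsilon> by auto
      have jM: "j \<ge> M" using step1(1) x(2) by simp
      have "u \<in> C" using step1(2) u(1) eu jM by blast
      moreover have "\<bar>P v - P u\<bar> \<le> 1" using v(2) eu \<epsilon> by auto
      ultimately show "v \<in> C" using near v(1) eu jM by blast
    qed
  next
    case (step2 j)
    show ?case
    proof (intro ballI impI)
      fix v assume v: "v \<in> V" "\<epsilon> * P v = j - 1" and jM: "j - 1 \<ge> M"
      obtain u where u: "u \<in> V" "P u = \<epsilon> * j" using P_obtain by blast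
      have eu: "\<epsilon> * P u = j" using u \<epsilon> by auto
      have "u \<in> C" using step2(2) u(1) eu jM by simp
      moreover have "\<bar>P v - P u\<bar> \<le> 1" using v(2) eu \<epsilon> by auto
      moreover have "\<epsilon> * P u \<ge> M" using eu jM by simp
      ultimately show "v \<in> C" using near v(1) by blast
    qed
  qed
  then show ?thesis using y by blast
qed

text \<open>Every \<open>D\<close>-predecessor of a vertex of \<open>A\<close> lies in
  \<open>A\<close> or in \<open>S\<close>. So when the level rises by \<open>t\<close>, the number
  of vertices of \<open>A\<close> grows by at most the number of vertices of \<open>S\<close> in the
  lower level. From far left to far right it grows from 0 to \<open>s\<close> in each residue class
  modulo \<open>t\<close>.\<close>

lemma cut_size:
  assumes A: "closed_off S A" and S: "finite S" "S \<subseteq> V"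
    and right: "\<And>v. v \<in> V \<Longrightarrow> P v \<ge> M \<Longrightarrow> v \<in> A"
    and left: "\<And>v. v \<in> V \<Longrightarrow> P v \<le> - M \<Longrightarrow> v \<notin> A"
  shows "s * t \<le> card S"
proof -
  define a where "a j = card (A \<inter> lev j)" for j
  \<comment> \<open>Chosen so that \<open>a\<close> vanishes on the \<open>t\<close> levels starting
    at \<open>-L\<close> and equals \<open>s\<close> on the \<open>t\<close> levels starting at
    \<open>L\<close>; these are all that survives when the shifted sums are compared.\<close>
  define L where "L = \<bar>M\<bar> + int t"
  have step: "a (j + int t) \<le> a j + card (S \<inter> lev j)" for j
  proof -
    have fin: "finite (A \<inter> lev (j + int t))" using finite_lev by blast
    have "a (j + int t) \<le> card (D\<inverse> `` (A \<inter> lev (j + int t)))"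
      unfolding a_def by (rule card_down[OF fin]) (auto simp: lev_def)
    also have "\<dots> \<le> card (A \<inter> lev j \<union> S \<inter> lev j)"
    proof (rule card_mono)
      show "D\<inverse> `` (A \<inter> lev (j + int t)) \<subseteq> A \<inter> lev j \<union> S \<inter> lev j"
      proof
        fix x assume "x \<in> D\<inverse> `` (A \<inter> lev (j + int t))"
        then obtain y where y: "(x, y) \<in> D" "y \<in> A" "P y = j + int t" by (auto simp: lev_def)
        then have "x \<in> lev j" using D_P D_V by (auto simp: lev_def)
        moreover have "(y, x) \<in> E" using y D_E edge_sym by blast
        then have "x \<in> A \<or> x \<in> S" using y A unfolding closed_off_def by blast
        ultimately show "x \<in> A \<inter> lev j \<union> S \<inter> lev j" by blast
      qed
    qed (use finite_lev in blast)
    also have "\<dots> \<le> a j + card (S \<inter> lev j)" unfolding a_def by (rule card_Un_le)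
    finally show ?thesis .
  qed
  have a_right: "a j = s" if "j \<ge> L" for j
  proof -
    have "A \<inter> lev j = lev j" using right that unfolding L_def lev_def by force
    then show ?thesis by (simp add: a_def card_lev)
  qed
  have a_left: "a j = 0" if "j < - L + int t" for j
  proof -
    have "A \<inter> lev j = {}" using left that unfolding L_def lev_def by force
    then show ?thesis by (simp add: a_def)
  qed
  have L: "L \<ge> int t" by (simp add: L_def)
  have "(\<Sum>j\<in>{-L..<L + int t}. a j) = (\<Sum>j\<in>{-L..<-L + int t}. a j) + (\<Sum>j\<in>{-L + int t..<L + int t}. a j)"
    by (subst sum.union_disjoint[symmetric]) (use L in \<open>auto intro!: sum.cong\<close>)
  moreover have "(\<Sum>j\<in>{-L..<-L + int t}. a j) = 0" using a_left by simp
  moreover have "(\<Sum>j\<in>{-L + int t..<L + int t}. a j) = (\<Sum>j\<in>{-L..<L}. a (j + int t))"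
    by (rule sum.reindex_bij_witness[of _ "\<lambda>j. j + int t" "\<lambda>j. j - int t"]) auto
  moreover have "(\<Sum>j\<in>{-L..<L + int t}. a j) = (\<Sum>j\<in>{-L..<L}. a j) + (\<Sum>j\<in>{L..<L + int t}. a j)"
    by (subst sum.union_disjoint[symmetric]) (use L in \<open>auto intro!: sum.cong\<close>)
  moreover have "(\<Sum>j\<in>{L..<L + int t}. a j) = s * t" using a_right by simp
  moreover have "(\<Sum>j\<in>{-L..<L}. a (j + int t)) \<le> (\<Sum>j\<in>{-L..<L}. a j + card (S \<inter> lev j))"
    by (rule sum_mono) (rule step)
  ultimately have "s * t \<le> (\<Sum>j\<in>{-L..<L}. card (S \<inter> lev j))" by (simp add: sum.distrib)
  also have "\<dots> = card (\<Union>j\<in>{-L..<L}. S \<inter> lev j)"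
    by (rule card_UN_disjoint[symmetric]) (use S in \<open>auto simp: lev_def\<close>)
  also have "\<dots> \<le> card S" by (rule card_mono) (use S in auto)
  finally show ?thesis .
qed

text \<open>The levels of bounded height are finite, so each infinite component reaches beyond
  \<open>M\<close> on some side and by \<open>far_side\<close> contains that whole side. Disjoint
  components cannot share a side, hence they occupy opposite ones and \<open>cut_size\<close>
  applies.\<close>

lemma separator_size:
  assumes S: "finite S" "S \<subseteq> V" and C: "C \<in> comps S" "infinite C" and F: "F \<in> comps S" "infinite F"
    and "C \<noteq> F"
  shows "s * t \<le> card S"
proof -
  define n where "n = Max (insert 0 ((\<lambda>z. \<bar>P z\<bar>) ` S))"
  have n: "\<bar>P z\<bar> \<le> n" if "z \<in> S" for z unfolding n_def using S that by (intro Max_ge) auto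
  define M where "M = n + int (2 * s * t) * int t + 1"
  have M_pos: "M > 0" unfolding M_def n_def using S by (simp add: add_nonneg_pos)
  have far: "\<exists>x\<in>A. P x \<ge> M \<or> P x \<le> - M" if "A \<in> comps S" "infinite A" for A
  proof (rule ccontr)
    assume "\<not> ?thesis"
    then have "A \<subseteq> (\<Union>j\<in>{-M..M}. lev j)" using comp_subset[OF that(1)] unfolding lev_def by fastforce
    moreover have "finite (\<Union>j\<in>{-M..M}. lev j)" using finite_lev by blast
    ultimately show False using that(2) finite_subset by blast
  qed
  have side: "(\<forall>v\<in>V. P v \<ge> M \<longrightarrow> v \<in> A) \<or> (\<forall>v\<in>V. P v \<le> - M \<longrightarrow> v \<in> A)" if A: "A \<in> comps S" "infinite A" for A
  proof -
    obtain x where x: "x \<in> A" "P x \<ge> M \<or> P x \<le> - M" using far[OF A] by blast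
    from x(2) show ?thesis
    proof
      assume "P x \<ge> M"
      then show ?thesis using far_side[OF comp_closed_off[OF A(1)] n, of 1 M x] x M_def by auto
    next
      assume "P x \<le> - M"
      then show ?thesis using far_side[OF comp_closed_off[OF A(1)] n, of "-1" M x] x M_def by auto
    qed
  qed
  have disj: "C \<inter> F = {}" using comp_disjoint assms by blast
  have *: "s * t \<le> card S" if AB: "A \<in> comps S" "B \<in> comps S" "A \<inter> B = {}"
    "\<forall>v\<in>V. P v \<ge> M \<longrightarrow> v \<in> A" "\<forall>v\<in>V. P v \<le> - M \<longrightarrow> v \<in> B" for A B
    by (rule cut_size[OF comp_closed_off[OF AB(1)] S, of M]) (use AB in blast)+
  obtain v w where vw: "v \<in> V" "P v = M" "w \<in> V" "P w = - M" using P_obtain by metis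
  then have "\<not> ((\<forall>v\<in>V. P v \<ge> M \<longrightarrow> v \<in> C) \<and> (\<forall>v\<in>V. P v \<ge> M \<longrightarrow> v \<in> F))"
    "\<not> ((\<forall>v\<in>V. P v \<le> - M \<longrightarrow> v \<in> C) \<and> (\<forall>v\<in>V. P v \<le> - M \<longrightarrow> v \<in> F))"
    using disj by force+
  then show ?thesis
    using side[OF C] side[OF F] *[OF C(1) F(1) disj] *[OF F(1) C(1)] disj by blast
qed

lemma infinite_half: "infinite {v \<in> V. P v \<ge> a}" "infinite {v \<in> V. P v < a}"
proof -
  have "{a..} \<subseteq> P ` {v \<in> V. P v \<ge> a}" "{..<a} \<subseteq> P ` {v \<in> V. P v < a}"
    using P_obtain by (auto simp: image_iff) metis+
  then show "infinite {v \<in> V. P v \<ge> a}" "infinite {v \<in> V. P v < a}"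
    using infinite_Ici[of a] infinite_Iio[of a] by (meson finite_imageI finite_subset)+
qed

section \<open>The value of \<open>kappa_inf\<close> and the cyclic system of levels\<close>

lemma kappa_inf_eq: "kappa_inf G = enat (s * t)"
proof (rule antisym)
  let ?W = "{v \<in> V. 0 \<le> P v \<and> P v < 0 + int t}"
  have W: "finite ?W" "?W \<subseteq> V" "card ?W = s * t" using card_slice[of 0] by auto
  \<comment> \<open>No edge spans more than \<open>t\<close> levels, so none jumps over the
    window.\<close>
  have "closed_off ?W {v \<in> V. P v \<ge> int t}"
    unfolding closed_off_def using span edge_verts by fastforce
  then obtain C where C: "C \<in> comps ?W" "infinite C" "C \<subseteq> {v \<in> V. P v \<ge> int t}"
    using infinite_comp_ex[OF W(1,2) _ infinite_half(1)] by meson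
  have "closed_off ?W {v \<in> V. P v < 0}"
    unfolding closed_off_def using span edge_verts by fastforce
  then obtain F where F: "F \<in> comps ?W" "infinite F" "F \<subseteq> {v \<in> V. P v < 0}"
    using infinite_comp_ex[OF W(1,2) _ infinite_half(2)] by meson
  have "C \<noteq> F"
  proof
    assume "C = F"
    moreover obtain x where "x \<in> C" using comp_nonempty[OF C(1)] by blast
    ultimately have "P x \<ge> int t" "P x < 0" using C(3) F(3) by blast+
    then show False by simp
  qed
  then have "enat (s * t) \<in> {ecard S | S. S \<subseteq> V \<and>
     (\<exists>C D. C \<in> comps S \<and> D \<in> comps S \<and> C \<noteq> D \<and> infinite C \<and> infinite D)}"
    using W C F by (intro CollectI exI[of _ ?W]) (auto simp: ecard_def)
  then show "kappa_inf G \<le> enat (s * t)" unfolding kappa_inf_def by (rule Inf_lower)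
  show "enat (s * t) \<le> kappa_inf G" unfolding kappa_inf_def
  proof (rule Inf_greatest)
    fix x assume "x \<in> {ecard S | S. S \<subseteq> V \<and>
     (\<exists>C D. C \<in> comps S \<and> D \<in> comps S \<and> C \<noteq> D \<and> infinite C \<and> infinite D)}"
    then obtain S C F where S: "x = ecard S" "S \<subseteq> V" "C \<in> comps S" "F \<in> comps S" "C \<noteq> F"
      "infinite C" "infinite F" by blast
    show "enat (s * t) \<le> x"
    proof (cases "finite S")
      case True
      then show ?thesis using separator_size[OF True S(2,3,6,4,7,5)] S(1) by (simp add: ecard_def)
    qed (simp add: S(1) ecard_def)
  qed
qed

definition \<sigma> :: "'a set set" where "\<sigma> = range lev"

definition R :: "('a set \<times> 'a set) set" where
  "R = {(lev i, lev j) | i j. j = i + 1 \<or> i = j + 1}"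

lemma lev_eq_iff [simp]: "lev i = lev j \<longleftrightarrow> i = j"
  using lev_inj by blast

lemma lev_R [simp]: "(lev i, lev j) \<in> R \<longleftrightarrow> j = i + 1 \<or> i = j + 1"
  unfolding R_def by auto

lemma partition_lev: "partition_on V \<sigma>"
proof (rule partition_onI)
  show "\<Union> \<sigma> = V" unfolding \<sigma>_def lev_def by blast
  show "disjnt p q" if "p \<in> \<sigma>" "q \<in> \<sigma>" "p \<noteq> q" for p q
    using that unfolding \<sigma>_def lev_def disjnt_def by auto
  show "{} \<notin> \<sigma>" using lev_nonempty unfolding \<sigma>_def by auto
qed

lemma cyclic_system_lev: "cyclic_system G \<sigma> R"
  unfolding cyclic_system_def
proof (intro conjI allI impI)
  show "system_of_imprimitivity G \<sigma>"
    unfolding system_of_imprimitivity_def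
  proof (intro conjI partition_lev allI impI)
    fix f assume f: "aut f"
    show "bij_betw ((`) f) \<sigma> \<sigma>"
      using aut_lev[OF f]
    proof (elim disjE exE)
      fix c assume c: "\<forall>j. f ` lev j = lev (j + c)"
      show ?thesis
        by (rule bij_betw_byWitness[of _ "\<lambda>B. lev (inv lev B - c)"])
          (use c lev_inj in \<open>auto simp: \<sigma>_def inv_f_f inj_def\<close>)
    next
      fix c assume c: "\<forall>j. f ` lev j = lev (c - j)"
      show ?thesis
        by (rule bij_betw_byWitness[of _ "\<lambda>B. lev (c - inv lev B)"])
          (use c lev_inj in \<open>auto simp: \<sigma>_def inv_f_f inj_def\<close>)
    qed
  qed
  have "bij_betw lev UNIV \<sigma>" unfolding \<sigma>_def bij_betw_def inj_def using lev_inj by blast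
  then show "cyclic_order \<sigma> R"
    unfolding cyclic_order_def is_two_way_infinite_path_def order_graph_def
    by (auto simp: R_def intro!: symI exI[of _ lev])
  fix f assume f: "aut f"
  show "\<forall>A\<in>\<sigma>. \<forall>B\<in>\<sigma>. (A, B) \<in> R \<longleftrightarrow> (f ` A, f ` B) \<in> R"
    using aut_lev[OF f] unfolding \<sigma>_def by (elim disjE exE) auto
qed

lemma ring_like_lev: "ring_like s t G \<sigma> R"
  unfolding ring_like_def
proof (intro conjI ballI impI)
  show "finite B" "card B = s" if "B \<in> \<sigma>" for B
    using that finite_lev card_lev unfolding \<sigma>_def by blast+
  fix A B u v assume AB: "A \<in> \<sigma>" "B \<in> \<sigma>" and uv: "u \<in> A" "v \<in> B" "(u, v) \<in> E"
  then have eq: "A = lev (P u)" "B = lev (P v)" unfolding \<sigma>_def lev_def by blast+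
  have plus: "(lev i, lev (i + int n)) \<in> R ^^ n" for i n
  proof (induction n)
    case (Suc n)
    then show ?case by (auto intro!: relcompI[of _ "lev (i + int n)"])
  qed simp
  have minus: "(lev i, lev (i - int n)) \<in> R ^^ n" for i n
  proof (induction n)
    case (Suc n)
    then show ?case by (auto intro!: relcompI[of _ "lev (i - int n)"])
  qed simp
  define n where "n = nat \<bar>P v - P u\<bar>"
  have "n \<le> t" using span[OF uv(3)] by (simp add: n_def)
  have "P v = P u + int n \<or> P v = P u - int n" by (auto simp: n_def)
  then have "(A, B) \<in> R ^^ n" unfolding eq using plus[of "P u" n] minus[of "P u" n] by auto
  moreover have "edges (order_graph \<sigma> R) \<subseteq> verts (order_graph \<sigma> R) \<times> verts (order_graph \<sigma> R)"
    unfolding order_graph_def R_def \<sigma>_def by auto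
  ultimately obtain p where p: "path_betw (order_graph \<sigma> R) A p B" "path_length p \<le> n"
    using relpow_imp_path_betw[of "order_graph \<sigma> R" A B n] AB by (auto simp: order_graph_def)
  have "graph_dist (order_graph \<sigma> R) A B \<le> enat (path_length p)"
    unfolding graph_dist_def by (rule Inf_lower) (use p in blast)
  also have "\<dots> \<le> enat t" using p(2) \<open>n \<le> t\<close> by simp
  finally show "graph_dist (order_graph \<sigma> R) A B \<le> enat t" .
qed

lemma cohesive_lev: "cohesive (2 * s * t) G \<sigma> R"
  unfolding cohesive_def
proof (intro ballI impI)
  fix A B u v assume AB: "A \<in> \<sigma>" "B \<in> \<sigma>" "A = B \<or> (A, B) \<in> R" and uv: "u \<in> A" "v \<in> B"
  then have eq: "A = lev (P u)" "B = lev (P v)" and V: "u \<in> V" "v \<in> V" unfolding \<sigma>_def lev_def by auto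
  have "\<bar>P v - P u\<bar> \<le> 1" using AB(3) unfolding eq by auto
  then obtain i where i: "i \<le> 2 * s * t" "(u, v) \<in> E ^^ i"
    using cohesive_dist[OF V] unfolding ball_def by blast
  then show "\<exists>p. path_betw G u p v \<and> path_length p \<le> 2 * s * t"
    using relpow_imp_path_betw[OF E_subset V(1) i(2)] by (meson le_trans)
qed

theorem ring_structure:
  "\<exists>s t :: nat. \<exists>\<sigma> R. s > 0 \<and> t > 0 \<and> cyclic_system G \<sigma> R \<and>
     ring_like s t G \<sigma> R \<and> cohesive (2 * s * t) G \<sigma> R \<and> kappa_inf G = enat (s * t)"
  using s_pos t_pos cyclic_system_lev ring_like_lev cohesive_lev kappa_inf_eq by blast

end

subsection \<open>From heights to layers\<close>

text \<open>Closure under differences makes \<open>S\<close> a nontrivial subgroup of the integers.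
  Its least positive element generates it, by division with remainder.\<close>

lemma int_subgroup:
  fixes S :: "int set"
  assumes diff: "\<And>a b. a \<in> S \<Longrightarrow> b \<in> S \<Longrightarrow> a - b \<in> S" and x: "x \<in> S" "x \<noteq> 0"
  shows "\<exists>g>0. S = range ((*) g)"
proof -
  have zero: "0 \<in> S" using diff[OF x(1) x(1)] by simp
  have neg: "- a \<in> S" if "a \<in> S" for a using diff[OF zero that] by simp
  have add: "a + b \<in> S" if "a \<in> S" "b \<in> S" for a b using diff[OF that(1) neg[OF that(2)]] by simp
  define n where "n = (LEAST n. n > 0 \<and> int n \<in> S)"
  have "nat \<bar>x\<bar> > 0 \<and> int (nat \<bar>x\<bar>) \<in> S" using x neg[OF x(1)] by (simp add: abs_if)
  then have n: "n > 0" "int n \<in> S" unfolding n_def by (metis (mono_tags, lifting) LeastI)+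
  have least: "n \<le> m" if "m > 0" "int m \<in> S" for m unfolding n_def using that by (simp add: Least_le)
  have mult_nat: "int n * int j \<in> S" for j
    by (induction j) (use zero add n in \<open>auto simp: algebra_simps\<close>)
  have mult: "int n * j \<in> S" for j
    using mult_nat[of "nat j"] neg[OF mult_nat[of "nat (- j)"]] by (cases "j \<ge> 0") simp_all
  have "\<exists>j. a = int n * j" if a: "a \<in> S" for a
  proof -
    have eq: "a mod int n = a - int n * (a div int n)" by (simp add: minus_mult_div_eq_mod)
    then have "a mod int n \<in> S" using diff[OF a mult] by simp
    moreover have "0 \<le> a mod int n" "a mod int n < int n" using n by auto
    ultimately have "a mod int n = 0" using least[of "nat (a mod int n)"] by fastforce
    then show ?thesis using eq by auto
  qed
  then have "S = range ((*) (int n))" using mult by auto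
  then show ?thesis using n(1) by (intro exI[of _ "int n"]) simp
qed

locale heighted = vt_graph +
  fixes pos :: "'a \<Rightarrow> int"
  assumes aut_pos: "aut f \<Longrightarrow>
      (\<exists>c. \<forall>v\<in>V. pos (f v) = pos v + c) \<or> (\<exists>c. \<forall>v\<in>V. pos (f v) = c - pos v)"
    and finite_pos: "finite {v \<in> V. pos v = j}"
    and infinite_V: "infinite V"
begin

text \<open>The sign \<open>e\<close> covers translations (1) and reflections (-1) of the height
  uniformly, so that composition multiplies signs.\<close>

definition acts :: "('a \<Rightarrow> 'a) \<Rightarrow> int \<Rightarrow> int \<Rightarrow> bool" where
  "acts f e c \<longleftrightarrow> aut f \<and> (\<forall>v\<in>V. pos (f v) = e * pos v + c)"

lemma acts_aut: "acts f e c \<Longrightarrow> aut f"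
  by (simp add: acts_def)

lemma acts_pos: "acts f e c \<Longrightarrow> v \<in> V \<Longrightarrow> pos (f v) = e * pos v + c"
  by (simp add: acts_def)

lemma aut_acts: "aut f \<Longrightarrow> \<exists>e c. (e = 1 \<or> e = - 1) \<and> acts f e c"
proof -
  assume f: "aut f"
  from aut_pos[OF f] show ?thesis
  proof (elim disjE exE)
    fix c assume "\<forall>v\<in>V. pos (f v) = pos v + c"
    then have "acts f 1 c" using f by (simp add: acts_def)
    then show ?thesis by blast
  next
    fix c assume "\<forall>v\<in>V. pos (f v) = c - pos v"
    then have "acts f (- 1) c" using f by (simp add: acts_def)
    then show ?thesis by blast
  qed
qed

lemma acts_comp: "acts f e c \<Longrightarrow> acts g e' c' \<Longrightarrow> acts (g \<circ> f) (e' * e) (e' * c + c')"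
  unfolding acts_def using aut_comp aut_in by (simp add: algebra_simps)

lemma acts_inverse:
  assumes "acts f e c" "e = 1 \<or> e = - 1"
  shows "\<exists>g c'. acts g e c' \<and> (\<forall>x\<in>V. g (f x) = x) \<and> (\<forall>x\<in>V. f (g x) = x)"
proof -
  obtain g where g: "aut g" "\<And>x. x \<in> V \<Longrightarrow> g (f x) = x" "\<And>x. x \<in> V \<Longrightarrow> f (g x) = x"
    using aut_inverse acts_aut[OF assms(1)] by blast
  have "pos (g v) = e * pos v + (- e * c)" if "v \<in> V" for v
    using acts_pos[OF assms(1) aut_in[OF g(1) that]] g(3)[OF that] assms(2) by auto
  then have "acts g e (- e * c)" using g by (simp add: acts_def)
  then show ?thesis using g by blast
qed

section \<open>Orbits of the height-translating automorphisms\<close>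

definition orb :: "'a \<Rightarrow> 'a \<Rightarrow> bool" where
  "orb x y \<longleftrightarrow> (\<exists>f c. acts f 1 c \<and> f x = y)"

lemma orbI: "acts f 1 c \<Longrightarrow> f x = y \<Longrightarrow> orb x y"
  unfolding orb_def by blast

lemma orb_refl: "orb x x"
proof (rule orbI)
  show "acts id 1 0" by (simp add: acts_def automorphism_def)
qed simp

lemma orb_sym: assumes "x \<in> V" "orb x y" shows "orb y x"
proof -
  obtain f c where f: "acts f 1 c" "f x = y" using assms orb_def by blast
  obtain g c' where "acts g 1 c'" "g (f x) = x" using acts_inverse[OF f(1)] assms by blast
  then show ?thesis using f orbI by blast
qed

lemma orb_trans: assumes "orb x y" "orb y z" shows "orb x z"
proof -
  obtain f c g c' where "acts f 1 c" "f x = y" "acts g 1 c'" "g y = z" using assms orb_def by blast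
  then show ?thesis using acts_comp[of f 1 c g 1 c'] by (intro orbI[of "g \<circ> f"]) auto
qed

lemma orb_V: "x \<in> V \<Longrightarrow> orb x y \<Longrightarrow> y \<in> V"
  unfolding orb_def using aut_in acts_aut by blast

lemma not_orb: assumes "x \<in> V" "y \<in> V" "\<not> orb x y" shows "\<exists>f c. acts f (- 1) c \<and> f x = y"
proof -
  obtain f where f: "aut f" "f x = y" using transitive_aut assms by blast
  obtain e c where "e = 1 \<or> e = - 1" "acts f e c" using aut_acts[OF f(1)] by blast
  then show ?thesis using f assms(3) orbI by blast
qed

text \<open>Two reflections of the height compose to a translation.\<close>

lemma two_orbits: assumes "x \<in> V" "y \<in> V" "z \<in> V" "\<not> orb x y" "\<not> orb y z" shows "orb x z"
proof -
  obtain f c where f: "acts f (- 1) c" "f x = y" using not_orb[OF assms(1,2,4)] by blast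
  obtain g c' where g: "acts g (- 1) c'" "g y = z" using not_orb[OF assms(2,3,5)] by blast
  show ?thesis by (rule orbI[of "g \<circ> f"]) (use acts_comp[OF f(1) g(1)] f(2) g(2) in auto)
qed

text \<open>The translations form a normal subgroup: conjugating by \<open>f\<close> multiplies the
  sign by \<open>e * e = 1\<close>.\<close>

lemma aut_orb_imp: assumes "aut f" "x \<in> V" "orb x y" shows "orb (f x) (f y)"
proof -
  obtain e c where e: "e = 1 \<or> e = - 1" and f: "acts f e c" using aut_acts[OF assms(1)] by blast
  obtain g c' where g: "acts g e c'" "g (f x) = x" using acts_inverse[OF f e] assms by blast
  obtain h d where h: "acts h 1 d" "h x = y" using assms orb_def by blast
  have "\<exists>c''. acts (f \<circ> (h \<circ> g)) (e * (1 * e)) c''" using acts_comp[OF acts_comp[OF g(1) h(1)] f] by blast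
  moreover have "e * (1 * e) = 1" using e by auto
  ultimately obtain c'' where "acts (f \<circ> (h \<circ> g)) 1 c''" by metis
  then show ?thesis by (rule orbI) (use g h in simp)
qed

lemma aut_orb: assumes "aut f" "x \<in> V" "y \<in> V" shows "orb (f x) (f y) \<longleftrightarrow> orb x y"
proof
  obtain g where g: "aut g" "\<And>x. x \<in> V \<Longrightarrow> g (f x) = x" "\<And>x. x \<in> V \<Longrightarrow> f (g x) = x"
    using aut_inverse[OF assms(1)] by blast
  assume "orb (f x) (f y)"
  then have "orb (g (f x)) (g (f y))" using aut_orb_imp[OF g(1)] aut_in assms by blast
  then show "orb x y" using g(2) assms by simp
qed (rule aut_orb_imp[OF assms(1,2)])

lemma orb_commute: "x \<in> V \<Longrightarrow> y \<in> V \<Longrightarrow> orb x y \<longleftrightarrow> orb y x"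
  using orb_sym by blast

text \<open>The sign is tied to the action on \<open>pos\<close>, so that \<open>orb\<close> keeps
  its meaning when \<open>pos\<close> is replaced by \<open>Q\<close>.\<close>

definition equivariant :: "('a \<Rightarrow> int) \<Rightarrow> bool" where
  "equivariant Q \<longleftrightarrow> (\<forall>f e c. (e = 1 \<or> e = - 1) \<longrightarrow> acts f e c \<longrightarrow> (\<exists>c'. \<forall>v\<in>V. Q (f v) = e * Q v + c')) \<and>
     (\<forall>j. finite {v \<in> V. Q v = j})"

text \<open>Edges across the orbits reach equally far up and down at every vertex. If a longest edge
  runs across, every vertex thus has both a predecessor and a successor among such edges.\<close>

definition balanced :: "('a \<Rightarrow> int) \<Rightarrow> bool" where
  "balanced Q \<longleftrightarrow> (\<forall>x y z. (x, y) \<in> E \<longrightarrow> \<not> orb x y \<longrightarrow> z \<in> V \<longrightarrow>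
     (\<exists>u. (z, u) \<in> E \<and> \<not> orb z u \<and> Q u - Q z \<ge> \<bar>Q y - Q x\<bar>) \<and>
     (\<exists>u. (z, u) \<in> E \<and> \<not> orb z u \<and> Q z - Q u \<ge> \<bar>Q y - Q x\<bar>))"

lemma equivariantD: "equivariant Q \<Longrightarrow> acts f e c \<Longrightarrow> e = 1 \<or> e = - 1 \<Longrightarrow> \<exists>c'. \<forall>v\<in>V. Q (f v) = e * Q v + c'"
  unfolding equivariant_def by blast

lemma normalised_height:
  assumes Q: "equivariant Q" "balanced Q" and g: "g > 0" "Q ` V = range ((*) g)"
  shows "\<exists>P. equivariant P \<and> balanced P \<and> P ` V = UNIV"
proof -
  define P where "P v = Q v div g" for v
  have QP: "Q v = g * P v" if "v \<in> V" for v
  proof -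
    have "Q v \<in> range ((*) g)" using that unfolding g(2)[symmetric] by blast
    then show ?thesis using g(1) by (auto simp: P_def)
  qed
  have "P ` V = (\<lambda>j. j div g) ` (Q ` V)" unfolding P_def by (simp add: image_image)
  also have "\<dots> = UNIV" unfolding g(2) using g(1) by (simp add: image_image)
  finally have "P ` V = UNIV" .
  moreover have "equivariant P"
    unfolding equivariant_def
  proof (intro conjI allI impI)
    fix f c and e :: int assume e: "e = 1 \<or> e = - 1" and f: "acts f e c"
    obtain c' where c': "\<And>v. v \<in> V \<Longrightarrow> Q (f v) = e * Q v + c'" using equivariantD[OF Q(1) f e] by blast
    have *: "g * (P (f v) - e * P v) = c'" if "v \<in> V" for v
      using c'[OF that] QP[OF that] QP[OF aut_in[OF acts_aut[OF f] that]] by (simp add: algebra_simps)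
    obtain w where w: "w \<in> V" using V_nonempty by blast
    have "P (f v) = e * P v + (P (f w) - e * P w)" if "v \<in> V" for v
    proof -
      have "g * (P (f v) - e * P v) = g * (P (f w) - e * P w)" using *[OF that] *[OF w] by simp
      then show ?thesis using g(1) by simp
    qed
    then show "\<exists>c'. \<forall>v\<in>V. P (f v) = e * P v + c'" by blast
  next
    fix j
    have "{v \<in> V. P v = j} \<subseteq> {v \<in> V. Q v = g * j}" using QP by auto
    then show "finite {v \<in> V. P v = j}" using Q(1) unfolding equivariant_def by (meson finite_subset)
  qed
  moreover have "balanced P"
    unfolding balanced_def
  proof (intro allI impI)
    fix x y z assume a: "(x, y) \<in> E" "\<not> orb x y" "z \<in> V"
    have V: "x \<in> V" "y \<in> V" using a edge_verts by auto
    have abs: "\<bar>Q y - Q x\<bar> = g * \<bar>P y - P x\<bar>"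
      using QP V g(1) by (simp add: right_diff_distrib[symmetric] abs_mult)
    obtain u w where u: "(z, u) \<in> E" "\<not> orb z u" "Q u - Q z \<ge> \<bar>Q y - Q x\<bar>"
      and w: "(z, w) \<in> E" "\<not> orb z w" "Q z - Q w \<ge> \<bar>Q y - Q x\<bar>"
      using Q(2) a unfolding balanced_def by meson
    have "g * (P u - P z) \<ge> g * \<bar>P y - P x\<bar>" "g * (P z - P w) \<ge> g * \<bar>P y - P x\<bar>"
      using u w QP a(3) edge_verts abs by (simp_all add: right_diff_distrib)
    then have "P u - P z \<ge> \<bar>P y - P x\<bar>" "P z - P w \<ge> \<bar>P y - P x\<bar>" using g(1) by simp_all
    then show "(\<exists>u. (z, u) \<in> E \<and> \<not> orb z u \<and> P u - P z \<ge> \<bar>P y - P x\<bar>) \<and>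
      (\<exists>u. (z, u) \<in> E \<and> \<not> orb z u \<and> P z - P u \<ge> \<bar>P y - P x\<bar>)" using u w by blast
  qed
  ultimately show ?thesis by blast
qed

lemma nbr_ex: assumes "x \<in> V" shows "\<exists>y. (x, y) \<in> E"
proof (rule ccontr)
  assume no: "\<not> ?thesis"
  have "y = x" if "y \<in> V" for y
    using connected_rtrancl[OF assms that] by induction (use no in auto)
  then have "V \<subseteq> {x}" by blast
  then show False using infinite_V finite_subset by blast
qed

text \<open>Transitivity makes the largest span \<open>T\<close> at \<open>v0\<close> the largest
  span anywhere. One edge attaining it decides whether \<open>D\<close> consists of edges inside
  orbits or across them.\<close>

lemma layered_ex:
  assumes P: "equivariant P" "balanced P" "P ` V = UNIV"
  shows "\<exists>t D. layered G P t D"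
proof -
  obtain v0 where v0: "v0 \<in> V" using V_nonempty by blast
  define S where "S = (\<lambda>y. \<bar>P y - P v0\<bar>) ` (E `` {v0})"
  have "finite S" "S \<noteq> {}" unfolding S_def using finite_nbrs nbr_ex[OF v0] by auto
  define T where "T = Max S"
  have span: "\<bar>P y - P x\<bar> \<le> T" if xy: "(x, y) \<in> E" for x y
  proof -
    have V: "x \<in> V" "y \<in> V" using xy edge_verts by auto
    obtain f where f: "aut f" "f x = v0" using transitive_aut V v0 by blast
    obtain e c where e: "e = 1 \<or> e = - 1" "acts f e c" using aut_acts[OF f(1)] by blast
    obtain c' where c': "\<And>v. v \<in> V \<Longrightarrow> P (f v) = e * P v + c'" using equivariantD[OF P(1) e(2,1)] by blast
    have "\<bar>P (f y) - P v0\<bar> = \<bar>P y - P x\<bar>" using c'[OF V(1)] c'[OF V(2)] f(2) e(1) by auto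
    moreover have "(v0, f y) \<in> E" using aut_edge[OF f(1) xy] f(2) by simp
    ultimately have "\<bar>P y - P x\<bar> \<in> S" unfolding S_def by (metis Image_singleton_iff image_eqI)
    then show ?thesis unfolding T_def using \<open>finite S\<close> by simp
  qed
  have "T \<in> S" unfolding T_def using \<open>finite S\<close> \<open>S \<noteq> {}\<close> by (rule Max_in)
  then obtain y0 where y0: "(v0, y0) \<in> E" "\<bar>P y0 - P v0\<bar> = T" unfolding S_def by blast
  have "T > 0"
  proof (rule ccontr)
    assume "\<not> T > 0"
    then have c: "P y = P x" if "(x, y) \<in> E" for x y using span[OF that] by simp
    have "P y = P v0" if "y \<in> V" for y
      using connected_rtrancl[OF v0 that] by induction (use c in auto)
    then have "V \<subseteq> {v \<in> V. P v = P v0}" by blast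
    then show False using infinite_V P(1) finite_subset unfolding equivariant_def by blast
  qed
  define t where "t = nat T"
  have t: "int t = T" using \<open>T > 0\<close> by (simp add: t_def)
  \<comment> \<open>Fixing the type is what lets two consecutive edges of \<open>D\<close> return to
    the same orbit: across twice, or never across.\<close>
  define D where "D = {(x, y). (x, y) \<in> E \<and> P y = P x + T \<and> (orb x y \<longleftrightarrow> orb v0 y0)}"
  have D_I: "(x, y) \<in> D" if "(x, y) \<in> E" "P y - P x \<ge> T" "orb x y \<longleftrightarrow> orb v0 y0" for x y
    using that span[OF that(1)] unfolding D_def by auto
  have D_V: "x \<in> V \<and> y \<in> V" if "(x, y) \<in> D" for x y using that edge_verts unfolding D_def by blast
  have ext: "(\<exists>y. (z, y) \<in> D) \<and> (\<exists>y. (y, z) \<in> D)" if z: "z \<in> V" for z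
  proof (cases "orb v0 y0")
    case False
    have "(\<exists>u. (z, u) \<in> E \<and> \<not> orb z u \<and> P u - P z \<ge> T) \<and> (\<exists>u. (z, u) \<in> E \<and> \<not> orb z u \<and> P z - P u \<ge> T)"
      using P(2)[unfolded balanced_def, rule_format, OF y0(1) False z] unfolding y0(2) .
    then obtain u w where u: "(z, u) \<in> E" "\<not> orb z u" "P u - P z \<ge> T"
      and w: "(z, w) \<in> E" "\<not> orb z w" "P z - P w \<ge> T" by blast
    have "\<not> orb w z" using orb_commute[OF z, of w] w edge_verts by blast
    then have "(z, u) \<in> D" "(w, z) \<in> D" using D_I[OF u(1,3)] D_I[OF edge_sym[OF w(1)] w(3)] u(2) False by blast+
    then show ?thesis by blast
  next
    case True
    obtain a b where ab: "(a, b) \<in> E" "orb a b" "P b = P a + T"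
    proof (cases "P y0 \<ge> P v0")
      case True
      then show ?thesis using that[of v0 y0] y0 \<open>orb v0 y0\<close> by simp
    next
      case False
      then show ?thesis using that[of y0 v0] y0 \<open>orb v0 y0\<close> edge_sym orb_sym[OF v0] by simp
    qed
    have V: "a \<in> V" "b \<in> V" using ab edge_verts by auto
    obtain h c where h: "acts h 1 c" "h a = b" using ab orb_def by blast
    obtain g c' where g: "acts g 1 c'" "\<And>x. x \<in> V \<Longrightarrow> g (h x) = x" "\<And>x. x \<in> V \<Longrightarrow> h (g x) = x"
      using acts_inverse[OF h(1)] by blast
    \<comment> \<open>The translation \<open>h\<close> takes \<open>a\<close> to \<open>b\<close>,
      so its inverse continues the edge backwards by an equal step. Moving \<open>a\<close> to
      \<open>z\<close> then gives an edge of span \<open>T\<close> on either side, whichever way the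
      heights are oriented.\<close>
    define a' where "a' = g a"
    have a'V: "a' \<in> V" using aut_in acts_aut g(1) V by (simp add: a'_def)
    have a': "(a', a) \<in> E" "orb a' a"
      using aut_edge[OF acts_aut[OF g(1)] ab(1)] g(2)[OF V(1)] h(2) orbI[OF h(1), of a' a] g(3)[OF V(1)]
      by (auto simp: a'_def)
    obtain d where d: "\<And>v. v \<in> V \<Longrightarrow> P (h v) = P v + d" using equivariantD[OF P(1) h(1)] by auto
    have "P a = P a' + T" using d[OF V(1)] d[OF a'V] h(2) ab(3) g(3)[OF V(1)] by (simp add: a'_def)
    note a' = a' this
    obtain f where f: "aut f" "f a = z" using transitive_aut V z by blast
    obtain e cc where e: "e = 1 \<or> e = - 1" "acts f e cc" using aut_acts[OF f(1)] by blast
    obtain c'' where c'': "\<And>v. v \<in> V \<Longrightarrow> P (f v) = e * P v + c''" using equivariantD[OF P(1) e(2,1)] by blast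
    have E: "(z, f b) \<in> E" "(f a', z) \<in> E" "(f b, z) \<in> E" "(z, f a') \<in> E"
      using aut_edge[OF f(1) ab(1)] aut_edge[OF f(1) a'(1)] f(2) edge_sym by auto
    have fV: "f b \<in> V" "f a' \<in> V" using aut_in[OF f(1)] V a'V by auto
    have o: "orb z (f b)" "orb (f a') z" "orb (f b) z" "orb z (f a')"
      using aut_orb_imp[OF f(1) V(1) ab(2)] aut_orb_imp[OF f(1) a'V a'(2)] f(2) orb_sym z fV by auto
    from e(1) show ?thesis
    proof
      assume "e = 1"
      then have "P (f b) - P z \<ge> T" "P z - P (f a') \<ge> T"
        using c''[OF V(1)] c''[OF V(2)] c''[OF a'V] f(2) ab(3) a'(3) by simp_all
      then show ?thesis using D_I[OF E(1)] D_I[OF E(2)] o True by blast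
    next
      assume "e = - 1"
      then have "P (f a') - P z \<ge> T" "P z - P (f b) \<ge> T"
        using c''[OF V(1)] c''[OF V(2)] c''[OF a'V] f(2) ab(3) a'(3) by simp_all
      then show ?thesis using D_I[OF E(4)] D_I[OF E(3)] o True by blast
    qed
  qed
  have up_D: "(f x, f y) \<in> D" if f: "acts f 1 c" and xy: "(x, y) \<in> D" for f c x y
  proof -
    obtain c' where c': "\<And>v. v \<in> V \<Longrightarrow> P (f v) = P v + c'" using equivariantD[OF P(1) f] by auto
    show ?thesis using xy D_V[OF xy] c' aut_edge[OF acts_aut[OF f]] aut_orb[OF acts_aut[OF f]]
      unfolding D_def by auto
  qed
  have down_D: "(f y, f x) \<in> D" if f: "acts f (- 1) c" and xy: "(x, y) \<in> D" for f c x y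
  proof -
    note V = D_V[OF xy]
    obtain c' where c': "\<And>v. v \<in> V \<Longrightarrow> P (f v) = - P v + c'" using equivariantD[OF P(1) f] by auto
    have "orb (f y) (f x) \<longleftrightarrow> orb v0 y0"
      using xy aut_orb[OF acts_aut[OF f], of y x] orb_commute[of y x] V unfolding D_def by blast
    then show ?thesis using xy V c' aut_edge[OF acts_aut[OF f]] edge_sym
      unfolding D_def by auto
  qed
  have finD: "finite (D `` {x})" "finite (D\<inverse> `` {x})" for x
  proof -
    have "D `` {x} \<subseteq> E `` {x}" "D\<inverse> `` {x} \<subseteq> E `` {x}" using edge_sym unfolding D_def by auto
    then show "finite (D `` {x})" "finite (D\<inverse> `` {x})" using finite_nbrs finite_subset by blast+
  qed
  have two: "orb x z" if "(x, y) \<in> D" "(y, z) \<in> D" for x y z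
    using that D_V[OF that(1)] D_V[OF that(2)] orb_trans[of x y z] two_orbits[of x y z] unfolding D_def by blast
  have deg_le: "card (D `` {x}) \<le> card (D `` {x'})" "card (D\<inverse> `` {x}) \<le> card (D\<inverse> `` {x'})"
    if x: "x \<in> V" "orb x x'" for x x'
  proof -
    obtain f c where f: "acts f 1 c" "f x = x'" using x orb_def by blast
    have "D `` {x} \<subseteq> V" "D\<inverse> `` {x} \<subseteq> V" using D_V by auto
    then have inj: "inj_on f (D `` {x})" "inj_on f (D\<inverse> `` {x})"
      using aut_inj[OF acts_aut[OF f(1)]] inj_on_subset by blast+
    have "f ` (D `` {x}) \<subseteq> D `` {x'}" "f ` (D\<inverse> `` {x}) \<subseteq> D\<inverse> `` {x'}" using up_D[OF f(1)] f(2) by auto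
    then show "card (D `` {x}) \<le> card (D `` {x'})" "card (D\<inverse> `` {x}) \<le> card (D\<inverse> `` {x'})"
      using card_inj_on_le[OF inj(1) _ finD(1)] card_inj_on_le[OF inj(2) _ finD(2)] by simp_all
  qed
  have deg: "card (D `` {x}) = card (D\<inverse> `` {y})" if xy: "(x, y) \<in> D" for x y
  proof -
    have V: "x \<in> V" "y \<in> V" using D_V[OF xy] by auto
    \<comment> \<open>One orbit at one height; all these sets are equally large. Edges of
      \<open>D\<close> leaving \<open>L x\<close> end in \<open>L y\<close> and those entering
      \<open>L y\<close> start in \<open>L x\<close>, so counting them from both ends compares the
      degrees.\<close>
    define L where "L u = {v \<in> V. orb u v \<and> P v = P u}" for u
    have finL: "finite (L u)" for u
    proof (rule finite_subset)
      show "L u \<subseteq> {v \<in> V. P v = P u}" unfolding L_def by blast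
    qed (use P(1) in \<open>simp add: equivariant_def\<close>)
    have L_le: "card (L u) \<le> card (L v)" if uv: "u \<in> V" "v \<in> V" for u v
    proof -
      obtain f where f: "aut f" "f u = v" using transitive_aut uv by blast
      obtain e cc where e: "e = 1 \<or> e = - 1" "acts f e cc" using aut_acts[OF f(1)] by blast
      obtain c' where c': "\<And>v. v \<in> V \<Longrightarrow> P (f v) = e * P v + c'" using equivariantD[OF P(1) e(2,1)] by blast
      have "f ` L u \<subseteq> L v"
      proof
        fix w assume "w \<in> f ` L u"
        then obtain w' where w': "w' \<in> V" "orb u w'" "P w' = P u" "w = f w'" unfolding L_def by blast
        have "P w = P v" using c'[OF w'(1)] c'[OF uv(1)] w'(3,4) f(2) by simp
        then show "w \<in> L v" using w' aut_in[OF f(1)] aut_orb_imp[OF f(1) uv(1) w'(2)] f(2) by (simp add: L_def)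
      qed
      moreover have "inj_on f (L u)" using aut_inj[OF f(1)] by (rule inj_on_subset) (auto simp: L_def)
      ultimately show ?thesis using card_inj_on_le finL by blast
    qed
    have sub1: "D `` {x'} \<subseteq> L y" if x': "x' \<in> L x" for x'
    proof
      fix y' assume "y' \<in> D `` {x'}"
      then have y': "(x', y') \<in> D" by simp
      note V' = D_V[OF y']
      have "orb x x'" using x' L_def by blast
      then have "orb x y' \<longleftrightarrow> orb v0 y0"
        using y' orb_trans orb_sym[OF V(1)] unfolding D_def by blast
      moreover have "orb x y \<longleftrightarrow> orb v0 y0" using xy D_def by blast
      ultimately have "orb y y'"
        using orb_trans orb_sym[OF V(1)] orb_commute[OF V] two_orbits[of y x y'] V V' by blast
      moreover have "P y' = P y" using y' xy x' unfolding D_def L_def by auto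
      ultimately show "y' \<in> L y" using V' by (simp add: L_def)
    qed
    have sub2: "D\<inverse> `` {y'} \<subseteq> L x" if y': "y' \<in> L y" for y'
    proof
      fix x' assume "x' \<in> D\<inverse> `` {y'}"
      then have x': "(x', y') \<in> D" by simp
      note V' = D_V[OF x']
      have "orb y y'" using y' L_def by blast
      then have "orb x' y \<longleftrightarrow> orb v0 y0"
        using x' orb_trans orb_sym[OF V(2)] unfolding D_def by blast
      moreover have "orb x y \<longleftrightarrow> orb v0 y0" using xy D_def by blast
      ultimately have "orb x x'"
        using orb_trans orb_commute[of x' y] two_orbits[of x y x'] V V' by blast
      moreover have "P x' = P x" using x' xy y' unfolding D_def L_def by auto
      ultimately show "x' \<in> L x" using V' by (simp add: L_def)
    qed
    have out: "card {j \<in> L y. (i, j) \<in> D} = card (D `` {x})" if i: "i \<in> L x" for i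
    proof -
      have "{j \<in> L y. (i, j) \<in> D} = D `` {i}" using sub1[OF i] by auto
      moreover have "i \<in> V" "orb x i" "orb i x" using i V(1) orb_sym unfolding L_def by blast+
      ultimately show ?thesis using deg_le(1)[of i x] deg_le(1)[of x i] V(1) by simp
    qed
    have inn: "card {i \<in> L x. (i, j) \<in> D} = card (D\<inverse> `` {y})" if j: "j \<in> L y" for j
    proof -
      have "{i \<in> L x. (i, j) \<in> D} = D\<inverse> `` {j}" using sub2[OF j] by auto
      moreover have "j \<in> V" "orb y j" "orb j y" using j V(2) orb_sym unfolding L_def by blast+
      ultimately show ?thesis using deg_le(2)[of j y] deg_le(2)[of y j] V(2) by simp
    qed
    have "(\<Sum>i\<in>L x. card {j \<in> L y. (i, j) \<in> D}) = (\<Sum>j\<in>L y. card (D\<inverse> `` {y}))"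
      by (rule sum_multicount_gen[OF finL finL]) (use inn in blast)
    then have "card (L x) * card (D `` {x}) = card (L y) * card (D\<inverse> `` {y})" using out by simp
    moreover have "card (L x) = card (L y)" using L_le V by (simp add: order_antisym)
    moreover have "x \<in> L x" using V orb_refl by (simp add: L_def)
    then have "card (L x) > 0" using finL by (metis card_gt_0_iff empty_iff)
    ultimately show ?thesis by simp
  qed
  have "layered G P t D"
  proof unfold_locales
    show "P ` V = UNIV" by (rule P(3))
    show "finite {v \<in> V. P v = j}" for j using P(1) by (simp add: equivariant_def)
    show "(\<exists>c. \<forall>v\<in>V. P (f v) = P v + c) \<and> (\<forall>x y. (x, y) \<in> D \<longrightarrow> (f x, f y) \<in> D) \<or>
      (\<exists>c. \<forall>v\<in>V. P (f v) = c - P v) \<and> (\<forall>x y. (x, y) \<in> D \<longrightarrow> (f y, f x) \<in> D)" if f: "aut f" for f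
    proof -
      obtain e c where e: "e = 1 \<or> e = - 1" "acts f e c" using aut_acts[OF f(1)] by blast
      obtain c' where c': "\<And>v. v \<in> V \<Longrightarrow> P (f v) = e * P v + c'" using equivariantD[OF P(1) e(2,1)] by blast
      from e(1) show ?thesis
      proof
        assume "e = 1"
        then have "\<forall>v\<in>V. P (f v) = P v + c'" "\<forall>x y. (x, y) \<in> D \<longrightarrow> (f x, f y) \<in> D"
          using c' up_D e(2) by auto
        then show ?thesis by blast
      next
        assume "e = - 1"
        then have "\<forall>v\<in>V. P (f v) = c' - P v" "\<forall>x y. (x, y) \<in> D \<longrightarrow> (f y, f x) \<in> D"
          using c' down_D e(2) by auto
        then show ?thesis by blast
      qed
    qed
    show "\<bar>P y - P x\<bar> \<le> int t" if "(x, y) \<in> E" for x y using span[OF that] t by simp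
    show "D \<subseteq> E" unfolding D_def by blast
    show "P y = P x + int t" if "(x, y) \<in> D" for x y using that t unfolding D_def by simp
    show "\<exists>y. (z, y) \<in> D" if "z \<in> V" for z using ext[OF that] by blast
    show "\<exists>y. (y, z) \<in> D" if "z \<in> V" for z using ext[OF that] by blast
    show "card (D `` {x}) = card (D\<inverse> `` {y})" if "(x, y) \<in> D" for x y by (rule deg[OF that])
    show "\<exists>f c. aut f \<and> (\<forall>v\<in>V. P (f v) = P v + c) \<and> f x = z" if "(x, y) \<in> D" "(y, z) \<in> D" for x y z
    proof -
      have "orb x z" by (rule two[OF that])
      then obtain f c where f: "acts f 1 c" "f x = z" using orb_def by blast
      then show ?thesis using equivariantD[OF P(1) f(1)] acts_aut by auto
    qed
    show "t > 0" using \<open>T > 0\<close> t by simp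
  qed
  then show ?thesis by blast
qed

section \<open>Balanced heights for one and for two orbits\<close>

lemma orbit_heights:
  assumes v: "v \<in> V" and inf: "infinite {u. orb v u}"
  shows "\<exists>p>0. (\<lambda>u. pos u - pos v) ` {u. orb v u} = range ((*) p)"
proof -
  let ?S = "(\<lambda>u. pos u - pos v) ` {u. orb v u}"
  have diff: "a - b \<in> ?S" if a: "a \<in> ?S" and b: "b \<in> ?S" for a b
  proof -
    obtain u w where u: "orb v u" "a = pos u - pos v" and w: "orb v w" "b = pos w - pos v" using a b by blast
    have V: "u \<in> V" "w \<in> V" using u w orb_V v by blast+
    obtain f c where f: "acts f 1 c" "f w = v" using orb_sym[OF v w(1)] orb_def by blast
    have "pos (f u) - pos v = a - b"
      using acts_pos[OF f(1) V(1)] acts_pos[OF f(1) V(2)] f(2) u(2) w(2) by simp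
    moreover have "orb v (f u)" using orb_trans[OF u(1) orbI[OF f(1) refl]] .
    ultimately show ?thesis by (metis image_eqI mem_Collect_eq)
  qed
  \<comment> \<open>An infinite orbit cannot stay at one height, because levels are finite.\<close>
  obtain x where "x \<in> ?S" "x \<noteq> 0"
  proof (rule ccontr)
    assume "\<not> thesis"
    then have "{u. orb v u} \<subseteq> {u \<in> V. pos u = pos v}" using that orb_V[OF v] by force
    then show False using inf finite_pos finite_subset by blast
  qed
  then show ?thesis using int_subgroup[OF diff] by blast
qed

lemma one_orbit_height:
  assumes "\<forall>x\<in>V. \<forall>y\<in>V. orb x y"
  shows "\<exists>Q g. equivariant Q \<and> balanced Q \<and> g > 0 \<and> Q ` V = range ((*) g)"
proof -
  obtain v where v: "v \<in> V" using V_nonempty by blast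
  have O: "{u. orb v u} = V" using assms v orb_V by blast
  then obtain p where p: "p > 0" "(\<lambda>u. pos u - pos v) ` V = range ((*) p)"
    using orbit_heights[OF v] infinite_V by auto
  let ?Q = "\<lambda>u. pos u - pos v"
  have "\<exists>c'. \<forall>u\<in>V. ?Q (f u) = e * ?Q u + c'" if "acts f e c" for f e c
    by (rule exI[of _ "e * pos v + c - pos v"]) (use acts_pos[OF that] in \<open>auto simp: algebra_simps\<close>)
  moreover have "finite {u \<in> V. ?Q u = j}" for j
    using finite_pos[of "j + pos v"] by (simp add: diff_eq_eq)
  ultimately have "equivariant ?Q" unfolding equivariant_def by blast
  moreover have "balanced ?Q" unfolding balanced_def using assms edge_verts by blast
  ultimately show ?thesis using p by blast
qed

lemma two_orbit_height:
  assumes v0: "v0 \<in> V" and w0: "w0 \<in> V" and no: "\<not> orb v0 w0"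
  shows "\<exists>Q g. equivariant Q \<and> balanced Q \<and> g > 0 \<and> Q ` V = range ((*) g)"
proof -
  have same2: "orb x y" if "x \<in> V" "y \<in> V" "\<not> orb v0 x" "\<not> orb v0 y" for x y
    using two_orbits[of x v0 y] that v0 orb_sym by blast
  have same1: "orb x y" if "orb v0 x" "orb v0 y" for x y
    using orb_trans orb_sym[OF v0] that by blast
  have iff_orb: "orb v0 x \<longleftrightarrow> orb v0 y" if "x \<in> V" "orb x y" for x y
    using orb_trans orb_sym that by blast
  \<comment> \<open>A single automorphism maps the orbit of \<open>v0\<close> onto a set containing
    the rest of \<open>V\<close>, so a finite orbit would make \<open>V\<close> finite.\<close>
  have inf: "infinite {u. orb v0 u}"
  proof
    assume fin: "finite {u. orb v0 u}"
    obtain f where f: "aut f" "f v0 = w0" using transitive_aut v0 w0 by blast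
    obtain g where g: "aut g" "\<And>x. x \<in> V \<Longrightarrow> g (f x) = x" "\<And>x. x \<in> V \<Longrightarrow> f (g x) = x"
      using aut_inverse f by blast
    have "V \<subseteq> {u. orb v0 u} \<union> f ` {u. orb v0 u}"
    proof
      fix z assume z: "z \<in> V"
      show "z \<in> {u. orb v0 u} \<union> f ` {u. orb v0 u}"
      proof (cases "orb v0 z")
        case False
        then have "orb (g w0) (g z)" using aut_orb_imp[OF g(1) w0 same2[OF w0 z no]] by blast
        then have "orb v0 (g z)" using g(2)[OF v0] f(2) by simp
        then show ?thesis using g(3)[OF z] by (metis UnI2 imageI mem_Collect_eq)
      qed simp
    qed
    then show False using fin infinite_V finite_subset by blast
  qed
  obtain p where p: "p > 0" "(\<lambda>u. pos u - pos v0) ` {u. orb v0 u} = range ((*) p)"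
    using orbit_heights[OF v0 inf] by blast
  have dvd: "p dvd pos y - pos x" if "x \<in> V" "orb x y" for x y
  proof -
    from \<open>orb x y\<close> obtain f c where f: "acts f 1 c" "f x = y" unfolding orb_def by blast
    have "orb v0 (f v0)" using orbI[OF f(1) refl] .
    then have "pos (f v0) - pos v0 \<in> range ((*) p)" unfolding p(2)[symmetric] by blast
    then show ?thesis using acts_pos[OF f(1) v0] acts_pos[OF f(1) that(1)] f(2) by auto
  qed
  have shift: "\<exists>y. orb x y \<and> pos y = pos x + p * j" if "x \<in> V" for x j
  proof -
    have "p * j \<in> (\<lambda>u. pos u - pos v0) ` {u. orb v0 u}" unfolding p(2) by blast
    then obtain u where u: "orb v0 u" "pos u - pos v0 = p * j" by auto
    obtain f c where f: "acts f 1 c" "f v0 = u" using u orb_def by blast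
    then have "pos (f x) = pos x + p * j" using acts_pos[OF f(1) v0] acts_pos[OF f(1) that] u by simp
    then show ?thesis using orbI[OF f(1) refl] by blast
  qed
  \<comment> \<open>Otherwise a translation turns \<open>f\<close> into a reflection fixing
    \<open>x\<close>. Composing any other reflection with it gives a translation with the same value
    at \<open>x\<close>, and there would be only one orbit.\<close>
  have no_fix: "\<not> orb x (f x)" if x: "x \<in> V" and f: "acts f (- 1) c" for x f c
  proof
    assume "orb x (f x)"
    then obtain g c' where g: "acts g 1 c'" "g (f x) = x" using orb_sym[OF x] orb_def by blast
    have r: "acts (g \<circ> f) (- 1) (c + c')" using acts_comp[OF f g(1)] by simp
    have all: "orb x y" if "y \<in> V" for y
    proof (rule ccontr)
      assume "\<not> orb x y"
      then obtain h d where h: "acts h (- 1) d" "h x = y" using not_orb x \<open>y \<in> V\<close> by blast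
      have "acts (h \<circ> (g \<circ> f)) 1 (- (c + c') + d)" using acts_comp[OF r h(1)] by simp
      then have "orb x y" by (rule orbI) (use g h in simp)
      then show False using \<open>\<not> orb x y\<close> by simp
    qed
    then show False using no all[OF v0] all[OF w0] orb_sym[OF x] orb_trans by blast
  qed
  \<comment> \<open>Edges are read from the orbit of \<open>v0\<close> to the other orbit.
    Translations move each of them to start at \<open>v0\<close>, so only finitely many values
    occur.\<close>
  define S where "S = {pos y - pos x | x y. (x, y) \<in> E \<and> orb v0 x \<and> \<not> orb v0 y}"
  have "S \<subseteq> (\<lambda>y. pos y - pos v0) ` (E `` {v0})"
  proof
    fix d assume "d \<in> S"
    then obtain x y where xy: "d = pos y - pos x" "(x, y) \<in> E" "orb v0 x" unfolding S_def by blast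
    have V: "x \<in> V" "y \<in> V" using xy edge_verts by auto
    obtain f c where f: "acts f 1 c" "f x = v0" using orb_sym[OF v0 xy(3)] orb_def by blast
    have "(v0, f y) \<in> E" using aut_edge[OF acts_aut[OF f(1)] xy(2)] f(2) by simp
    moreover have "pos (f y) - pos v0 = d" using acts_pos[OF f(1) V(1)] acts_pos[OF f(1) V(2)] f(2) xy(1) by simp
    ultimately show "d \<in> (\<lambda>y. pos y - pos v0) ` (E `` {v0})" by (metis Image_singleton_iff image_eqI)
  qed
  then have finS: "finite S" using finite_nbrs finite_subset by blast
  have "S \<noteq> {}"
  proof
    assume "S = {}"
    then have c: "orb v0 y" if "(x, y) \<in> E" "orb v0 x" for x y using that unfolding S_def by blast
    have "orb v0 w0" using connected_rtrancl[OF v0 w0] by induction (use c orb_refl in auto)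
    then show False using no by simp
  qed
  define M where "M = Max S"
  define m where "m = Min S"
  have "M \<in> S" "m \<in> S" unfolding M_def m_def using finS \<open>S \<noteq> {}\<close> by simp_all
  then obtain x1 y1 x2 y2 where
    1: "(x1, y1) \<in> E" "orb v0 x1" "\<not> orb v0 y1" "M = pos y1 - pos x1" and
    2: "(x2, y2) \<in> E" "orb v0 x2" "\<not> orb v0 y2" "m = pos y2 - pos x2"
    unfolding S_def by blast
  have V: "x1 \<in> V" "y1 \<in> V" "x2 \<in> V" "y2 \<in> V" using 1 2 edge_verts by auto
  have bounds: "m \<le> pos y - pos x" "pos y - pos x \<le> M" if "(x, y) \<in> E" "orb v0 x" "\<not> orb v0 y" for x y
  proof -
    have "pos y - pos x \<in> S" unfolding S_def using that by blast
    then show "m \<le> pos y - pos x" "pos y - pos x \<le> M" unfolding M_def m_def using finS by simp_all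
  qed
  \<comment> \<open>Doubling avoids halves. The second orbit is lowered by the midpoint of
    \<open>m\<close> and \<open>M\<close>, after which the differences across the orbits lie between
    \<open>-(M - m)\<close> and \<open>M - m\<close>, both attained.\<close>
  define Q where "Q v = 2 * (pos v - pos v0) + (if orb v0 v then 0 else - (m + M))" for v
  have up: "Q (f v) = Q v + 2 * c" if "acts f 1 c" "v \<in> V" for f c v
    using acts_pos[OF that] iff_orb[OF that(2) orbI[OF that(1) refl]] by (simp add: Q_def)
  have down: "Q (f v) = - Q v + (2 * c - 4 * pos v0 - (m + M))" if f: "acts f (- 1) c" and v: "v \<in> V" for f c v
  proof -
    have "\<not> orb v (f v)" using no_fix v f by blast
    then have "orb v0 (f v) \<longleftrightarrow> \<not> orb v0 v"
      using same1[of v "f v"] same2[OF v aut_in[OF acts_aut[OF f] v]] by blast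
    then show ?thesis using acts_pos[OF f v] by (simp add: Q_def)
  qed
  have "equivariant Q"
    unfolding equivariant_def
  proof (intro conjI allI impI)
    fix f c and e :: int assume "e = 1 \<or> e = - 1" "acts f e c"
    then show "\<exists>c'. \<forall>v\<in>V. Q (f v) = e * Q v + c'"
    proof (elim disjE)
      assume "acts f e c" "e = 1"
      then show ?thesis using up[of f c] by (intro exI[of _ "2 * c"]) simp
    next
      assume "acts f e c" "e = - 1"
      then show ?thesis using down[of f c] by (intro exI[of _ "2 * c - 4 * pos v0 - (m + M)"]) simp
    qed
  next
    fix j
    have "{v \<in> V. Q v = j} \<subseteq> {v \<in> V. pos v = pos v0 + j div 2} \<union> {v \<in> V. pos v = pos v0 + (j + (m + M)) div 2}"
      unfolding Q_def by auto
    then show "finite {v \<in> V. Q v = j}" using finite_pos by (meson finite_UnI finite_subset)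
  qed
  moreover have "balanced Q"
    unfolding balanced_def
  proof (intro allI impI)
    fix x y z assume xy: "(x, y) \<in> E" "\<not> orb x y" and z: "z \<in> V"
    have xyV: "x \<in> V" "y \<in> V" using xy edge_verts by auto
    have diff: "\<bar>Q y - Q x\<bar> \<le> M - m" if "(x, y) \<in> E" "orb v0 x" "\<not> orb v0 y" for x y
      using bounds[OF that] that by (simp add: Q_def)
    have le: "\<bar>Q y - Q x\<bar> \<le> M - m"
    proof (cases "orb v0 x")
      case True
      then show ?thesis using diff[OF xy(1)] same1 xy(2) by blast
    next
      case False
      then have "orb v0 y" using same2 xyV xy(2) by blast
      then show ?thesis using diff[OF edge_sym[OF xy(1)]] False by (simp add: abs_minus_commute)
    qed
    have d1: "Q y1 - Q x1 = M - m" and d2: "Q x2 - Q y2 = M - m" using 1 2 by (simp_all add: Q_def)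
    have n1: "\<not> orb x1 y1" "\<not> orb y1 x1" and n2: "\<not> orb x2 y2" "\<not> orb y2 x2"
      using 1 2 iff_orb V by blast+
    have move: "\<exists>u. (z, u) \<in> E \<and> \<not> orb z u \<and> Q u - Q z = Q b - Q a" if ab: "(a, b) \<in> E" "\<not> orb a b" "orb a z" for a b
    proof -
      obtain f c where f: "acts f 1 c" "f a = z" using ab orb_def by blast
      have abV: "a \<in> V" "b \<in> V" using ab edge_verts by auto
      have "(z, f b) \<in> E" using aut_edge[OF acts_aut[OF f(1)] ab(1)] f(2) by simp
      moreover have "\<not> orb z (f b)" using aut_orb[OF acts_aut[OF f(1)] abV] f(2) ab(2) by simp
      moreover have "Q (f b) - Q z = Q b - Q a" using up[OF f(1) abV(1)] up[OF f(1) abV(2)] f(2) by simp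
      ultimately show ?thesis by blast
    qed
    \<comment> \<open>A vertex in the orbit of \<open>v0\<close> inherits the edge at
      \<open>x1\<close> as an upward one and the edge at \<open>x2\<close> as a downward one; a
      vertex of the other orbit inherits both reversed, with up and down exchanged.\<close>
    have "\<exists>u w. ((z, u) \<in> E \<and> \<not> orb z u \<and> Q u - Q z = M - m) \<and> ((z, w) \<in> E \<and> \<not> orb z w \<and> Q z - Q w = M - m)"
    proof (cases "orb v0 z")
      case True
      then show ?thesis
        using move[OF 1(1) n1(1) same1[OF 1(2) True]] move[OF 2(1) n2(1) same1[OF 2(2) True]] d1 d2
        by (metis minus_diff_eq)
    next
      case False
      then show ?thesis
        using move[OF edge_sym[OF 1(1)] n1(2) same2[OF V(2) z 1(3) False]]
          move[OF edge_sym[OF 2(1)] n2(2) same2[OF V(4) z 2(3) False]] d1 d2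
        by (metis minus_diff_eq)
    qed
    then show "(\<exists>u. (z, u) \<in> E \<and> \<not> orb z u \<and> Q u - Q z \<ge> \<bar>Q y - Q x\<bar>) \<and>
      (\<exists>u. (z, u) \<in> E \<and> \<not> orb z u \<and> Q z - Q u \<ge> \<bar>Q y - Q x\<bar>)" using le by metis
  qed
  moreover have "\<exists>g>0. Q ` V = range ((*) g)"
  proof -
    \<comment> \<open>\<open>M - m\<close> is a combination of height differences inside the two
      orbits, which are multiples of \<open>p\<close>.\<close>
    have "p dvd pos y1 - pos y2" "p dvd pos x1 - pos x2"
      using dvd[OF V(4) same2[OF V(4,2) 2(3) 1(3)]] dvd[OF V(3) same1[OF 2(2) 1(2)]] by auto
    then have "p dvd (pos y1 - pos y2) - (pos x1 - pos x2)" by (rule dvd_diff)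
    moreover have "(pos y1 - pos y2) - (pos x1 - pos x2) = M - m" using 1(4) 2(4) by simp
    ultimately obtain d where d: "M - m = p * d" by (metis dvdE)
    have Q1: "\<exists>j. Q v = p * (2 * j)" if "orb v0 v" for v
    proof -
      have "p dvd pos v - pos v0" by (rule dvd[OF v0 that])
      then obtain j where "pos v - pos v0 = p * j" by (rule dvdE)
      then show ?thesis using that by (auto simp: Q_def)
    qed
    have Q1': "\<exists>v\<in>V. Q v = p * (2 * j)" for j
    proof -
      obtain v where "orb v0 v" "pos v = pos v0 + p * j" using shift[OF v0] by blast
      then show ?thesis using orb_V[OF v0] by (intro bexI[of _ v]) (auto simp: Q_def)
    qed
    obtain b where b: "pos x1 - pos v0 = p * b" using dvd[OF v0 1(2)] by (metis dvdE)
    have Qy1: "Q v = p * (d + 2 * (a + b))" if "\<not> orb v0 v" "pos v = pos y1 + p * a" for v a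
    proof -
      have "Q v = 2 * (M + p * b + p * a) - (m + M)" using that 1(4) b by (simp add: Q_def)
      also have "\<dots> = p * d + 2 * (p * b + p * a)" using d by simp
      finally show ?thesis by (simp add: algebra_simps)
    qed
    have Q2: "\<exists>j. Q v = p * (d + 2 * j)" if "v \<in> V" "\<not> orb v0 v" for v
    proof -
      have "p dvd pos v - pos y1" by (rule dvd[OF V(2) same2[OF V(2) that(1) 1(3) that(2)]])
      then obtain a where "pos v - pos y1 = p * a" by (rule dvdE)
      then have "Q v = p * (d + 2 * (a + b))" by (intro Qy1[OF that(2)]) simp
      then show ?thesis by blast
    qed
    have Q2': "\<exists>v\<in>V. Q v = p * (d + 2 * j)" for j
    proof -
      obtain v where v: "orb y1 v" "pos v = pos y1 + p * (j - b)" using shift[OF V(2)] by blast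
      then have "v \<in> V" "\<not> orb v0 v" using orb_V[OF V(2)] iff_orb[OF V(2)] 1(3) by blast+
      then show ?thesis using Qy1[of v "j - b"] v by (intro bexI[of _ v]) auto
    qed
    \<comment> \<open>The orbit of \<open>v0\<close> takes as values all even multiples of
      \<open>p\<close>, the other orbit all multiples of \<open>p\<close> whose factor has the
      parity of \<open>d\<close>. So the common step is \<open>2 * p\<close> or
      \<open>p\<close>.\<close>
    show ?thesis
    proof (cases "even d")
      case True
      then obtain l where l: "d = 2 * l" by (metis evenE)
      have "Q ` V = range ((*) (2 * p))"
      proof
        show "Q ` V \<subseteq> range ((*) (2 * p))"
        proof
          fix q assume "q \<in> Q ` V"
          then obtain v where v: "v \<in> V" "q = Q v" by blast
          have "\<exists>j. Q v = p * (2 * j)" using Q1[of v] Q2[OF v(1)] l by (metis distrib_left)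
          then show "q \<in> range ((*) (2 * p))" using v by (auto simp: algebra_simps)
        qed
        show "range ((*) (2 * p)) \<subseteq> Q ` V"
        proof
          fix q assume "q \<in> range ((*) (2 * p))"
          then obtain j where "q = p * (2 * j)" by (auto simp: algebra_simps)
          then show "q \<in> Q ` V" using Q1'[of j] by (metis imageI)
        qed
      qed
      then show ?thesis using p(1) by (intro exI[of _ "2 * p"]) simp
    next
      case False
      then obtain l where l: "d = 2 * l + 1" by (metis oddE)
      have "Q ` V = range ((*) p)"
      proof
        show "Q ` V \<subseteq> range ((*) p)" using Q1 Q2 by blast
        show "range ((*) p) \<subseteq> Q ` V"
        proof
          fix q assume "q \<in> range ((*) p)"
          then obtain j where j: "q = p * j" by blast
          show "q \<in> Q ` V"
          proof (cases "even j")
            case True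
            then obtain i where "j = 2 * i" by (metis evenE)
            then show ?thesis using Q1'[of i] j by (metis imageI)
          next
            case False
            then obtain i where "j = 2 * i + 1" by (metis oddE)
            then have "j = d + 2 * (i - l)" using l by simp
            then show ?thesis using Q2'[of "i - l"] j by (metis imageI)
          qed
        qed
      qed
      then show ?thesis using p(1) by blast
    qed
  qed
  ultimately show ?thesis by blast
qed

lemma layered_ex_heighted: "\<exists>P t D. layered G P t D"
proof -
  have "\<exists>Q g. equivariant Q \<and> balanced Q \<and> g > 0 \<and> Q ` V = range ((*) g)"
  proof (cases "\<forall>x\<in>V. \<forall>y\<in>V. orb x y")
    case True
    then show ?thesis by (rule one_orbit_height)
  next
    case False
    then obtain x y where "x \<in> V" "y \<in> V" "\<not> orb x y" by blast
    then show ?thesis by (rule two_orbit_height)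
  qed
  then obtain Q g where "equivariant Q" "balanced Q" "g > 0" "Q ` V = range ((*) g)" by blast
  then obtain P where "equivariant P" "balanced P" "P ` V = UNIV" using normalised_height by meson
  then show ?thesis using layered_ex by blast
qed

end

theorem theorem3p1:
  fixes G :: "'a graph"
  assumes "simple_graph G"
    and "locally_finite_graph G"
    and "connected_graph G"
    and "vertex_transitive G"
    and "card (ends G) = 2"
  shows "\<exists>s t :: nat. \<exists>\<sigma> R. s > 0 \<and> t > 0 \<and> cyclic_system G \<sigma> R \<and>
           ring_like s t G \<sigma> R \<and> cohesive (2 * s * t) G \<sigma> R \<and>
           kappa_inf G = enat (s * t)"
proof -
  interpret two_ended G by unfold_locales (use assms in auto)
  obtain pos :: "'a \<Rightarrow> int" where pos: "\<forall>f. aut f \<longrightarrow>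
      (\<exists>c. \<forall>v\<in>V. pos (f v) = pos v + c) \<or> (\<exists>c. \<forall>v\<in>V. pos (f v) = c - pos v)"
    "\<forall>j. finite {v \<in> V. pos v = j}"
    using height_ex by blast
  interpret heighted G pos by unfold_locales (use pos infinite_V in blast)+
  obtain P t D where "layered G P t D" using layered_ex_heighted by blast
  then interpret layered G P t D .
  show ?thesis by (rule ring_structure)
qed

end
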